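(* Let $g(x)=\dfrac{x^2-1}{(x^2+1)(x^2+4)(x^2+9)}$ for $x\in\mathbb{R}$. For every integer $p\ge 2$ and all $\alpha,\beta>0$ with $\alpha\beta=\frac{p}{3p-1}$, the Gabor system $\mathcal G(g,\alpha,\beta)$ is a frame for $L^2(\mathbb{R})$.
   Context: For $g\in L^2(\mathbb{R})$ nonzero and $\alpha,\beta>0$, the Gabor system is $\mathcal G(g,\alpha,\beta)=\{x\mapsto e^{2\pi i\beta m x}g(x-\alpha k): k,m\in\mathbb{Z}\}$. It is a (Gabor) frame for $L^2(\mathbb{R})$ if there exist constants $A,B>0$ such that for every $f\in L^2(\mathbb{R})$, $A\|f\|^2\le\sum_{m,k\in\mathbb{Z}}|\langle f,e^{2\pi i\beta m\cdot}g(\cdot-\alpha k)\rangle|^2\le B\|f\|^2$. *)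

theory Defs
  imports "HOL-Analysis.Analysis"
begin

text \<open>
  Elements of \<open>L\<^sup>2(\<real>)\<close> are represented by Lebesgue measurable, square-integrable,
  complex-valued functions, without passing to almost-everywhere classes; inner products
  and norms do not depend on the representative.
\<close>

definition L2_space :: "(real \<Rightarrow> complex) set" where
  "L2_space = {f. f \<in> borel_measurable lebesgue \<and>
                  integrable lebesgue (\<lambda>x. (cmod (f x))\<^sup>2)}"

definition L2_inner :: "(real \<Rightarrow> complex) \<Rightarrow> (real \<Rightarrow> complex) \<Rightarrow> complex" where
  "L2_inner f h = (LINT x|lebesgue. f x * cnj (h x))"

definition L2_norm :: "(real \<Rightarrow> complex) \<Rightarrow> real" where
  "L2_norm f = sqrt (LINT x|lebesgue. (cmod (f x))\<^sup>2)"

text \<open>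
  Frames are indexed families: repeated elements count with multiplicity. Summability is
  required explicitly because \<open>infsum\<close> is 0 on families that are not summable.
\<close>

definition L2_frame :: "('i \<Rightarrow> real \<Rightarrow> complex) \<Rightarrow> bool" where
  "L2_frame e \<longleftrightarrow>
     (\<forall>i. e i \<in> L2_space) \<and>
     (\<exists>A B :: real. A > 0 \<and> B > 0 \<and>
       (\<forall>f\<in>L2_space.
          (\<lambda>i. (cmod (L2_inner f (e i)))\<^sup>2) summable_on UNIV \<and>
          A * (L2_norm f)\<^sup>2 \<le> (\<Sum>\<^sub>\<infinity>i. (cmod (L2_inner f (e i)))\<^sup>2) \<and>
          (\<Sum>\<^sub>\<infinity>i. (cmod (L2_inner f (e i)))\<^sup>2) \<le> B * (L2_norm f)\<^sup>2))"

definition gabor_system ::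
  "(real \<Rightarrow> complex) \<Rightarrow> real \<Rightarrow> real \<Rightarrow> int \<times> int \<Rightarrow> real \<Rightarrow> complex" where
  "gabor_system g \<alpha> \<beta> = (\<lambda>(k, m) x.
     exp (2 * complex_of_real pi * \<i> * complex_of_real \<beta> * of_int m * complex_of_real x)
       * g (x - \<alpha> * of_int k))"

end

theory Submission
  imports Defs "HOL-Real_Asymp.Real_Asymp"
begin

text \<open>
  Put \<open>a = 1 / \<alpha>\<close>, \<open>\<theta> = 2 * pi * \<beta>\<close> and \<open>A = 2 * pi * a\<close>.  The Fourier transform of the window at \<open>\<xi>\<close> is a
  constant times \<open>profile (2 * pi * \<xi>)\<close>, where \<open>profile t = exp (- \<bar>t\<bar>) * (1 - exp (- \<bar>t\<bar>))\<^sup>2\<close>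
  (\<open>gwindow_inverse_fourier\<close>).  For a fixed modulation, Parseval's identity turns the sum over the translations
  into an integral over \<open>\<xi>\<close> in one period \<open>[0, a)\<close> (\<open>fibre_parseval\<close>).  Hence the frame property follows if,
  uniformly in \<open>x0\<close>, the infinite matrix \<open>profile (m * \<theta> - (x0 + j * A))\<close>, with \<open>m\<close> and \<open>j\<close> ranging over
  the integers, is bounded above and below on square-summable sequences.  The upper bound is Schur's test
  (\<open>colsum_upper\<close>).

  The lower bound (\<open>colsum_lower\<close>) is the heart of the matter.  The profile is a combination of \<open>exp (- s * \<bar>t\<bar>)\<close> for
  \<open>s = 1, 2, 3\<close>, so a suitable combination of its translates by \<open>- 3 * \<theta>, \<dots>, 3 * \<theta>\<close> is a function \<open>bump\<close> that vanishes
  outside \<open>[- 3 * \<theta>, 3 * \<theta>]\<close>; row operations therefore replace \<open>profile\<close> by \<open>bump\<close>.  The density condition says that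
  \<open>A = 3 * \<theta> - \<delta>\<close> with \<open>\<delta> = \<theta> / p\<close>, and \<open>p \<ge> 2\<close> gives \<open>0 < \<delta> \<le> \<theta> / 2\<close>.
  Thus each row of the new matrix has very few nonzero entries.  At suitable nodes six consecutive rows involve only four
  unknowns, and sign and size information on the bump shows that they determine the second unknown, with a bound that is
  uniform by compactness (\<open>mid_pair_injective\<close>, \<open>mid_pair_bound\<close>).  Every node has such a node at a bounded distance to its
  right, because the position of the nodes relative to the lattice \<open>\<theta> * \<int>\<close> slips by \<open>\<delta>\<close> at every step; from there
  the estimate is carried back to the left through rows with two nonzero entries (\<open>rowsum_lower_local\<close>).

  These arguments are carried out for continuous functions of compact support, for which Plancherel's identity is
  deduced from Parseval's (\<open>plancherel_cc\<close>).  A density argument extends the frame bounds to all square-integrable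
  functions (\<open>L2_frame_dense\<close>, \<open>cc_dense\<close>).
\<close>

abbreviation ints :: "int measure" where
  "ints \<equiv> count_space UNIV"

section \<open>A compactly supported combination of translates\<close>

text \<open>The Fourier transform of the window at \<open>\<xi>\<close> is \<open>- (pi / 12) * profile (2 * pi * \<xi>)\<close>
  (lemma \<open>gwindow_inverse_fourier\<close>).\<close>

definition profile :: "real \<Rightarrow> real" where
  "profile t = exp (- \<bar>t\<bar>) * (1 - exp (- \<bar>t\<bar>))\<^sup>2"

text \<open>The coefficients of the difference operator \<open>\<Prod>s\<in>{1,2,3}. (E + inverse E - 2 * cosh (s * \<theta>))\<close>, where
  \<open>E\<close> is translation by \<open>\<theta>\<close>.  The factor with index \<open>s\<close> kills \<open>exp (s * t)\<close> and \<open>exp (- s * t)\<close>, and on each half-line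
  \<open>profile\<close> is a combination of three such exponentials; so what remains after the operator has been
  applied is concentrated near the kink at 0.\<close>

definition stencil :: "real \<Rightarrow> int \<Rightarrow> real" where
  "stencil \<theta> i =
     (if \<bar>i\<bar> = 3 then 1
      else if \<bar>i\<bar> = 2 then - 2 * (cosh \<theta> + cosh (2*\<theta>) + cosh (3*\<theta>))
      else if \<bar>i\<bar> = 1 then 3 + 4 * (cosh \<theta> * cosh (2*\<theta>) + cosh \<theta> * cosh (3*\<theta>) + cosh (2*\<theta>) * cosh (3*\<theta>))
      else - 8 * cosh \<theta> * cosh (2*\<theta>) * cosh (3*\<theta>) - 4 * (cosh \<theta> + cosh (2*\<theta>) + cosh (3*\<theta>)))"

definition bump :: "real \<Rightarrow> real \<Rightarrow> real" where
  "bump \<theta> t = - (\<Sum>i\<in>{-3..3}. stencil \<theta> i * profile (t + of_int i * \<theta>)) / 2"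

text \<open>Twice this is the amount by which the formula for \<open>profile\<close> on the right half-line misses \<open>profile\<close>
  on the left half-line.\<close>

definition sinh_comb :: "real \<Rightarrow> real" where
  "sinh_comb x = sinh x - 2 * sinh (2*x) + sinh (3*x)"

lemma cosh_triple: "cosh (3 * x :: real) = 4 * cosh x ^ 3 - 3 * cosh x"
proof -
  have "cosh (3 * x) = cosh (2 * x + x)" by simp
  also have "\<dots> = (2 * cosh x ^ 2 - 1) * cosh x + 2 * sinh x ^ 2 * cosh x"
    unfolding cosh_add by (simp add: cosh_double_cosh sinh_double power2_eq_square)
  also have "\<dots> = 4 * cosh x ^ 3 - 3 * cosh x"
    unfolding sinh_square_eq by (simp add: algebra_simps power2_eq_square power3_eq_cube)
  finally show ?thesis .
qed

lemma sinh_triple: "sinh (3 * x :: real) = sinh x * (4 * cosh x ^ 2 - 1)"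
proof -
  have "sinh (3 * x) = sinh (2 * x + x)" by simp
  also have "\<dots> = 2 * sinh x * cosh x ^ 2 + (2 * cosh x ^ 2 - 1) * sinh x"
    unfolding sinh_add by (simp add: cosh_double_cosh sinh_double power2_eq_square)
  finally show ?thesis by (simp add: algebra_simps)
qed

lemma sinh_comb_eq: "sinh_comb x = 4 * sinh x * cosh x * (cosh x - 1)"
  unfolding sinh_comb_def sinh_triple sinh_double by (simp add: algebra_simps power2_eq_square)

lemma stencil_sum:
  fixes f :: "int \<Rightarrow> real"
  shows "(\<Sum>i\<in>{-3..3}. stencil \<theta> i * f i) =
    f (-3) + f 3 - 2 * (cosh \<theta> + cosh (2*\<theta>) + cosh (3*\<theta>)) * (f (-2) + f 2)
    + (3 + 4 * (cosh \<theta> * cosh (2*\<theta>) + cosh \<theta> * cosh (3*\<theta>) + cosh (2*\<theta>) * cosh (3*\<theta>))) * (f (-1) + f 1)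
    - (8 * cosh \<theta> * cosh (2*\<theta>) * cosh (3*\<theta>) + 4 * (cosh \<theta> + cosh (2*\<theta>) + cosh (3*\<theta>))) * f 0"
proof -
  have "{-3..3::int} = {-3,-2,-1,0,1,2,3}" by auto
  then show ?thesis by (simp add: stencil_def algebra_simps)
qed

text \<open>On \<open>exp (- s * t)\<close> translation by \<open>\<theta>\<close> is multiplication by a number, so the operator multiplies by its
  symbol, a product in which the factor with index \<open>s\<close> vanishes.\<close>

lemma stencil_kills_exp:
  assumes "s \<in> {1,2,3::real}"
  shows "(\<Sum>i\<in>{-3..3}. stencil \<theta> i * exp (- s * (t + of_int i * \<theta>))) = 0"
proof -
  define E where "E = exp (- s * \<theta>)"
  define Z where "Z = 2 * cosh (s * \<theta>)"
  have E: "E > 0" and ZE: "Z = E + inverse E"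
    unfolding E_def Z_def cosh_field_def by (auto simp: exp_minus)
  have pow: "exp (- s * (t + of_int i * \<theta>)) = exp (- s * t) * E powi i" for i :: int
    unfolding E_def exp_power_int by (simp add: exp_add[symmetric] algebra_simps)
  have p1: "E powi (-1) + E powi 1 = Z" unfolding ZE by (simp add: power_int_minus)
  have p2: "E powi (-2) + E powi 2 = Z^2 - 2" unfolding ZE using E
    by (simp add: power_int_minus power2_eq_square field_simps)
  have p3: "E powi (-3) + E powi 3 = Z^3 - 3*Z" unfolding ZE using E
    by (simp add: power_int_minus power2_eq_square power3_eq_cube field_simps)
  have "Z \<in> {2 * cosh \<theta>, 2 * cosh (2*\<theta>), 2 * cosh (3*\<theta>)}" using assms unfolding Z_def by auto
  then have "(Z - 2 * cosh \<theta>) * (Z - 2 * cosh (2*\<theta>)) * (Z - 2 * cosh (3*\<theta>)) = 0" by auto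
  moreover have "(\<Sum>i\<in>{-3..3}. stencil \<theta> i * exp (- s * (t + of_int i * \<theta>)))
     = exp (- s * t) * (\<Sum>i\<in>{-3..3}. stencil \<theta> i * E powi i)"
    unfolding pow sum_distrib_left by (simp add: algebra_simps)
  moreover have "(\<Sum>i\<in>{-3..3}. stencil \<theta> i * E powi i)
     = (Z - 2 * cosh \<theta>) * (Z - 2 * cosh (2*\<theta>)) * (Z - 2 * cosh (3*\<theta>))"
    unfolding stencil_sum p1 p2 p3 power_int_0_right
    by (simp add: algebra_simps power2_eq_square power3_eq_cube)
  ultimately show ?thesis by simp
qed

lemma profile_split:
  "profile t = exp (- 1 * t) - 2 * exp (- 2 * t) + exp (- 3 * t) - 2 * sinh_comb (max 0 (- t))"
proof (cases "t \<ge> 0")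
  case True
  have "exp (- 2 * t) = exp (-t) ^ 2" "exp (- 3 * t) = exp (-t) ^ 3"
    by (simp_all add: exp_of_nat_mult[symmetric])
  then show ?thesis using True unfolding profile_def sinh_comb_def
    by (simp add: max_def algebra_simps power2_eq_square power3_eq_cube)
next
  case False
  have "exp (2 * t) = exp t ^ 2" "exp (3 * t) = exp t ^ 3"
    by (simp_all add: exp_of_nat_mult[symmetric])
  then show ?thesis using False unfolding profile_def sinh_comb_def sinh_field_def
    by (simp add: max_def field_simps power2_eq_square power3_eq_cube)
qed

lemma bump_eq: "bump \<theta> t = (\<Sum>i\<in>{-3..3}. stencil \<theta> i * sinh_comb (max 0 (- (t + of_int i * \<theta>))))"
proof -
  let ?s = "\<lambda>f. \<Sum>i\<in>{-3..3}. stencil \<theta> i * f (t + of_int i * \<theta>)"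
  have "?s profile = ?s (\<lambda>x. exp (- 1 * x)) - 2 * ?s (\<lambda>x. exp (- 2 * x)) + ?s (\<lambda>x. exp (- 3 * x))
      - 2 * ?s (\<lambda>x. sinh_comb (max 0 (- x)))"
    unfolding profile_split[abs_def]
    by (simp add: sum.distrib sum_subtractf sum_distrib_left algebra_simps)
  also have "\<dots> = - 2 * ?s (\<lambda>x. sinh_comb (max 0 (- x)))"
    using stencil_kills_exp[of 1 \<theta> t] stencil_kills_exp[of 2 \<theta> t] stencil_kills_exp[of 3 \<theta> t] by simp
  finally show ?thesis unfolding bump_def by simp
qed

lemma sinh_comb_0 [simp]: "sinh_comb 0 = 0" by (simp add: sinh_comb_def)

lemma profile_even: "profile (- t) = profile t" by (simp add: profile_def)

lemma bump_even: "bump \<theta> (- t) = bump \<theta> t"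
proof -
  have "profile (- t + of_int i * \<theta>) = profile (t + of_int (- i) * \<theta>)" for i
    using profile_even[of "t + of_int (- i) * \<theta>"] by (simp add: algebra_simps)
  moreover have "stencil \<theta> (- i) = stencil \<theta> i" for i by (simp add: stencil_def)
  ultimately have "(\<Sum>i\<in>{-3..3}. stencil \<theta> i * profile (- t + of_int i * \<theta>)) =
      (\<Sum>i\<in>{-3..3}. stencil \<theta> i * profile (t + of_int i * \<theta>))"
    by (intro sum.reindex_bij_witness[of _ uminus uminus]) auto
  then show ?thesis by (simp add: bump_def)
qed

text \<open>For \<open>t \<ge> 3 * \<theta>\<close> all seven nodes lie on the right half-line, where only exponentials are seen; evenness
  gives the other side.\<close>

lemma bump_eq_0:
  assumes "\<theta> > 0" "\<bar>t\<bar> \<ge> 3 * \<theta>"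
  shows "bump \<theta> t = 0"
proof -
  have *: "bump \<theta> t = 0" if "t \<ge> 3 * \<theta>" for t
  proof -
    have "max 0 (- (t + of_int i * \<theta>)) = 0" if "i \<in> {-3..3}" for i :: int
    proof -
      have "of_int (-3) * \<theta> \<le> of_int i * \<theta>" using that assms(1) by (intro mult_right_mono) auto
      then show ?thesis using \<open>t \<ge> 3 * \<theta>\<close> by simp
    qed
    then show ?thesis unfolding bump_eq by (intro sum.neutral) auto
  qed
  show ?thesis using *[of t] *[of "-t"] assms(2) bump_even[of \<theta> t] by (cases "t \<ge> 0") auto
qed

lemma bump_outer:
  assumes "\<theta> > 0" "2 * \<theta> \<le> t" "t \<le> 3 * \<theta>"
  shows "bump \<theta> t = sinh_comb (3 * \<theta> - t)"
  unfolding bump_eq stencil_sum using assms by simp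

lemma bump_middle_aux:
  assumes "\<theta> > 0" "\<theta> \<le> t" "t \<le> 2 * \<theta>"
  shows "bump \<theta> t = sinh_comb (3 * \<theta> - t)
    - 2 * (cosh \<theta> + cosh (2*\<theta>) + cosh (3*\<theta>)) * sinh_comb (2 * \<theta> - t)"
  unfolding bump_eq stencil_sum using assms by simp

lemma bump_inner_aux:
  assumes "\<theta> > 0" "0 \<le> t" "t \<le> \<theta>"
  shows "bump \<theta> t = sinh_comb (3 * \<theta> - t)
    - 2 * (cosh \<theta> + cosh (2*\<theta>) + cosh (3*\<theta>)) * sinh_comb (2 * \<theta> - t)
    + (3 + 4 * (cosh \<theta> * cosh (2*\<theta>) + cosh \<theta> * cosh (3*\<theta>) + cosh (2*\<theta>) * cosh (3*\<theta>)))
      * sinh_comb (\<theta> - t)"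
  unfolding bump_eq stencil_sum using assms by simp

text \<open>On the cells \<open>[\<theta>, 2\<theta>]\<close> and \<open>[0, \<theta>]\<close> the bump has the form \<open>sinh t * p + sinh (\<theta> - t) * q\<close> with \<open>p\<close> and \<open>q\<close>
  polynomials in hyperbolic cosines; \<open>ucoef\<close> and \<open>vcoef\<close> are these polynomials, with \<open>c\<close> standing for \<open>cosh \<theta>\<close>.
  The positivity questions thereby become polynomial ones.\<close>

definition ucoef :: "real \<Rightarrow> real \<Rightarrow> real" where
  "ucoef c T = 8 * (2*c*(2*c\<^sup>2 - 1)*T - c*(c\<^sup>2 - 1) - (2*c - 1)*(c + 1)*T\<^sup>2)"

definition vcoef :: "real \<Rightarrow> real \<Rightarrow> real" where
  "vcoef c X = 8*X*(X - 1)
     + 16*c*((c\<^sup>2 - 1)*(2*c\<^sup>2 - 1) - (4*c^3 - 3*c)*X + (2*c\<^sup>2 - 1)*X\<^sup>2)"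

lemma sinh_shift: "sinh (a + y :: real) = 2 * cosh a * sinh y + sinh (a - y)"
  by (simp add: sinh_add sinh_diff algebra_simps)

lemma sinh_shift2: "sinh (2 * a + y :: real) = 2 * cosh a * sinh (a + y) - sinh y"
proof -
  have "sinh (2 * a + y) = sinh (a + (a + y))" by (simp add: algebra_simps)
  then show ?thesis unfolding sinh_shift[of a "a + y"] by simp
qed

lemma bump_middle:
  assumes "\<theta> > 0" "0 \<le> t" "t \<le> \<theta>"
  shows "bump \<theta> (t + \<theta>) = sinh t * (4 * cosh t * (cosh t - 1))
    + sinh (\<theta> - t) * ucoef (cosh \<theta>) (cosh (\<theta> - t))"
proof -
  define x where "x = \<theta> - t"
  define C1 C2 C3 where "C1 = cosh \<theta>" and "C2 = cosh (2*\<theta>)" and "C3 = cosh (3*\<theta>)"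
  have e: "sinh (s*(\<theta> + x)) = 2 * cosh (s*\<theta>) * sinh (s*x) + sinh (s*t)" for s
    using sinh_shift[of "s*\<theta>" "s*x"] unfolding x_def by (simp add: algebra_simps)
  have e1: "sinh (\<theta> + x) = 2 * C1 * sinh x + sinh t" using e[of 1] by (simp add: C1_def)
  have e2: "sinh (2*(\<theta> + x)) = 2 * C2 * sinh (2*x) + sinh (2*t)" using e[of 2] by (simp add: C2_def)
  have e3: "sinh (3*(\<theta> + x)) = 2 * C3 * sinh (3*x) + sinh (3*t)" using e[of 3] by (simp add: C3_def)
  have "bump \<theta> (t + \<theta>) = sinh_comb (\<theta> + x) - 2 * (C1 + C2 + C3) * sinh_comb x"
    using bump_middle_aux[of \<theta> "t + \<theta>"] assms unfolding x_def C1_def C2_def C3_def by (simp add: algebra_simps)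
  also have "\<dots> = sinh_comb t - 2*(C2 + C3) * sinh x + 4*(C1 + C3) * sinh (2*x) - 2*(C1 + C2) * sinh (3*x)"
    unfolding sinh_comb_def e1 e2 e3 by (simp add: algebra_simps)
  also have "\<dots> = sinh t * (4 * cosh t * (cosh t - 1)) + sinh x * ucoef C1 (cosh x)"
    unfolding sinh_comb_eq sinh_triple sinh_double C2_def C3_def cosh_double_cosh cosh_triple C1_def ucoef_def
    by (simp add: algebra_simps power2_eq_square power3_eq_cube)
  finally show ?thesis by (simp add: x_def C1_def)
qed

lemma bump_inner:
  assumes "\<theta> > 0" "0 \<le> t" "t \<le> \<theta>"
  shows "bump \<theta> t = sinh t * ucoef (cosh \<theta>) (cosh t) + sinh (\<theta> - t) * vcoef (cosh \<theta>) (cosh (\<theta> - t))"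
proof -
  define x where "x = \<theta> - t"
  define C1 C2 C3 where "C1 = cosh \<theta>" and "C2 = cosh (2*\<theta>)" and "C3 = cosh (3*\<theta>)"
  have e: "sinh (s*(\<theta> + x)) = 2 * cosh (s*\<theta>) * sinh (s*x) + sinh (s*t)" for s
    using sinh_shift[of "s*\<theta>" "s*x"] unfolding x_def by (simp add: algebra_simps)
  have f: "sinh (s*(2*\<theta> + x)) = 2 * cosh (s*\<theta>) * sinh (s*(\<theta> + x)) - sinh (s*x)" for s
    using sinh_shift2[of "s*\<theta>" "s*x"] by (simp add: algebra_simps)
  have e1: "sinh (\<theta> + x) = 2 * C1 * sinh x + sinh t" using e[of 1] by (simp add: C1_def)
  have e2: "sinh (2*(\<theta> + x)) = 2 * C2 * sinh (2*x) + sinh (2*t)" using e[of 2] by (simp add: C2_def)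
  have e3: "sinh (3*(\<theta> + x)) = 2 * C3 * sinh (3*x) + sinh (3*t)" using e[of 3] by (simp add: C3_def)
  have f1: "sinh (2*\<theta> + x) = 2 * C1 * sinh (\<theta> + x) - sinh x" using f[of 1] by (simp add: C1_def)
  have f2: "sinh (2*(2*\<theta> + x)) = 2 * C2 * sinh (2*(\<theta> + x)) - sinh (2*x)" using f[of 2] by (simp add: C2_def)
  have f3: "sinh (3*(2*\<theta> + x)) = 2 * C3 * sinh (3*(\<theta> + x)) - sinh (3*x)" using f[of 3] by (simp add: C3_def)
  have "bump \<theta> t = sinh_comb (2*\<theta> + x) - 2 * (C1 + C2 + C3) * sinh_comb (\<theta> + x)
      + (3 + 4 * (C1*C2 + C1*C3 + C2*C3)) * sinh_comb x"
    using bump_inner_aux[of \<theta> t] assms unfolding x_def C1_def C2_def C3_def by (simp add: algebra_simps)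
  also have "\<dots> = (2 + 4*C2*C3) * sinh x - 2*(2 + 4*C1*C3) * sinh (2*x) + (2 + 4*C1*C2) * sinh (3*x)
      - 2*(C2 + C3) * sinh t + 4*(C1 + C3) * sinh (2*t) - 2*(C1 + C2) * sinh (3*t)"
    unfolding sinh_comb_def f1 f2 f3 e1 e2 e3 by (simp add: algebra_simps)
  also have "\<dots> = sinh t * ucoef C1 (cosh t) + sinh x * vcoef C1 (cosh x)"
    unfolding sinh_triple sinh_double C2_def C3_def cosh_double_cosh cosh_triple C1_def ucoef_def vcoef_def
    by (simp add: algebra_simps power2_eq_square power3_eq_cube)
  finally show ?thesis by (simp add: x_def C1_def)
qed

lemma continuous_bump: "continuous_on UNIV (bump \<theta>)"
  unfolding bump_def[abs_def] profile_def by (intro continuous_intros) auto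

section \<open>Size and sign of the bump\<close>

text \<open>Most positivity statements below concern expressions that are concave quadratic in one variable, for which
  the two ends of the range suffice.\<close>

lemma concave_quadratic_pos:
  fixes a b d l r T :: real
  assumes a: "a \<le> 0" and T: "l \<le> T" "T \<le> r"
    and ends: "0 < a * l\<^sup>2 + b * l + d" "0 < a * r\<^sup>2 + b * r + d"
  shows "0 < a * T\<^sup>2 + b * T + d"
proof (cases "T = l \<or> T = r")
  case True
  then show ?thesis using ends by blast
next
  case False
  then have T: "0 < T - l" "0 < r - T" "0 < r - l" using T by auto
  have "0 < (r - T) * (a * l\<^sup>2 + b * l + d)" by (rule mult_pos_pos[OF T(2) ends(1)])
  moreover have "0 < (T - l) * (a * r\<^sup>2 + b * r + d)" by (rule mult_pos_pos[OF T(1) ends(2)])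
  moreover have "0 \<le> (- a) * ((T - l) * (r - T) * (r - l))"
    by (rule mult_nonneg_nonneg) (use a T in auto)
  ultimately have "0 < (r - T) * (a * l\<^sup>2 + b * l + d) + (T - l) * (a * r\<^sup>2 + b * r + d)
      + (- a) * ((T - l) * (r - T) * (r - l))" by (rule add_pos_nonneg[OF add_pos_pos])
  also have "\<dots> = (r - l) * (a * T\<^sup>2 + b * T + d)"
    by (simp add: algebra_simps power2_eq_square)
  finally show ?thesis using T(3) zero_less_mult_pos by blast
qed

text \<open>The coefficients of \<open>sinh t\<close> and \<open>sinh (\<theta> - t)\<close> in \<open>bump \<theta> t - \<nu> * bump \<theta> (t + \<theta>)\<close>
  (lemma \<open>bump_combination\<close>).\<close>

definition tcoef :: "real \<Rightarrow> real \<Rightarrow> real \<Rightarrow> real" where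
  "tcoef \<nu> c T = ucoef c T - 4 * \<nu> * T * (T - 1)"

definition xcoef :: "real \<Rightarrow> real \<Rightarrow> real \<Rightarrow> real" where
  "xcoef \<nu> c X = vcoef c X - \<nu> * ucoef c X"

lemma tcoef_concave_pos:
  assumes c: "c \<ge> 1" and \<mu>: "\<mu> > 0" and T: "l \<le> T" "T \<le> r" and lam: "- 4 \<le> \<nu>"
    and pos: "0 < \<mu> * tcoef \<nu> c l + w" "0 < \<mu> * tcoef \<nu> c r + w"
  shows "0 < \<mu> * tcoef \<nu> c T + w"
proof -
  have e: "\<mu> * tcoef \<nu> c T + w =
     (\<mu> * (- 8 * ((2*c - 1)*(c + 1)) - 4 * \<nu>)) * T\<^sup>2 + (\<mu> * (16*c*(2*c\<^sup>2 - 1) + 4 * \<nu>)) * T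
       + (w - \<mu> * (8*c*(c\<^sup>2 - 1)))" for T
    by (simp add: tcoef_def ucoef_def algebra_simps power2_eq_square)
  define B where "B = (2*c - 1)*(c + 1)"
  have "1 * 2 \<le> B" unfolding B_def using c by (intro mult_mono) linarith+
  then have "- 8 * B - 4 * \<nu> \<le> 0" using lam by linarith
  then have "\<mu> * (- 8 * ((2*c - 1)*(c + 1)) - 4 * \<nu>) \<le> 0"
    unfolding B_def using \<mu> by (intro mult_nonneg_nonpos) linarith+
  then show ?thesis unfolding e by (rule concave_quadratic_pos[OF _ T pos[unfolded e]])
qed

lemma ucoef_at_1: "ucoef c 1 = 8 * (c - 1) * (3*c\<^sup>2 + c - 1)"
  by (simp add: ucoef_def algebra_simps power2_eq_square)

lemma ucoef_at_c: "ucoef c c = 8 * c * (c - 1) * (2*c\<^sup>2 - 1)"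
  by (simp add: ucoef_def algebra_simps power2_eq_square)

lemma ucoef_pos:
  assumes "c > 1" "1 \<le> T" "T \<le> c"
  shows "ucoef c T > 0"
proof -
  have "c\<^sup>2 > 1" using assms(1) by simp
  then have "3*c\<^sup>2 + c - 1 > 0" "2*c\<^sup>2 - 1 > 0" using assms(1) by linarith+
  then have ends: "0 < ucoef c 1" "0 < ucoef c c"
    unfolding ucoef_at_1 ucoef_at_c using assms(1) by simp_all
  have "0 < 1 * tcoef 0 c T + 0"
    by (rule tcoef_concave_pos[OF _ _ assms(2,3)]) (use assms(1) ends in \<open>auto simp: tcoef_def\<close>)
  then show ?thesis by (simp add: tcoef_def)
qed

text \<open>Concavity in \<open>T\<close> leaves the ends \<open>1\<close> and \<open>c\<close>.  There, in terms of \<open>n = c - 1\<close>, \<open>m = X - 1\<close> and the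
  nonnegative slack \<open>n - 4 * m\<close>, the expression is a polynomial without negative coefficients.  The multipliers 1 (here)
  and 3, 7 (below) are the lower bounds for \<open>sinh t / sinh (\<theta> - t)\<close> when \<open>t\<close> is at least \<open>\<theta>/2\<close>, \<open>3\<theta>/4\<close>,
  \<open>7\<theta>/8\<close>.\<close>

lemma coef_half_low:
  assumes c: "c > 1" and T: "1 \<le> T" "T \<le> c" and X: "1 \<le> X" "X \<le> (c + 3) / 4"
  shows "0 < 2 * tcoef (-3/2) c T + 2 * xcoef (-3/2) c X"
proof -
  define m n where "m = X - 1" and "n = c - 1"
  have nm: "n > 0" "n \<ge> 0" "m \<ge> 0" "n - 4 * m \<ge> 0"
    using c X by (simp_all add: m_def n_def)
  have c_eq: "c = 1 + n" and X_eq: "X = 1 + m" unfolding m_def n_def by auto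
  have "0 < 24*n + (40*n*m^2 + 152*n^2 + 144*n^2*m^2 + 192*n^3 + 64*n^3*m^2 + 120*n^4 + 32*n^5
      + (24*n^2 + 72*n^3 + 32*n^4) * (n - 4 * m))"
    by (rule add_pos_nonneg; (intro add_nonneg_nonneg mult_nonneg_nonneg mult_pos_pos zero_le_power
        zero_le_numeral zero_less_numeral nm)?)
  also have "\<dots> = 2 * ucoef c 1 + (2 * vcoef c X + 3 * ucoef c X)"
    unfolding c_eq X_eq ucoef_def vcoef_def by (simp add: algebra_simps eval_nat_numeral)
  finally have 1: "0 < 2 * tcoef (-3/2) c 1 + 2 * xcoef (-3/2) c X" by (simp add: tcoef_def xcoef_def field_simps)
  have "0 < 4*n + (40*n*m^2 + 132*n^2 + 144*n^2*m^2 + 240*n^3 + 64*n^3*m^2 + 152*n^4 + 32*n^5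
      + (24*n^2 + 72*n^3 + 32*n^4) * (n - 4 * m))"
    by (rule add_pos_nonneg; (intro add_nonneg_nonneg mult_nonneg_nonneg mult_pos_pos zero_le_power
        zero_le_numeral zero_less_numeral nm)?)
  also have "\<dots> = 2 * ucoef c c + 12 * c * (c - 1) + (2 * vcoef c X + 3 * ucoef c X)"
    unfolding c_eq X_eq ucoef_def vcoef_def by (simp add: algebra_simps eval_nat_numeral)
  finally have 2: "0 < 2 * tcoef (-3/2) c c + 2 * xcoef (-3/2) c X" by (simp add: tcoef_def xcoef_def field_simps)
  show ?thesis
    by (rule tcoef_concave_pos[OF _ _ T _ 1 2]) (use c in auto)
qed

text \<open>The multiplier 3 serves up to \<open>(7 * c + 1) / 8\<close>, a bound for \<open>cosh (7\<theta>/8)\<close>; beyond \<open>7\<theta>/8\<close> the larger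
  multiplier 7 is available.\<close>

lemma coef_quarter_low:
  assumes c: "c > 1" and X: "1 \<le> X" "X \<le> (c + 3) / 4" and T: "1 \<le> T"
  shows "T \<le> c \<Longrightarrow> 0 < 21 * tcoef (-2/3) c T + 3 * xcoef (-2/3) c X"
    and "T \<le> (7*c + 1)/8 \<Longrightarrow> 0 < 9 * tcoef (-2/3) c T + 3 * xcoef (-2/3) c X"
proof -
  define m k where "m = X - 1" and "k = (c - 1) / 8"
  have nm: "k > 0" "k \<ge> 0" "m \<ge> 0" "8 * k - 4 * m \<ge> 0"
    using c X by (simp_all add: m_def k_def)
  have c_eq: "c = 1 + 8*k" and X_eq: "X = 1 + m" by (simp_all add: m_def k_def field_simps)
  \<comment> \<open>The substitution \<open>c = 1 + 8 * k\<close> keeps the coefficients below integral at this point as well.\<close>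
  define T1 where "T1 = (7*c + 1)/8"
  have T1_eq: "T1 = 1 + 7*k" unfolding T1_def c_eq by simp
  have "0 < 1024*k + (40*m + 40*m^2 + 1280*k*m^2 + 52224*k^2 + 16384*k^2*m^2 + 575488*k^3 + 49152*k^3*m^2 + 2031616*k^4 + 1572864*k^5
      + (4864*k^2 + 65536*k^3 + 196608*k^4) * (8*k - 4 * m))"
    by (rule add_pos_nonneg; (intro add_nonneg_nonneg mult_nonneg_nonneg mult_pos_pos zero_le_power
        zero_le_numeral zero_less_numeral nm)?)
  also have "\<dots> = 21 * ucoef c c + 56 * c * (c - 1) + (3 * vcoef c X + 2 * ucoef c X)"
    unfolding c_eq X_eq ucoef_def vcoef_def by (simp add: algebra_simps eval_nat_numeral)
  finally have 1: "0 < 21 * tcoef (-2/3) c c + 3 * xcoef (-2/3) c X" by (simp add: tcoef_def xcoef_def field_simps)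
  have "0 < 960*k + (40*m + 40*m^2 + 1280*k*m^2 + 27136*k^2 + 16384*k^2*m^2 + 169984*k^3 + 49152*k^3*m^2 + 655360*k^4 + 1572864*k^5
      + (4864*k^2 + 65536*k^3 + 196608*k^4) * (8*k - 4 * m))"
    by (rule add_pos_nonneg; (intro add_nonneg_nonneg mult_nonneg_nonneg mult_pos_pos zero_le_power
        zero_le_numeral zero_less_numeral nm)?)
  also have "\<dots> = 9 * ucoef c 1 + (3 * vcoef c X + 2 * ucoef c X)"
    unfolding c_eq X_eq ucoef_def vcoef_def by (simp add: algebra_simps eval_nat_numeral)
  finally have 2: "0 < 9 * tcoef (-2/3) c 1 + 3 * xcoef (-2/3) c X" by (simp add: tcoef_def xcoef_def field_simps)
  have "0 < 120*k + (40*m + 40*m^2 + 1280*k*m^2 + 21256*k^2 + 16384*k^2*m^2 + 286912*k^3 + 49152*k^3*m^2 + 1235968*k^4 + 1572864*k^5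
      + (4864*k^2 + 65536*k^3 + 196608*k^4) * (8*k - 4 * m))"
    by (rule add_pos_nonneg; (intro add_nonneg_nonneg mult_nonneg_nonneg mult_pos_pos zero_le_power
        zero_le_numeral zero_less_numeral nm)?)
  also have "\<dots> = 9 * ucoef c T1 + 24 * T1 * (T1 - 1) + (3 * vcoef c X + 2 * ucoef c X)"
    unfolding T1_eq c_eq X_eq ucoef_def vcoef_def by (simp add: algebra_simps eval_nat_numeral)
  finally have 3: "0 < 9 * tcoef (-2/3) c T1 + 3 * xcoef (-2/3) c X" by (simp add: tcoef_def xcoef_def field_simps)
  have "0 < tcoef (-2/3) c 1" using ucoef_pos[of c 1] c by (simp add: tcoef_def)
  then have 4: "0 < 21 * tcoef (-2/3) c 1 + 3 * xcoef (-2/3) c X" using 2 by linarith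
  show "0 < 21 * tcoef (-2/3) c T + 3 * xcoef (-2/3) c X" if "T \<le> c"
    by (rule tcoef_concave_pos[OF _ _ T that _ 4 1]) (use c in auto)
  show "0 < 9 * tcoef (-2/3) c T + 3 * xcoef (-2/3) c X" if "T \<le> (7*c + 1)/8"
    by (rule tcoef_concave_pos[OF _ _ T that[folded T1_def] _ 2 3]) (use c in auto)
qed

text \<open>For \<open>c \<ge> 2\<close> the largest admissible \<open>X\<close> is the worst one, so a one-variable polynomial inequality remains.
  The difference is written as a quadratic in the distance \<open>d\<close> from that end, with nonnegative coefficients; in terms of
  \<open>n = c - 2\<close> their signs can be read off.\<close>

lemma xcoef_antimono:
  assumes c: "c \<ge> 2" and X: "1 \<le> X" "X \<le> (c + 3) / 4" and lam: "0 \<le> \<nu>" "\<nu> \<le> 2"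
  shows "xcoef \<nu> c ((c + 3) / 4) \<le> xcoef \<nu> c X"
proof -
  define n d where "n = c - 2" and "d = (c + 3) / 4 - X"
  have nd: "n \<ge> 0" "d \<ge> 0" and c_eq: "c = 2 + n" and X_eq: "X = (c + 3) / 4 - d"
    using c X unfolding n_def d_def by auto
  have "xcoef \<nu> c X - xcoef \<nu> c ((c + 3) / 4)
     = d\<^sup>2 * (8 + 16*c*(2*c\<^sup>2 - 1) + 8 * \<nu> * ((2*c - 1) * (c + 1)))
     + d * (16*c*((4*c^3 - 3*c) - (2*c\<^sup>2 - 1)*(c+3)/2) + 8 - 4 * (c + 3))
     + \<nu> * d * (8 * (2*c*(2*c\<^sup>2 - 1) - (2*c - 1)*(c + 1)*(c + 3)/2))"
    unfolding X_eq xcoef_def ucoef_def vcoef_def by (simp add: field_simps power2_eq_square power3_eq_cube)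
  moreover have "d\<^sup>2 * (8 + 16*c*(2*c\<^sup>2 - 1) + 8 * \<nu> * ((2*c - 1) * (c + 1))) \<ge> 0"
  proof -
    have "c\<^sup>2 \<ge> 1" using c by (simp add: one_le_power)
    then have "2 * c\<^sup>2 - 1 \<ge> 0" by linarith
    then show ?thesis using c lam by (intro mult_nonneg_nonneg add_nonneg_nonneg) auto
  qed
  moreover have "16*c*((4*c^3 - 3*c) - (2*c\<^sup>2 - 1)*(c+3)/2) + 8 - 4 * (c + 3) \<ge> 0"
  proof -
    have "16*c*((4*c^3 - 3*c) - (2*c\<^sup>2 - 1)*(c+3)/2) + 8 - 4 * (c + 3)
       = 260 + 820*n + 824*n\<^sup>2 + 336*n^3 + 48*n^4"
      unfolding c_eq by (simp add: field_simps power2_eq_square power3_eq_cube power4_eq_xxxx)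
    then show ?thesis using nd by simp
  qed
  moreover have "8 * (2*c*(2*c\<^sup>2 - 1) - (2*c - 1)*(c + 1)*(c + 3)/2) \<ge> 0"
  proof -
    have "8 * (2*c*(2*c\<^sup>2 - 1) - (2*c - 1)*(c + 1)*(c + 3)/2) = 44 + 152*n + 116*n\<^sup>2 + 24*n^3"
      unfolding c_eq by (simp add: field_simps power2_eq_square power3_eq_cube)
    then show ?thesis using nd by simp
  qed
  ultimately show ?thesis using nd lam by (smt (verit, best) mult_nonneg_nonneg)
qed

lemma coef_half_high:
  assumes c: "c \<ge> 2" and T: "1 \<le> T" "T \<le> c" and X: "1 \<le> X" "X \<le> (c + 3) / 4"
  shows "0 < 1 * tcoef (1/2) c T + xcoef (1/2) c X"
proof -
  define n where "n = c - 2"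
  have n: "n \<ge> 0" and c_eq: "c = 2 + n" using c unfolding n_def by auto
  define Y where "Y = (c + 3) / 4"
  have Y_eq: "Y = 5/4 + n/4" unfolding Y_def c_eq by (simp add: field_simps)
  have "0 < 1/4 * (115 + 1051*n + 2063*n^2 + 1617*n^3 + 562*n^4 + 72*n^5)"
    using n by (intro mult_pos_pos add_pos_nonneg) auto
  also have "\<dots> = 1 * tcoef (1/2) c 1 + xcoef (1/2) c Y"
    unfolding tcoef_def xcoef_def Y_eq c_eq ucoef_def vcoef_def by (simp add: field_simps eval_nat_numeral)
  finally have 1: "0 < 1 * tcoef (1/2) c 1 + xcoef (1/2) c Y" .
  have "0 < 1/4 * (131 + 1379*n + 2663*n^2 + 1969*n^3 + 626*n^4 + 72*n^5)"
    using n by (intro mult_pos_pos add_pos_nonneg) auto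
  also have "\<dots> = 1 * tcoef (1/2) c c + xcoef (1/2) c Y"
    unfolding tcoef_def xcoef_def Y_eq c_eq ucoef_def vcoef_def by (simp add: field_simps eval_nat_numeral)
  finally have 2: "0 < 1 * tcoef (1/2) c c + xcoef (1/2) c Y" .
  have "0 < 1 * tcoef (1/2) c T + xcoef (1/2) c Y"
    by (rule tcoef_concave_pos[OF _ _ T _ 1 2]) (use c in auto)
  also have "\<dots> \<le> 1 * tcoef (1/2) c T + xcoef (1/2) c X"
    unfolding Y_def using c X by (intro add_left_mono xcoef_antimono) auto
  finally show ?thesis .
qed

lemma coef_quarter_high:
  assumes c: "c \<ge> 2" and T: "1 \<le> T" "T \<le> c" and X: "1 \<le> X" "X \<le> (c + 3) / 4"
  shows "0 < 3 * tcoef 2 c T + xcoef 2 c X"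
proof -
  define n where "n = c - 2"
  have n: "n \<ge> 0" and c_eq: "c = 2 + n" using c unfolding n_def by auto
  define Y where "Y = (c + 3) / 4"
  have Y_eq: "Y = 5/4 + n/4" unfolding Y_def c_eq by (simp add: field_simps)
  have "0 < 1/2 * (115 + 546*n + 915*n^2 + 708*n^3 + 260*n^4 + 36*n^5)"
    using n by (intro mult_pos_pos add_pos_nonneg) auto
  also have "\<dots> = 3 * tcoef 2 c 1 + xcoef 2 c Y"
    unfolding tcoef_def xcoef_def Y_eq c_eq ucoef_def vcoef_def by (simp add: field_simps eval_nat_numeral)
  finally have 1: "0 < 3 * tcoef 2 c 1 + xcoef 2 c Y" .
  have "0 < 1/2 * (67 + 930*n + 1779*n^2 + 1236*n^3 + 356*n^4 + 36*n^5)"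
    using n by (intro mult_pos_pos add_pos_nonneg) auto
  also have "\<dots> = 3 * tcoef 2 c c + xcoef 2 c Y"
    unfolding tcoef_def xcoef_def Y_eq c_eq ucoef_def vcoef_def by (simp add: field_simps eval_nat_numeral)
  finally have 2: "0 < 3 * tcoef 2 c c + xcoef 2 c Y" .
  have "0 < 3 * tcoef 2 c T + xcoef 2 c Y"
    by (rule tcoef_concave_pos[OF _ _ T _ 1 2]) (use c in auto)
  also have "\<dots> \<le> 3 * tcoef 2 c T + xcoef 2 c X"
    unfolding Y_def using c X by (intro add_left_mono xcoef_antimono) auto
  finally show ?thesis .
qed

lemma tcoef_2_pos:
  assumes c: "c \<ge> 2" and T: "1 \<le> T" "T \<le> c"
  shows "0 < tcoef 2 c T"
proof -
  have e: "tcoef 2 c c = 8 * c * (c - 1) * (2 * c\<^sup>2 - 2)"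
    by (simp add: tcoef_def ucoef_at_c algebra_simps)
  have "c\<^sup>2 > 1" using c by simp
  then have "0 < tcoef 2 c c" unfolding e using c by (intro mult_pos_pos) auto
  moreover have "0 < tcoef 2 c 1" using ucoef_pos[of c 1] c by (simp add: tcoef_def)
  ultimately have "0 < 1 * tcoef 2 c T + 0"
    by (intro tcoef_concave_pos[OF _ _ T]) (use c in auto)
  then show ?thesis by simp
qed

text \<open>The upper bound for \<open>ucoef\<close> and minus three times \<open>vcoef\<close> are compared at the ends of the range of \<open>X\<close>;
  their difference is concave in \<open>X\<close>.\<close>

lemma coef_start_neg:
  assumes c: "1 < c" "c \<le> 2" and X: "(c + 1) / 2 \<le> X" "X \<le> c" and T: "1 \<le> T" "T \<le> 1 + (c - 1) / 16"
  shows "ucoef c T + 3 * vcoef c X < 0"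
proof -
  have "c\<^sup>2 > 1" using c by simp
  have u: "ucoef c T \<le> (c - 1) * (24 * c\<^sup>2 + 8 * c - 3)"
  proof -
    have "ucoef c T = 8 * (c - 1) * (3*c\<^sup>2 + c - 1) + 8 * (4*c^3 - 4*c\<^sup>2 - 4*c + 2) * (T - 1)
        - 8 * ((2*c - 1)*(c + 1)) * (T - 1)\<^sup>2"
      by (simp add: ucoef_def algebra_simps power2_eq_square power3_eq_cube)
    moreover have "8 * ((2*c - 1)*(c + 1)) * (T - 1)\<^sup>2 \<ge> 0" using c by simp
    moreover have "8 * (4*c^3 - 4*c\<^sup>2 - 4*c + 2) * (T - 1) \<le> 80 * ((c - 1) / 16)"
    proof -
      have "4*c^3 - 4*c\<^sup>2 - 4*c + 2 = 10 - (2 - c) * (4 * c\<^sup>2 + 4 * c + 4)"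
        by (simp add: algebra_simps power2_eq_square power3_eq_cube)
      moreover have "(2 - c) * (4 * c\<^sup>2 + 4 * c + 4) \<ge> 0" using c by simp
      ultimately have "8 * (4*c^3 - 4*c\<^sup>2 - 4*c + 2) * (T - 1) \<le> 80 * (T - 1)"
        using T by (intro mult_right_mono) auto
      also have "\<dots> \<le> 80 * ((c - 1) / 16)" using T by (simp add: field_simps)
      finally show ?thesis .
    qed
    ultimately show ?thesis by (simp add: algebra_simps power2_eq_square)
  qed
  have "0 < (- 3 * (8 + 16 * c * (2*c\<^sup>2 - 1))) * X\<^sup>2 + (3 * (8 + 16 * c * (4*c^3 - 3*c))) * X
      + (- 3 * (16 * c * ((c\<^sup>2 - 1)*(2*c\<^sup>2 - 1))) - (c - 1) * (24 * c\<^sup>2 + 8 * c - 3))" (is "0 < ?q X")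
  proof (rule concave_quadratic_pos[OF _ X])
    show "- 3 * (8 + 16 * c * (2*c\<^sup>2 - 1)) \<le> 0"
    proof -
      have "0 \<le> c * (2*c\<^sup>2 - 1)" using c(1) \<open>c\<^sup>2 > 1\<close> by (intro mult_nonneg_nonneg) linarith+
      then show ?thesis by simp
    qed
    have "?q c = (c - 1) * (24 * c\<^sup>2 + 16 * c + 3)"
      by (simp add: algebra_simps power2_eq_square power3_eq_cube)
    then show "0 < ?q c" using c by (simp add: zero_less_mult_iff add_pos_pos)
    have "?q ((c + 1) / 2) = (c - 1) * (12 * c\<^sup>2 + 22 * c - 3 + 24 * c * (c + 1) * (c * (2 - c)))"
      by (simp add: field_simps power2_eq_square power3_eq_cube)
    moreover have "0 \<le> 24 * c * (c + 1) * (c * (2 - c))" using c by (intro mult_nonneg_nonneg) auto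
    moreover have "12 * c\<^sup>2 + 22 * c - 3 > 0" using c \<open>c\<^sup>2 > 1\<close> by linarith
    ultimately show "0 < ?q ((c + 1) / 2)" using c by (metis add_pos_nonneg diff_gt_0_iff_gt mult_pos_pos)
  qed
  moreover have "?q X = - 3 * vcoef c X - (c - 1) * (24 * c\<^sup>2 + 8 * c - 3)"
    by (simp add: vcoef_def algebra_simps power2_eq_square power3_eq_cube)
  ultimately show ?thesis using u by linarith
qed

lemma sinh_mult_ge: "x \<ge> 0 \<Longrightarrow> real k * sinh x \<le> sinh (real k * x)"
proof (induction k)
  case (Suc k)
  have "real (Suc k) * sinh x \<le> sinh (real k * x) * 1 + 1 * sinh x" using Suc by (simp add: algebra_simps)
  also have "\<dots> \<le> sinh (real k * x) * cosh x + cosh (real k * x) * sinh x"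
    using Suc.prems by (intro add_mono mult_left_mono mult_right_mono cosh_real_ge_1) auto
  also have "\<dots> = sinh (real (Suc k) * x)" unfolding sinh_add[symmetric] by (simp add: algebra_simps)
  finally show ?case .
qed simp

lemma cosh_half_le: "cosh (x / 2) \<le> (cosh x + 3) / (4 :: real)"
proof -
  have "cosh x = 2 * cosh (x/2) ^ 2 - 1" using cosh_double_cosh[of "x/2"] by simp
  moreover have "0 \<le> (cosh (x/2) - 1)\<^sup>2" by simp
  ultimately show ?thesis by (simp add: power2_eq_square algebra_simps)
qed

lemma cosh_convex:
  fixes x y w :: real
  assumes "0 \<le> w" "w \<le> 1"
  shows "cosh (w * x) \<le> w * cosh x + (1 - w)"
proof -
  have "convex_on UNIV (cosh :: real \<Rightarrow> real)"
    by (rule f''_ge0_imp_convex[where f' = sinh and f'' = cosh]) (auto intro!: derivative_eq_intros)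
  from convex_onD[OF this, of w 0 x] assms show ?thesis by simp
qed

context
  fixes \<theta> :: real assumes pos: "\<theta> > 0"
begin

lemma cosh_gt_1: "cosh \<theta> > 1"
  using cosh_real_ge_1[of \<theta>] cosh_real_one_iff[of \<theta>] pos by linarith

lemma bump_combination:
  assumes "0 \<le> t" "t \<le> \<theta>"
  shows "bump \<theta> t - \<nu> * bump \<theta> (t + \<theta>)
    = sinh t * tcoef \<nu> (cosh \<theta>) (cosh t) + sinh (\<theta> - t) * xcoef \<nu> (cosh \<theta>) (cosh (\<theta> - t))"
proof -
  note e = bump_inner[OF pos assms] bump_middle[OF pos assms]
  show ?thesis unfolding e tcoef_def xcoef_def by (simp add: algebra_simps)
qed

text \<open>For \<open>Y \<noteq> 0\<close> the ratio \<open>N / Y\<close> is at least \<open>\<rho>\<close>, and enlarging it only helps because \<open>u\<close> is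
  positive.\<close>

lemma positive_combination:
  fixes N u Y v \<rho> :: real
  assumes "N \<ge> \<rho> * Y" "Y \<ge> 0" "N > 0" "u > 0" "\<rho> * u + v > 0"
  shows "N * u + Y * v > 0"
proof (cases "Y = 0")
  case False
  have "N * u + Y * v \<ge> \<rho> * Y * u + Y * v" using assms by (simp add: mult_right_mono)
  moreover have "\<rho> * Y * u + Y * v = Y * (\<rho> * u + v)" by (simp add: algebra_simps)
  moreover have "Y * (\<rho> * u + v) > 0" using assms False by (intro mult_pos_pos) auto
  ultimately show ?thesis by linarith
qed (use assms in simp)

lemma range_facts:
  assumes "\<theta>/2 \<le> t" "t \<le> \<theta>"
  shows "0 < sinh t" "0 \<le> sinh (\<theta> - t)" "1 \<le> cosh t" "cosh t \<le> cosh \<theta>"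
    "1 \<le> cosh (\<theta> - t)" "cosh (\<theta> - t) \<le> (cosh \<theta> + 3) / 4"
proof -
  show "cosh (\<theta> - t) \<le> (cosh \<theta> + 3) / 4"
    using cosh_half_le[of \<theta>] cosh_real_nonneg_le_iff[of "\<theta> - t" "\<theta>/2"] assms pos by linarith
qed (use assms pos cosh_real_nonneg_le_iff[of t \<theta>] in \<open>auto simp: cosh_real_ge_1\<close>)

lemma sinh_ratio:
  assumes "real k * (\<theta> - t) \<le> t" "t \<le> \<theta>"
  shows "sinh t \<ge> real k * sinh (\<theta> - t)"
proof -
  have "real k * sinh (\<theta> - t) \<le> sinh (real k * (\<theta> - t))" using assms by (intro sinh_mult_ge) auto
  also have "\<dots> \<le> sinh t" using assms by simp
  finally show ?thesis .
qed

lemma tcoef_nonpos_weight: "\<nu> \<le> 0 \<Longrightarrow> 1 \<le> T \<Longrightarrow> ucoef c T \<le> tcoef \<nu> c T"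
  by (simp add: tcoef_def mult_nonpos_nonneg)

text \<open>The four comparisons of \<open>bump \<theta> t\<close> with \<open>bump \<theta> (t + \<theta>)\<close> come in two pairs whose constants are reciprocal,
  \<open>3/2\<close> with \<open>2/3\<close> and \<open>1/2\<close> with \<open>2\<close>.  One member of each pair holds from \<open>\<theta>/2\<close> on, the other
  from \<open>3\<theta>/4\<close> on; multiplied together they exclude \<open>bump \<theta> s * bump \<theta> t = bump \<theta> (s + \<theta>) * bump \<theta> (t + \<theta>)\<close>, the first
  pair when both factors on the left are negative, the second pair when the factors on the right are positive.\<close>

lemma bump_half_low:
  assumes t: "\<theta>/2 \<le> t" "t \<le> \<theta>"
  shows "bump \<theta> t + 3/2 * bump \<theta> (t + \<theta>) > 0"
proof -
  note R = range_facts[OF t]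
  have "0 < tcoef (-3/2) (cosh \<theta>) (cosh t)"
    using ucoef_pos[OF cosh_gt_1 R(3,4)] tcoef_nonpos_weight[OF _ R(3), of "-3/2" "cosh \<theta>"] by simp
  moreover have "0 < 1 * tcoef (-3/2) (cosh \<theta>) (cosh t) + xcoef (-3/2) (cosh \<theta>) (cosh (\<theta> - t))"
    using coef_half_low[OF cosh_gt_1 R(3-6)] by linarith
  moreover have "1 * sinh (\<theta> - t) \<le> sinh t" using sinh_ratio[of 1 t] t by simp
  ultimately have "0 < sinh t * tcoef (-3/2) (cosh \<theta>) (cosh t)
      + sinh (\<theta> - t) * xcoef (-3/2) (cosh \<theta>) (cosh (\<theta> - t))"
    using R(1,2) by (intro positive_combination[of 1]) auto
  then show ?thesis using bump_combination[of t "-3/2"] t pos by simp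
qed

lemma bump_quarter_low:
  assumes "3*\<theta>/4 \<le> t" "t \<le> \<theta>"
  shows "bump \<theta> t + 2/3 * bump \<theta> (t + \<theta>) > 0"
proof -
  have t: "\<theta>/2 \<le> t" "t \<le> \<theta>" using assms pos by auto
  note R = range_facts[OF t]
  let ?u = "tcoef (-2/3) (cosh \<theta>) (cosh t)"
  let ?v = "xcoef (-2/3) (cosh \<theta>) (cosh (\<theta> - t))"
  have u: "0 < ?u"
    using ucoef_pos[OF cosh_gt_1 R(3,4)] tcoef_nonpos_weight[OF _ R(3), of "-2/3" "cosh \<theta>"] by simp
  have "0 < sinh t * ?u + sinh (\<theta> - t) * ?v"
  proof (cases "t \<le> 7 * \<theta> / 8")
    case True
    have "cosh t \<le> cosh (7/8 * \<theta>)" using True t pos by (subst cosh_real_nonneg_le_iff) auto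
    also have "\<dots> \<le> (7 * cosh \<theta> + 1) / 8" using cosh_convex[of "7/8" \<theta>] by simp
    finally have "0 < 3 * ?u + ?v"
      using coef_quarter_low(2)[OF cosh_gt_1 R(5,6,3)] by linarith
    then show ?thesis using sinh_ratio[of 3 t] R u assms by (intro positive_combination[of 3]) auto
  next
    case False
    have "0 < 7 * ?u + ?v"
      using coef_quarter_low(1)[OF cosh_gt_1 R(5,6,3,4)] by linarith
    then show ?thesis using sinh_ratio[of 7 t] R u False assms by (intro positive_combination[of 7]) auto
  qed
  then show ?thesis using bump_combination[of t "-2/3"] t pos by simp
qed

lemma bump_half_high:
  assumes c: "cosh \<theta> \<ge> 2" and t: "\<theta>/2 \<le> t" "t \<le> \<theta>"
  shows "bump \<theta> t > 1/2 * bump \<theta> (t + \<theta>)"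
proof -
  note R = range_facts[OF t]
  have "0 \<le> cosh t * (cosh t - 1)" using R(3) by simp
  then have "0 < tcoef (1/2) (cosh \<theta>) (cosh t)"
    using tcoef_2_pos[OF c R(3,4)] by (simp add: tcoef_def mult.assoc)
  moreover have "0 < 1 * tcoef (1/2) (cosh \<theta>) (cosh t) + xcoef (1/2) (cosh \<theta>) (cosh (\<theta> - t))"
    using coef_half_high[OF c R(3-6)] .
  moreover have "1 * sinh (\<theta> - t) \<le> sinh t" using sinh_ratio[of 1 t] t by simp
  ultimately have "0 < sinh t * tcoef (1/2) (cosh \<theta>) (cosh t)
      + sinh (\<theta> - t) * xcoef (1/2) (cosh \<theta>) (cosh (\<theta> - t))"
    using R(1,2) by (intro positive_combination[of 1]) auto
  then show ?thesis using bump_combination[of t "1/2"] t pos by simp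
qed

lemma bump_quarter_high:
  assumes c: "cosh \<theta> \<ge> 2" and "3*\<theta>/4 \<le> t" "t \<le> \<theta>"
  shows "bump \<theta> t > 2 * bump \<theta> (t + \<theta>)"
proof -
  have t: "\<theta>/2 \<le> t" "t \<le> \<theta>" using assms pos by auto
  note R = range_facts[OF t]
  have "0 < sinh t * tcoef 2 (cosh \<theta>) (cosh t) + sinh (\<theta> - t) * xcoef 2 (cosh \<theta>) (cosh (\<theta> - t))"
    using tcoef_2_pos[OF c R(3,4)] coef_quarter_high[OF c R(3-6)] sinh_ratio[of 3 t] R(1,2) assms
    by (intro positive_combination[of 3]) auto
  then show ?thesis using bump_combination[of t "2"] t pos by simp
qed

text \<open>For \<open>cosh \<theta> \<le> 2\<close> the negative contribution of \<open>sinh (\<theta> - t)\<close>, which is at least \<open>3 * sinh t\<close>, prevails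
  on the first quarter of the cell.  Hence positivity there forces \<open>\<theta>\<close> to be large, the case in which the bounds
  \<open>bump_half_high\<close> and \<open>bump_quarter_high\<close> are available.\<close>

lemma bump_pos_start:
  assumes "0 \<le> t" "t \<le> \<theta>/4" "bump \<theta> t > 0"
  shows "cosh \<theta> > 2"
proof (rule ccontr)
  assume "\<not> ?thesis"
  then have c: "1 < cosh \<theta>" "cosh \<theta> \<le> 2" using cosh_gt_1 by auto
  define z where "z = cosh (\<theta>/4)"
  have z1: "z \<ge> 1" unfolding z_def by (rule cosh_real_ge_1)
  have "cosh (\<theta>/2) = 2 * z\<^sup>2 - 1" unfolding z_def using cosh_double_cosh[of "\<theta>/4"] by simp
  then have cz: "cosh \<theta> = 2 * (2 * z\<^sup>2 - 1)\<^sup>2 - 1" using cosh_double_cosh[of "\<theta>/2"] by simp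
  have "cosh \<theta> - 1 - 16 * (z - 1) = 8 * (z - 1)\<^sup>2 * (z\<^sup>2 + 2 * z + 2)"
    unfolding cz by (simp add: algebra_simps power2_eq_square)
  moreover have "8 * (z - 1)\<^sup>2 * (z\<^sup>2 + 2 * z + 2) \<ge> 0" using z1 by (intro mult_nonneg_nonneg) auto
  ultimately have "0 \<le> cosh \<theta> - 1 - 16 * (z - 1)" by simp
  then have z2: "z \<le> 1 + (cosh \<theta> - 1) / 16" "16 * z \<le> cosh \<theta> + 15" by (simp_all add: field_simps)
  have "cosh (3 * (\<theta>/4)) \<ge> (cosh \<theta> + 1) / 2"
  proof -
    have z3: "z \<le> 11/10" using z2 c by (simp add: field_simps)
    have "z\<^sup>2 \<le> (11/10)\<^sup>2" using z1 z3 by (intro power_mono) auto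
    then have "z * z\<^sup>2 \<le> z * (121/100)" using z1 by (intro mult_left_mono) (auto simp: power2_eq_square)
    then have "4 * z^3 \<le> 4 * z + 1" using z3 by (simp add: power3_eq_cube power2_eq_square)
    then have "0 \<le> (z - 1) * (4 * z + 1 - 4 * z^3)" using z1 by simp
    then show ?thesis unfolding cosh_triple cz z_def[symmetric]
      by (simp add: field_simps power2_eq_square power3_eq_cube)
  qed
  moreover have "cosh (3 * (\<theta>/4)) \<le> cosh (\<theta> - t)" "cosh (\<theta> - t) \<le> cosh \<theta>" "cosh t \<le> z"
    unfolding z_def using assms pos by (auto simp: cosh_real_nonneg_le_iff)
  ultimately have "ucoef (cosh \<theta>) (cosh t) + 3 * vcoef (cosh \<theta>) (cosh (\<theta> - t)) < 0"
    using coef_start_neg[OF c, of "cosh (\<theta> - t)" "cosh t"] cosh_real_ge_1[of t] z2 by linarith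
  moreover have "0 \<le> ucoef (cosh \<theta>) (cosh t)"
    using ucoef_pos[OF c(1) cosh_real_ge_1[of t]] \<open>cosh t \<le> z\<close> z2 c by simp
  moreover have "3 * sinh t \<le> sinh (\<theta> - t)"
  proof -
    have "3 * sinh t \<le> sinh (3 * t)" using sinh_mult_ge[OF assms(1), of 3] by simp
    also have "\<dots> \<le> sinh (\<theta> - t)" unfolding sinh_real_le_iff using assms(2) by linarith
    finally show ?thesis .
  qed
  moreover have "sinh t \<ge> 0" using assms by simp
  moreover define u where "u = ucoef (cosh \<theta>) (cosh t)"
  moreover define v where "v = vcoef (cosh \<theta>) (cosh (\<theta> - t))"
  ultimately have uv: "u + 3 * v < 0" "0 \<le> u" "3 * sinh t \<le> sinh (\<theta> - t)" "0 \<le> sinh t" by auto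
  have "bump \<theta> t = sinh t * u + sinh (\<theta> - t) * v"
    unfolding u_def v_def using assms pos by (intro bump_inner) auto
  also have "\<dots> \<le> sinh t * u + 3 * sinh t * v"
    using uv by (intro add_left_mono mult_right_mono_neg) auto
  also have "\<dots> = sinh t * (u + 3 * v)" by (simp add: algebra_simps)
  also have "\<dots> \<le> 0" using uv by (intro mult_nonneg_nonpos) auto
  finally have "bump \<theta> t \<le> 0" .
  then show False using assms by simp
qed

lemma bump_pos:
  assumes "\<theta> \<le> \<bar>t\<bar>" "\<bar>t\<bar> < 3 * \<theta>"
  shows "bump \<theta> t > 0"
proof -
  have *: "bump \<theta> t > 0" if t: "\<theta> \<le> t" "t < 3 * \<theta>" for t
  proof (cases "t \<le> 2 * \<theta>")
    case True
    define s where "s = t - \<theta>"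
    have s: "0 \<le> s" "s \<le> \<theta>" and ts: "t = s + \<theta>" using t True unfolding s_def by auto
    have u: "0 < ucoef (cosh \<theta>) (cosh (\<theta> - s))"
      using s pos by (intro ucoef_pos cosh_gt_1) (auto simp: cosh_real_ge_1 cosh_real_nonneg_le_iff)
    show ?thesis
    proof (cases "s = \<theta>")
      case True
      then show ?thesis unfolding ts bump_middle[OF pos s] using pos cosh_gt_1 by simp
    next
      case False
      then have "0 < sinh (\<theta> - s) * ucoef (cosh \<theta>) (cosh (\<theta> - s))" using u s by simp
      moreover have "0 \<le> sinh s * (4 * cosh s * (cosh s - 1))"
        using s cosh_real_ge_1[of s] by simp
      ultimately show ?thesis unfolding ts bump_middle[OF pos s] by linarith
    qed
  next
    case False
    define s where "s = 3 * \<theta> - t"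
    have s: "s > 0" using t unfolding s_def by simp
    then have "cosh s > 1" using cosh_real_ge_1[of s] cosh_real_one_iff[of s] by linarith
    then have "sinh_comb s > 0" unfolding sinh_comb_eq using s by simp
    then show ?thesis using bump_outer[OF pos, of t] False t unfolding s_def by simp
  qed
  show ?thesis using *[of t] *[of "-t"] assms bump_even[of \<theta> t] by (cases "t \<ge> 0") auto
qed

end

section \<open>Four unknowns and six rows\<close>

text \<open>Only the two middle rows involve \<open>c1\<close> and \<open>c2\<close> alone.  If they admit a solution with \<open>c1 \<noteq> 0\<close>, their
  determinant vanishes, that is, \<open>bump r * bump q = bump (r + \<theta>) * bump (q + \<theta>)\<close>.  Both \<open>r\<close> and \<open>q\<close> are at
  least \<open>\<theta>/2\<close> and one of them is at least \<open>3\<theta>/4\<close>.  If \<open>bump r\<close> and \<open>bump q\<close> are negative, the low bounds contradict this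
  equation.  If they are positive, the signs of \<open>c0, c1, c2, c3\<close> alternate, and the second and the fifth row force the
  bump to be positive at \<open>\<theta> - r\<close> and at \<open>r - \<theta> + \<delta>\<close>.  The sum of these two numbers is \<open>\<delta> \<le> \<theta>/2\<close>, so one
  of them is at most \<open>\<theta>/4\<close>; therefore \<open>cosh \<theta> > 2\<close>, and the high bounds contradict the equation.\<close>

lemma mid_pair_injective:
  fixes \<theta> \<delta> r c0 c1 c2 c3 :: real
  assumes \<theta>: "\<theta> > 0" and \<delta>: "0 < \<delta>" "\<delta> \<le> \<theta>/2" and r: "\<theta> - \<delta> \<le> r" "r \<le> \<theta>"
  defines "A \<equiv> 3 * \<theta> - \<delta>"
  defines "E \<equiv> \<lambda>s. c0 * bump \<theta> (s + A) + c1 * bump \<theta> s + c2 * bump \<theta> (s - A) + c3 * bump \<theta> (s - 2 * A)"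
  assumes E: "\<And>i. i \<in> {-2..3::int} \<Longrightarrow> E (r + of_int i * \<theta>) = 0"
  shows "c0 = 0 \<and> c1 = 0 \<and> c2 = 0 \<and> c3 = 0"
proof -
  let ?K = "bump \<theta>"
  \<comment> \<open>The second middle node has the same position as the first when seen from the right; \<open>q\<close> plays there the part of \<open>r\<close>.\<close>
  define q where "q = 2 * \<theta> - \<delta> - r"
  have q: "\<theta> - \<delta> \<le> q" "q \<le> \<theta>" using r unfolding q_def by auto
  note bounds = \<theta> \<delta> r q
  have K0: "?K s = 0" if "3 * \<theta> \<le> s \<or> s \<le> - 3 * \<theta>" for s
    using that \<theta> by (intro bump_eq_0) auto
  have Kpos: "?K s > 0" if "\<theta> \<le> s" "s < 3 * \<theta>" for s
    using that \<theta> by (intro bump_pos) auto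
  have Knn: "?K s \<ge> 0" if "\<theta> \<le> s" for s
    using Kpos[of s] K0[of s] that by (cases "s < 3 * \<theta>") auto
  have flip: "?K (- s) = ?K s" for s by (rule bump_even)
  \<comment> \<open>The rows \<open>i = -2, \<dots>, 3\<close>, without their vanishing entries and with arguments made positive by evenness.\<close>
  have e1: "c0 * ?K (r + \<theta> - \<delta>) + c1 * ?K (2 * \<theta> - r) = 0"
  proof -
    have "?K (r - 2 * \<theta> - A) = 0" "?K (r - 2 * \<theta> - 2 * A) = 0"
      using bounds unfolding A_def by (auto intro!: K0)
    moreover have "?K (r - 2 * \<theta> + A) = ?K (r + \<theta> - \<delta>)" "?K (r - 2 * \<theta>) = ?K (2 * \<theta> - r)"
      using flip[of "2 * \<theta> - r"] unfolding A_def by (auto simp: algebra_simps)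
    ultimately show ?thesis using E[of "-2"] unfolding E_def by simp
  qed
  have e2: "c0 * ?K (r + 2 * \<theta> - \<delta>) + c1 * ?K (\<theta> - r) + c2 * ?K (4 * \<theta> - \<delta> - r) = 0"
  proof -
    have "?K (r - \<theta> - 2 * A) = 0" using bounds unfolding A_def by (auto intro!: K0)
    moreover have "?K (r - \<theta> + A) = ?K (r + 2 * \<theta> - \<delta>)" "?K (r - \<theta>) = ?K (\<theta> - r)"
        "?K (r - \<theta> - A) = ?K (4 * \<theta> - \<delta> - r)"
      using flip[of "\<theta> - r"] flip[of "4 * \<theta> - \<delta> - r"] unfolding A_def by (auto simp: algebra_simps)
    ultimately show ?thesis using E[of "-1"] unfolding E_def by simp
  qed
  have e3: "c1 * ?K r + c2 * ?K (q + \<theta>) = 0"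
  proof -
    have "?K (r + A) = 0" "?K (r - 2 * A) = 0" using bounds unfolding A_def by (auto intro!: K0)
    moreover have "?K (r - A) = ?K (q + \<theta>)"
      using flip[of "q + \<theta>"] unfolding A_def q_def by (auto simp: algebra_simps)
    ultimately show ?thesis using E[of 0] unfolding E_def by simp
  qed
  have e4: "c1 * ?K (r + \<theta>) + c2 * ?K q = 0"
  proof -
    have "?K (r + \<theta> + A) = 0" "?K (r + \<theta> - 2 * A) = 0" using bounds unfolding A_def by (auto intro!: K0)
    moreover have "?K (r + \<theta> - A) = ?K q"
      using flip[of "q"] unfolding A_def q_def by (auto simp: algebra_simps)
    ultimately show ?thesis using E[of 1] unfolding E_def by simp
  qed
  have e5: "c1 * ?K (r + 2 * \<theta>) + c2 * ?K (r - \<theta> + \<delta>) + c3 * ?K (q + 2 * \<theta> - \<delta>) = 0"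
  proof -
    have "?K (r + 2 * \<theta> + A) = 0" using bounds unfolding A_def by (auto intro!: K0)
    moreover have "?K (r + 2 * \<theta> - A) = ?K (r - \<theta> + \<delta>)" "?K (r + 2 * \<theta> - 2 * A) = ?K (q + 2 * \<theta> - \<delta>)"
      using flip[of "q + 2 * \<theta> - \<delta>"] unfolding A_def q_def by (auto simp: algebra_simps)
    ultimately show ?thesis using E[of 2] unfolding E_def by simp
  qed
  have e6: "c2 * ?K (r + \<delta>) + c3 * ?K (q + \<theta> - \<delta>) = 0"
  proof -
    have "?K (r + 3 * \<theta> + A) = 0" "?K (r + 3 * \<theta>) = 0" using bounds unfolding A_def by (auto intro!: K0)
    moreover have "?K (r + 3 * \<theta> - A) = ?K (r + \<delta>)" "?K (r + 3 * \<theta> - 2 * A) = ?K (q + \<theta> - \<delta>)"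
      using flip[of "q + \<theta> - \<delta>"] unfolding A_def q_def by (auto simp: algebra_simps)
    ultimately show ?thesis using E[of 3] unfolding E_def by simp
  qed
  have p: "?K (r + \<theta>) > 0" "?K (q + \<theta>) > 0" "?K (r + \<theta> - \<delta>) > 0" "?K (2 * \<theta> - r) > 0"
      "?K (r + 2 * \<theta> - \<delta>) > 0" "?K (r + \<delta>) > 0" "?K (q + \<theta> - \<delta>) > 0" "?K (q + 2 * \<theta> - \<delta>) > 0"
    using bounds by (auto intro!: Kpos)
  have nn: "?K (4 * \<theta> - \<delta> - r) \<ge> 0" "?K (r + 2 * \<theta>) \<ge> 0"
    using bounds by (auto intro!: Knn)
  have "c1 = 0"
  proof (rule ccontr)
    assume c1: "c1 \<noteq> 0"
    then have sq1: "0 < c1 * c1" using not_real_square_gt_zero by blast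
    have x3: "c1 * ?K r = - (c2 * ?K (q + \<theta>))" and x4: "c2 * ?K q = - (c1 * ?K (r + \<theta>))"
      using e3 e4 by linarith+
    have "c1 * (?K r * ?K q) = (c1 * ?K r) * ?K q" by simp
    also have "\<dots> = - ((c2 * ?K q) * ?K (q + \<theta>))" unfolding x3 by simp
    also have "\<dots> = c1 * (?K (r + \<theta>) * ?K (q + \<theta>))" unfolding x4 by simp
    finally have f: "?K r * ?K q = ?K (r + \<theta>) * ?K (q + \<theta>)" using c1 by simp
    have rq: "\<theta>/2 \<le> r" "\<theta>/2 \<le> q" "3 * \<theta> / 4 \<le> r \<or> 3 * \<theta> / 4 \<le> q"
      using bounds unfolding q_def by linarith+
    have fpos: "?K r * ?K q > 0" unfolding f using p by simp
    show False
    proof (cases "?K r > 0")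
      case False
      then have neg: "?K r < 0" "?K q < 0" using fpos by (auto simp: zero_less_mult_iff)
      have key: False if "?K s * ?K t = ?K (s + \<theta>) * ?K (t + \<theta>)" "?K s < 0" "?K t < 0"
          "\<theta>/2 \<le> s" "s \<le> \<theta>" "3 * \<theta> / 4 \<le> t" "t \<le> \<theta>" for s t
      proof -
        have 1: "- ?K s < 3/2 * ?K (s + \<theta>)" using bump_half_low[OF \<theta>, of s] that by simp
        have 2: "- ?K t < 2/3 * ?K (t + \<theta>)" using bump_quarter_low[OF \<theta>, of t] that by simp
        have "(- ?K s) * (- ?K t) < (3/2 * ?K (s + \<theta>)) * (2/3 * ?K (t + \<theta>))"
          using 1 2 that(2,3) by (intro mult_strict_mono) auto
        then show False using that(1) by simp
      qed
      show False using rq(3)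
      proof
        assume "3 * \<theta> / 4 \<le> r"
        then show False using key[of q r] f neg rq q r by (simp add: mult.commute)
      next
        assume "3 * \<theta> / 4 \<le> q"
        then show False using key[of r q] f neg rq q r by simp
      qed
    next
      case True
      then have Kq: "?K q > 0" using fpos by (simp add: zero_less_mult_iff)
      have c12: "c1 * c2 < 0"
      proof -
        have "c1 * (c1 * ?K r + c2 * ?K (q + \<theta>)) = 0" using e3 by simp
        then have "(c1 * c2) * ?K (q + \<theta>) = - (c1 * c1 * ?K r)" by (simp add: algebra_simps)
        moreover have "c1 * c1 * ?K r > 0" by (rule mult_pos_pos[OF sq1 True])
        ultimately have "(c1 * c2) * ?K (q + \<theta>) < 0" by linarith
        then show ?thesis using p(2) by (simp add: mult_less_0_iff)
      qed
      then have c2: "c2 \<noteq> 0" by auto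
      then have sq2: "0 < c2 * c2" using not_real_square_gt_zero by blast
      have c01: "c0 * c1 < 0"
      proof -
        have "c1 * (c0 * ?K (r + \<theta> - \<delta>) + c1 * ?K (2 * \<theta> - r)) = 0" using e1 by simp
        then have "(c0 * c1) * ?K (r + \<theta> - \<delta>) = - (c1 * c1 * ?K (2 * \<theta> - r))" by (simp add: algebra_simps)
        moreover have "c1 * c1 * ?K (2 * \<theta> - r) > 0" by (rule mult_pos_pos[OF sq1 p(4)])
        ultimately have "(c0 * c1) * ?K (r + \<theta> - \<delta>) < 0" by linarith
        then show ?thesis using p(3) by (simp add: mult_less_0_iff)
      qed
      have c23: "c2 * c3 < 0"
      proof -
        have "c2 * (c2 * ?K (r + \<delta>) + c3 * ?K (q + \<theta> - \<delta>)) = 0" using e6 by simp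
        then have "(c2 * c3) * ?K (q + \<theta> - \<delta>) = - (c2 * c2 * ?K (r + \<delta>))" by (simp add: algebra_simps)
        moreover have "c2 * c2 * ?K (r + \<delta>) > 0" by (rule mult_pos_pos[OF sq2 p(6)])
        ultimately have "(c2 * c3) * ?K (q + \<theta> - \<delta>) < 0" by linarith
        then show ?thesis using p(7) by (simp add: mult_less_0_iff)
      qed
      have "?K (\<theta> - r) > 0"
      proof -
        have "c1 * (c0 * ?K (r + 2 * \<theta> - \<delta>) + c1 * ?K (\<theta> - r) + c2 * ?K (4 * \<theta> - \<delta> - r)) = 0"
          using e2 by simp
        then have "c1 * c1 * ?K (\<theta> - r) = - ((c0 * c1) * ?K (r + 2 * \<theta> - \<delta>)) - (c1 * c2) * ?K (4 * \<theta> - \<delta> - r)"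
          by (simp add: algebra_simps)
        moreover have "(c0 * c1) * ?K (r + 2 * \<theta> - \<delta>) < 0" using c01 p(5) by (rule mult_neg_pos)
        moreover have "(c1 * c2) * ?K (4 * \<theta> - \<delta> - r) \<le> 0" by (rule mult_nonpos_nonneg[OF less_imp_le[OF c12] nn(1)])
        ultimately have "c1 * c1 * ?K (\<theta> - r) > 0" by linarith
        moreover have "c1 * c1 > 0" using c1 not_real_square_gt_zero by blast
        ultimately show ?thesis using zero_less_mult_pos by blast
      qed
      moreover have "?K (r - \<theta> + \<delta>) > 0"
      proof -
        have "c2 * (c1 * ?K (r + 2 * \<theta>) + c2 * ?K (r - \<theta> + \<delta>) + c3 * ?K (q + 2 * \<theta> - \<delta>)) = 0"
          using e5 by simp
        then have "c2 * c2 * ?K (r - \<theta> + \<delta>) = - ((c1 * c2) * ?K (r + 2 * \<theta>)) - (c2 * c3) * ?K (q + 2 * \<theta> - \<delta>)"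
          by (simp add: algebra_simps)
        moreover have "(c1 * c2) * ?K (r + 2 * \<theta>) \<le> 0" by (rule mult_nonpos_nonneg[OF less_imp_le[OF c12] nn(2)])
        moreover have "(c2 * c3) * ?K (q + 2 * \<theta> - \<delta>) < 0" using c23 p(8) by (rule mult_neg_pos)
        ultimately have "c2 * c2 * ?K (r - \<theta> + \<delta>) > 0" by linarith
        moreover have "c2 * c2 > 0" using c2 not_real_square_gt_zero by blast
        ultimately show ?thesis using zero_less_mult_pos by blast
      qed
      moreover have "\<theta> - r \<le> \<theta>/4 \<or> r - \<theta> + \<delta> \<le> \<theta>/4" using bounds by linarith
      ultimately have big: "cosh \<theta> \<ge> 2"
        using bump_pos_start[OF \<theta>, of "\<theta> - r"] bump_pos_start[OF \<theta>, of "r - \<theta> + \<delta>"] bounds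
        by fastforce
      have key: False if "?K s * ?K t = ?K (s + \<theta>) * ?K (t + \<theta>)" "?K (s + \<theta>) > 0" "?K (t + \<theta>) > 0"
          "\<theta>/2 \<le> s" "s \<le> \<theta>" "3 * \<theta> / 4 \<le> t" "t \<le> \<theta>" for s t
      proof -
        have 1: "1/2 * ?K (s + \<theta>) < ?K s" using bump_half_high[OF \<theta> big, of s] that by simp
        have 2: "2 * ?K (t + \<theta>) < ?K t" using bump_quarter_high[OF \<theta> big, of t] that by simp
        have "(1/2 * ?K (s + \<theta>)) * (2 * ?K (t + \<theta>)) < ?K s * ?K t"
          using 1 2 that(2,3) by (intro mult_strict_mono) auto
        then show False using that(1) by simp
      qed
      show False using rq(3)
      proof
        assume "3 * \<theta> / 4 \<le> r"
        then show False using key[of q r] f p rq q r by (simp add: mult.commute)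
      next
        assume "3 * \<theta> / 4 \<le> q"
        then show False using key[of r q] f p rq q r by simp
      qed
    qed
  qed
  moreover from this have "c2 = 0" using e3 p(2) by simp
  moreover from calculation have "c0 = 0" "c3 = 0" using e1 e6 p by auto
  ultimately show ?thesis by simp
qed

text \<open>The four terms of the row sum at distance \<open>s\<close> to the right of the node carrying \<open>c1\<close>, when neighbouring nodes
  are \<open>A\<close> apart.\<close>

definition row4 :: "real \<Rightarrow> real \<Rightarrow> complex \<Rightarrow> complex \<Rightarrow> complex \<Rightarrow> complex \<Rightarrow> real \<Rightarrow> complex" where
  "row4 \<theta> A c0 c1 c2 c3 s = c0 * complex_of_real (bump \<theta> (s + A)) + c1 * complex_of_real (bump \<theta> s)
     + c2 * complex_of_real (bump \<theta> (s - A)) + c3 * complex_of_real (bump \<theta> (s - 2 * A))"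

text \<open>Injectivity becomes a uniform estimate by compactness of the product of the interval of \<open>r\<close> with the unit
  sphere of coefficient vectors.  The matrix is real, so real and imaginary parts can be treated separately.\<close>

lemma mid_pair_bound:
  fixes \<theta> \<delta> :: real
  assumes \<theta>: "\<theta> > 0" and \<delta>: "0 < \<delta>" "\<delta> \<le> \<theta>/2"
  defines "A \<equiv> 3 * \<theta> - \<delta>"
  shows "\<exists>C>0. \<forall>r c0 c1 c2 c3. \<theta> - \<delta> \<le> r \<longrightarrow> r \<le> \<theta> \<longrightarrow>
    (cmod c1)\<^sup>2 \<le> C * (\<Sum>i\<in>{-2..3::int}. (cmod (row4 \<theta> A c0 c1 c2 c3 (r + of_int i * \<theta>)))\<^sup>2)"
proof -
  define R where "R = (\<lambda>(c0, c1, c2, c3) s. c0 * bump \<theta> (s + A) + c1 * bump \<theta> s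
     + c2 * bump \<theta> (s - A) + c3 * bump \<theta> (s - 2 * A))"
  define Q where "Q = (\<lambda>x::real \<times> real \<times> real \<times> real \<times> real.
     \<Sum>i\<in>{-2..3::int}. (R (snd x) (fst x + of_int i * \<theta>))\<^sup>2)"
  define S where "S = {\<theta> - \<delta>..\<theta>} \<times> sphere (0::real \<times> real \<times> real \<times> real) 1"
  have cb: "continuous_on X (\<lambda>x. bump \<theta> (f x))" if "continuous_on X f" for f :: "'b::topological_space \<Rightarrow> real" and X
    by (rule continuous_on_compose2[OF continuous_bump[of \<theta>] that]) auto
  have "continuous_on S Q"
    unfolding Q_def R_def case_prod_beta by (intro continuous_intros cb)
  moreover have "compact S" unfolding S_def by (intro compact_Times compact_sphere) auto
  moreover have "S \<noteq> {}"
  proof -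
    have "(\<theta>, (1, 0, 0, 0)) \<in> S" using \<delta> unfolding S_def by (simp add: norm_Pair)
    then show ?thesis by auto
  qed
  ultimately obtain z where z: "z \<in> S" "\<And>x. x \<in> S \<Longrightarrow> Q z \<le> Q x"
    using continuous_attains_inf by metis
  have "Q z > 0"
  proof (rule ccontr)
    assume "\<not> Q z > 0"
    moreover have "Q z \<ge> 0" unfolding Q_def by (intro sum_nonneg) auto
    ultimately have "Q z = 0" by simp
    then have *: "R (snd z) (fst z + of_int i * \<theta>) = 0" if "i \<in> {-2..3::int}" for i
      using that unfolding Q_def by (subst (asm) sum_nonneg_eq_0_iff) auto
    obtain r c0 c1 c2 c3 where zz: "z = (r, c0, c1, c2, c3)" by (metis prod.collapse)
    have r: "\<theta> - \<delta> \<le> r" "r \<le> \<theta>" using z(1) unfolding S_def zz by auto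
    have "c0 = 0 \<and> c1 = 0 \<and> c2 = 0 \<and> c3 = 0"
      by (rule mid_pair_injective[OF \<theta> \<delta> r]) (use * in \<open>simp add: zz R_def A_def\<close>)
    then show False using z(1) unfolding S_def zz by (simp add: norm_Pair)
  qed
  have real: "c1\<^sup>2 \<le> 1 / Q z * (\<Sum>i\<in>{-2..3::int}. (R (c0, c1, c2, c3) (r + of_int i * \<theta>))\<^sup>2)"
    if r: "\<theta> - \<delta> \<le> r" "r \<le> \<theta>" for r c0 c1 c2 c3
  proof (cases "c1 = 0")
    case True
    then show ?thesis using \<open>Q z > 0\<close> by (simp add: sum_nonneg)
  next
    case False
    define c where "c = (c0, c1, c2, c3)"
    define n where "n = norm c"
    have n2: "n\<^sup>2 = c0\<^sup>2 + c1\<^sup>2 + c2\<^sup>2 + c3\<^sup>2" unfolding n_def c_def norm_Pair by simp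
    then have "c1\<^sup>2 \<le> n\<^sup>2" by simp
    have n: "n > 0" unfolding n_def c_def using False by (simp add: zero_prod_def)
    have "(r, c /\<^sub>R n) \<in> S" using r n unfolding S_def n_def by simp
    from z(2)[OF this] have "Q z * n\<^sup>2 \<le> Q (r, c /\<^sub>R n) * n\<^sup>2" by (intro mult_right_mono) auto
    also have "\<dots> = (\<Sum>i\<in>{-2..3::int}. (R c (r + of_int i * \<theta>))\<^sup>2)"
    proof -
      have "R (c /\<^sub>R n) s * n = R c s" for s
        using n unfolding R_def c_def by (simp add: field_simps)
      then show ?thesis unfolding Q_def sum_distrib_right by (simp add: power_mult_distrib[symmetric])
    qed
    finally have "Q z * c1\<^sup>2 \<le> (\<Sum>i\<in>{-2..3::int}. (R c (r + of_int i * \<theta>))\<^sup>2)"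
      using \<open>c1\<^sup>2 \<le> n\<^sup>2\<close> \<open>Q z > 0\<close> by (meson mult_left_mono order_less_imp_le order_trans)
    then show ?thesis using \<open>Q z > 0\<close> unfolding c_def by (simp add: field_simps)
  qed
  show ?thesis
  proof (intro exI[of _ "1 / Q z"] conjI allI impI)
    show "0 < 1 / Q z" using \<open>Q z > 0\<close> by simp
    fix r c0 c1 c2 c3 assume r: "\<theta> - \<delta> \<le> r" "r \<le> \<theta>"
    have "(cmod c1)\<^sup>2 = (Re c1)\<^sup>2 + (Im c1)\<^sup>2" by (rule cmod_power2)
    also have "\<dots> \<le> 1 / Q z * (\<Sum>i\<in>{-2..3::int}. (R (Re c0, Re c1, Re c2, Re c3) (r + of_int i * \<theta>))\<^sup>2)
        + 1 / Q z * (\<Sum>i\<in>{-2..3::int}. (R (Im c0, Im c1, Im c2, Im c3) (r + of_int i * \<theta>))\<^sup>2)"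
      by (intro add_mono real r)
    also have "\<dots> = 1 / Q z * (\<Sum>i\<in>{-2..3::int}. (cmod (row4 \<theta> A c0 c1 c2 c3 (r + of_int i * \<theta>)))\<^sup>2)"
      unfolding distrib_left[symmetric] sum.distrib[symmetric]
      by (simp add: cmod_power2 row4_def R_def)
    finally show "(cmod c1)\<^sup>2 \<le> 1 / Q z * (\<Sum>i\<in>{-2..3::int}. (cmod (row4 \<theta> A c0 c1 c2 c3 (r + of_int i * \<theta>)))\<^sup>2)" .
  qed
qed

definition rowsum :: "real \<Rightarrow> (int \<Rightarrow> real) \<Rightarrow> (int \<Rightarrow> complex) \<Rightarrow> real \<Rightarrow> complex" where
  "rowsum \<theta> x c y = (\<integral>j. c j * complex_of_real (bump \<theta> (y - x j)) \<partial>count_space UNIV)"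

text \<open>The bump vanishes outside \<open>[-3\<theta>, 3\<theta>]\<close> and the nodes are at least \<open>5\<theta>/2\<close> apart.\<close>

lemma rowsum_local:
  fixes \<theta> \<delta> x0 :: real
  assumes \<theta>: "\<theta> > 0" and \<delta>: "0 < \<delta>" "\<delta> \<le> \<theta>/2" and s: "- \<theta> - \<delta> \<le> s" "s \<le> 4 * \<theta>"
  defines "A \<equiv> 3 * \<theta> - \<delta>"
  defines "x \<equiv> \<lambda>j. x0 + of_int j * A"
  shows "rowsum \<theta> x c (x j + s) = row4 \<theta> A (c (j - 1)) (c j) (c (j + 1)) (c (j + 2)) s"
proof -
  have A: "5/2 * \<theta> \<le> A" "A > 0" using \<theta> \<delta> unfolding A_def by auto
  have d: "x j + s - x i = s - of_int (i - j) * A" for i unfolding x_def by (simp add: algebra_simps)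
  have zero: "bump \<theta> (x j + s - x i) = 0" if i: "i \<notin> {j - 1, j, j + 1, j + 2}" for i
  proof (rule bump_eq_0[OF \<theta>])
    consider "i - j \<le> -2" | "i - j \<ge> 3" using i by fastforce
    then show "3 * \<theta> \<le> \<bar>x j + s - x i\<bar>"
    proof cases
      case 1
      then have "of_int (i - j) * A \<le> (-2) * A" using A by (intro mult_right_mono) auto
      then show ?thesis unfolding d using s A \<delta> by linarith
    next
      case 2
      then have "of_int (i - j) * A \<ge> 3 * A" using A by (intro mult_right_mono) auto
      then show ?thesis unfolding d using s A \<delta> by linarith
    qed
  qed
  have "rowsum \<theta> x c (x j + s) = (\<Sum>i\<in>{j - 1, j, j + 1, j + 2}. c i * complex_of_real (bump \<theta> (x j + s - x i)))"
    unfolding rowsum_def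
  proof (rule lebesgue_integral_count_space_finite_support[THEN trans])
    have sub: "{i. c i * complex_of_real (bump \<theta> (x j + s - x i)) \<noteq> 0} \<subseteq> {j - 1, j, j + 1, j + 2}"
      using zero by auto
    then show "finite {i \<in> UNIV. c i * complex_of_real (bump \<theta> (x j + s - x i)) \<noteq> 0}"
      using finite_subset by auto
    show "(\<Sum>i | i \<in> UNIV \<and> c i * complex_of_real (bump \<theta> (x j + s - x i)) \<noteq> 0. c i * complex_of_real (bump \<theta> (x j + s - x i)))
       = (\<Sum>i\<in>{j - 1, j, j + 1, j + 2}. c i * complex_of_real (bump \<theta> (x j + s - x i)))"
      using sub by (intro sum.mono_neutral_left) auto
  qed
  also have "\<dots> = row4 \<theta> A (c (j - 1)) (c j) (c (j + 1)) (c (j + 2)) s"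
    unfolding row4_def d by (simp add: algebra_simps)
  finally show ?thesis .
qed

lemma power2_sum_le: "(x + y)\<^sup>2 \<le> 2 * x\<^sup>2 + 2 * (y::real)\<^sup>2"
  using sum_squares_bound[of x y] by (simp add: power2_sum)

text \<open>The node spacing is \<open>3 * \<theta> - \<delta>\<close>, so from one node to the next the position relative to the lattice
  \<open>\<theta> * \<int>\<close> slips by \<open>\<delta>\<close>.  Within \<open>\<theta> / \<delta>\<close> steps to the right of any node there is one that has a lattice
  point at a distance between \<open>\<theta> - \<delta>\<close> and \<open>\<theta>\<close> on its right; its coefficient is controlled by six rows
  (\<open>mid_pair_bound\<close>).  From there one returns to the left: a lattice point at a distance between \<open>\<theta>\<close> and \<open>2\<theta>\<close>
  to the right of a node gives a row that contains only the coefficients of this node and the next one, and in it the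
  factor of the former is bounded below by a positive constant.\<close>

lemma rowsum_lower_local:
  fixes \<theta> \<delta> :: real
  assumes \<theta>: "\<theta> > 0" and \<delta>: "0 < \<delta>" "\<delta> \<le> \<theta>/2"
  defines "A \<equiv> 3 * \<theta> - \<delta>"
  obtains C R where "C > 0" "R > 0"
    "\<And>x0 c j. (cmod (c j))\<^sup>2 \<le> C * (\<Sum>m\<in>{m::int. \<bar>of_int m * \<theta> - (x0 + of_int j * A)\<bar> \<le> R}.
        (cmod (rowsum \<theta> (\<lambda>j. x0 + of_int j * A) c (of_int m * \<theta>)))\<^sup>2)"
proof -
  have A: "5/2 * \<theta> \<le> A" "A > 0" "A \<le> 3 * \<theta>" using \<theta> \<delta> unfolding A_def by auto
  obtain C1 where C1: "C1 > 0" and mid: "\<And>r c0 c1 c2 c3. \<theta> - \<delta> \<le> r \<Longrightarrow> r \<le> \<theta> \<Longrightarrow>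
       (cmod c1)\<^sup>2 \<le> C1 * (\<Sum>i\<in>{-2..3::int}. (cmod (row4 \<theta> A c0 c1 c2 c3 (r + of_int i * \<theta>)))\<^sup>2)"
    using mid_pair_bound[OF \<theta> \<delta>] unfolding A_def by auto
  have cont: "continuous_on X (bump \<theta>)" for X using continuous_bump continuous_on_subset by blast
  obtain z where z: "z \<in> {\<theta>..2*\<theta>}" "\<And>s. s \<in> {\<theta>..2*\<theta>} \<Longrightarrow> bump \<theta> z \<le> bump \<theta> s"
    using continuous_attains_inf[OF compact_Icc _ cont, of \<theta> "2*\<theta>"] \<theta> by auto
  define k0 where "k0 = bump \<theta> z"
  have k0: "k0 > 0" unfolding k0_def using z(1) \<theta> by (intro bump_pos) auto
  have "bounded (bump \<theta> ` {-3*\<theta>..0})" by (intro compact_imp_bounded compact_continuous_image cont compact_Icc)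
  then obtain M where M': "M > 0" "\<forall>y\<in>bump \<theta> ` {-3*\<theta>..0}. norm y \<le> M"
    unfolding bounded_pos by blast
  then have M: "\<bar>bump \<theta> s\<bar> \<le> M" if "s \<in> {-3*\<theta>..0}" for s
    using that by fastforce
  \<comment> \<open>The loss at each step to the left; \<open>N\<close> bounds the number of steps.\<close>
  define C2 where "C2 = max 1 (2 * (1 + M\<^sup>2) / k0\<^sup>2)"
  have C2: "C2 \<ge> 1" "2 * (1 + M\<^sup>2) / k0\<^sup>2 \<le> C2" unfolding C2_def by auto
  define N where "N = nat \<lceil>\<theta> / \<delta>\<rceil>"
  define R where "R = of_nat N * A + 4 * \<theta>"
  have R: "R > 0" unfolding R_def using A \<theta> by (intro add_nonneg_pos) auto
  define C where "C = max 1 C1 * (2 * C2) ^ N"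
  have C: "C > 0" unfolding C_def using C2 by simp
  show ?thesis
  proof (rule that[OF C R])
    fix x0 :: real and c :: "int \<Rightarrow> complex" and j0 :: int
    define x where "x = (\<lambda>j. x0 + of_int j * A)"
    define W where "W = {m::int. \<bar>of_int m * \<theta> - x j0\<bar> \<le> R}"
    define e where "e = (\<lambda>m::int. (cmod (rowsum \<theta> x c (of_int m * \<theta>)))\<^sup>2)"
    define S where "S = (\<Sum>m\<in>W. e m)"
    have finW: "finite W"
    proof (rule finite_subset)
      show "W \<subseteq> {\<lfloor>(x j0 - R) / \<theta>\<rfloor>..\<lceil>(x j0 + R) / \<theta>\<rceil>}"
        unfolding W_def using \<theta> by (auto simp: floor_le_iff le_ceiling_iff field_simps abs_le_iff)
    qed simp
    have rows: "rowsum \<theta> x c (x j + s) = row4 \<theta> A (c (j - 1)) (c j) (c (j + 1)) (c (j + 2)) s"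
      if "- \<theta> - \<delta> \<le> s" "s \<le> 4 * \<theta>" for j s
      using rowsum_local[OF \<theta> \<delta> that, of x0 c j] unfolding x_def A_def .
    have inW: "m \<in> W" if "of_int m * \<theta> = x (j0 + int i) + s" "- 4 * \<theta> \<le> s" "s \<le> 4 * \<theta>" "i \<le> N" for m s i
    proof -
      have "x (j0 + int i) - x j0 = of_nat i * A" unfolding x_def by (simp add: algebra_simps)
      moreover have "of_nat i * A \<le> of_nat N * A" using that(4) A by (intro mult_right_mono) auto
      moreover have "0 \<le> of_nat i * A" using A by simp
      ultimately show ?thesis using that(1-3) unfolding W_def R_def by auto
    qed
    have eS: "e m \<le> S" if "m \<in> W" for m
      unfolding S_def by (rule member_le_sum[OF that _ finW]) (simp add: e_def)
    have S0: "S \<ge> 0" unfolding S_def e_def by (intro sum_nonneg) auto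
    \<comment> \<open>The node \<open>j0 + i\<close> is the one that the slip by \<open>\<delta>\<close> per step has brought into the right position.\<close>
    define k where "k = \<lfloor>x j0 / \<theta>\<rfloor>"
    define d where "d = x j0 - of_int k * \<theta>"
    have d: "0 \<le> d" "d < \<theta>"
      using floor_divide_lower[OF \<theta>, of "x j0"] floor_divide_upper[OF \<theta>, of "x j0"]
      unfolding d_def k_def by (auto simp: algebra_simps)
    define i where "i = nat \<lfloor>d / \<delta>\<rfloor>"
    have i: "of_nat i * \<delta> \<le> d" "d < (of_nat i + 1) * \<delta>"
    proof -
      have i': "real i = of_int \<lfloor>d / \<delta>\<rfloor>" unfolding i_def using d \<delta> by simp
      show "of_nat i * \<delta> \<le> d" "d < (of_nat i + 1) * \<delta>"
        using floor_divide_lower[OF \<delta>(1), of d] floor_divide_upper[OF \<delta>(1), of d] unfolding i' by auto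
    qed
    have "real i \<le> \<theta> / \<delta>" using i d \<delta> by (simp add: field_simps)
    then have iN: "i \<le> N" unfolding N_def by linarith
    define m where "m = k + 3 * int i + 1"
    define r where "r = of_int m * \<theta> - x (j0 + int i)"
    have "r = \<theta> - d + of_nat i * \<delta>"
      unfolding r_def m_def d_def x_def A_def by (simp add: algebra_simps)
    then have r: "\<theta> - \<delta> \<le> r" "r \<le> \<theta>" using i by (auto simp: algebra_simps)
    have top: "(cmod (c (j0 + int i)))\<^sup>2 \<le> max 1 C1 * S"
    proof -
      have sr: "x (j0 + int i) + (r + of_int l * \<theta>) = of_int (m + l) * \<theta>" for l
        unfolding r_def by (simp add: algebra_simps)
      have "(cmod (c (j0 + int i)))\<^sup>2 \<le> C1 * (\<Sum>l\<in>{-2..3::int}. e (m + l))"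
      proof (rule order_trans[OF mid[OF r, of _ "c (j0 + int i - 1)" "c (j0 + int i + 1)" "c (j0 + int i + 2)"]])
        have "e (m + l) = (cmod (row4 \<theta> A (c (j0 + int i - 1)) (c (j0 + int i))
            (c (j0 + int i + 1)) (c (j0 + int i + 2)) (r + of_int l * \<theta>)))\<^sup>2"
          if "l \<in> {-2..3}" for l
        proof -
          have "of_int (-2) * \<theta> \<le> of_int l * \<theta>" "of_int l * \<theta> \<le> of_int 3 * \<theta>"
            using that \<theta> by (intro mult_right_mono; simp)+
          then have b: "- \<theta> - \<delta> \<le> r + of_int l * \<theta>" "r + of_int l * \<theta> \<le> 4 * \<theta>"
            using r \<delta> by linarith+
          show ?thesis unfolding e_def sr[symmetric] rows[OF b] by simp
        qed
        then show "C1 * (\<Sum>l = - 2..3. (cmod (row4 \<theta> A (c (j0 + int i - 1)) (c (j0 + int i))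
            (c (j0 + int i + 1)) (c (j0 + int i + 2)) (r + of_int l * \<theta>)))\<^sup>2)
            \<le> C1 * (\<Sum>l = - 2..3. e (m + l))" by simp
      qed
      also have "(\<Sum>l\<in>{-2..3::int}. e (m + l)) = (\<Sum>l\<in>(+) m ` {-2..3}. e l)"
        by (subst sum.reindex) auto
      also have "C1 * (\<Sum>l\<in>(+) m ` {-2..3}. e l) \<le> C1 * S"
      proof (intro mult_left_mono)
        show "(\<Sum>l\<in>(+) m ` {-2..3}. e l) \<le> S" unfolding S_def
        proof (rule sum_mono2[OF finW])
          show "(+) m ` {-2..3} \<subseteq> W"
          proof safe
            fix l :: int assume "l \<in> {-2..3}"
            then have "of_int (-2) * \<theta> \<le> of_int l * \<theta>" "of_int l * \<theta> \<le> of_int 3 * \<theta>"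
              using \<theta> by (intro mult_right_mono; simp)+
            then have b: "- 4 * \<theta> \<le> r + of_int l * \<theta>" "r + of_int l * \<theta> \<le> 4 * \<theta>"
              using r \<delta> by linarith+
            show "m + l \<in> W" by (rule inW[OF sr[symmetric] b iN])
          qed
        qed (simp add: e_def)
      qed (use C1 in simp)
      also have "\<dots> \<le> max 1 C1 * S" using S0 by (intro mult_right_mono) auto
      finally show ?thesis .
    qed
    have step: "(cmod (c j))\<^sup>2 \<le> C2 * (S + (cmod (c (j + 1)))\<^sup>2)" if j: "j = j0 + int l" "l \<le> N" for j l
    proof -
      define m where "m = \<lfloor>x j / \<theta>\<rfloor> + 2"
      define s where "s = of_int m * \<theta> - x j"
      have s: "\<theta> \<le> s" "s \<le> 2 * \<theta>"
        using floor_divide_lower[OF \<theta>, of "x j"] floor_divide_upper[OF \<theta>, of "x j"]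
        unfolding s_def m_def by (auto simp: algebra_simps)
      have ms: "of_int m * \<theta> = x j + s" unfolding s_def by simp
      have row: "rowsum \<theta> x c (of_int m * \<theta>) = c j * complex_of_real (bump \<theta> s) + c (j + 1) * complex_of_real (bump \<theta> (s - A))"
      proof -
        have "bump \<theta> (s + A) = 0" "bump \<theta> (s - 2 * A) = 0"
          using s A \<theta> by (auto intro!: bump_eq_0)
        then show ?thesis unfolding ms using s \<theta> \<delta> by (subst rows) (auto simp: row4_def)
      qed
      have "m \<in> W" using inW[OF ms[unfolded j(1)]] s \<theta> j(2) by simp
      then have em: "e m \<le> S" by (rule eS)
      have ks: "k0 \<le> bump \<theta> s" unfolding k0_def using z(2) s by simp
      have Ms: "\<bar>bump \<theta> (s - A)\<bar> \<le> M" using s A by (intro M) auto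
      have "k0 * cmod (c j) \<le> bump \<theta> s * cmod (c j)" by (rule mult_right_mono[OF ks]) simp
      also have "\<dots> = cmod (c j * complex_of_real (bump \<theta> s))"
        using ks k0 by (simp add: norm_mult)
      also have "\<dots> = cmod (rowsum \<theta> x c (of_int m * \<theta>) - c (j + 1) * complex_of_real (bump \<theta> (s - A)))"
        unfolding row by simp
      also have "\<dots> \<le> cmod (rowsum \<theta> x c (of_int m * \<theta>)) + cmod (c (j + 1) * complex_of_real (bump \<theta> (s - A)))"
        by (rule norm_triangle_ineq4)
      also have "\<dots> \<le> cmod (rowsum \<theta> x c (of_int m * \<theta>)) + M * cmod (c (j + 1))"
        using mult_right_mono[OF Ms, of "cmod (c (j + 1))"] by (simp add: norm_mult mult.commute)
      finally have "(k0 * cmod (c j))\<^sup>2 \<le> (cmod (rowsum \<theta> x c (of_int m * \<theta>)) + M * cmod (c (j + 1)))\<^sup>2"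
        using k0 by (intro power_mono) auto
      also have "\<dots> \<le> 2 * (cmod (rowsum \<theta> x c (of_int m * \<theta>)))\<^sup>2 + 2 * (M * cmod (c (j + 1)))\<^sup>2"
        by (rule power2_sum_le)
      also have "\<dots> \<le> 2 * S + 2 * (M * cmod (c (j + 1)))\<^sup>2" using em unfolding e_def by simp
      also have "\<dots> \<le> 2 * (1 + M\<^sup>2) * (S + (cmod (c (j + 1)))\<^sup>2)"
        using S0 by (simp add: algebra_simps power_mult_distrib)
      finally have "(cmod (c j))\<^sup>2 \<le> 2 * (1 + M\<^sup>2) / k0\<^sup>2 * (S + (cmod (c (j + 1)))\<^sup>2)"
        using k0 by (simp add: power_mult_distrib field_simps)
      also have "\<dots> \<le> C2 * (S + (cmod (c (j + 1)))\<^sup>2)" using C2 S0 by (intro mult_right_mono) auto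
      finally show ?thesis .
    qed
    have "l \<le> i \<Longrightarrow> (cmod (c (j0 + int (i - l))))\<^sup>2 \<le> max 1 C1 * (2 * C2) ^ l * S" for l
    proof (induction l)
      case 0 then show ?case using top by simp
    next
      case (Suc l)
      have e1: "j0 + int (i - Suc l) + 1 = j0 + int (i - l)" using Suc.prems by (simp add: of_nat_diff)
      have "1 \<le> (2 * C2) ^ l" using C2 by (intro one_le_power) simp
      then have "1 * 1 \<le> max 1 C1 * (2 * C2) ^ l" by (intro mult_mono) simp_all
      then have big: "1 \<le> max 1 C1 * (2 * C2) ^ l" by simp
      have "(cmod (c (j0 + int (i - Suc l))))\<^sup>2 \<le> C2 * (S + (cmod (c (j0 + int (i - l))))\<^sup>2)"
        using step[of "j0 + int (i - Suc l)" "i - Suc l"] iN unfolding e1 by simp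
      also have "\<dots> \<le> C2 * (S + max 1 C1 * (2 * C2) ^ l * S)"
        using Suc C2 by (intro mult_left_mono add_left_mono) auto
      also have "\<dots> \<le> C2 * (max 1 C1 * (2 * C2) ^ l * S + max 1 C1 * (2 * C2) ^ l * S)"
        using C2 big S0 mult_right_mono[OF big S0] by (intro mult_left_mono add_right_mono) auto
      also have "\<dots> = max 1 C1 * (2 * C2) ^ Suc l * S" by (simp add: algebra_simps)
      finally show ?case .
    qed
    from this[of i] have "(cmod (c j0))\<^sup>2 \<le> max 1 C1 * (2 * C2) ^ i * S" by simp
    also have "\<dots> \<le> C * S" unfolding C_def
      using S0 C2 iN by (intro mult_right_mono mult_left_mono power_increasing) auto
    finally show "(cmod (c j0))\<^sup>2 \<le> C * (\<Sum>m\<in>{m::int. \<bar>of_int m * \<theta> - (x0 + of_int j0 * A)\<bar> \<le> R}.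
        (cmod (rowsum \<theta> (\<lambda>j. x0 + of_int j * A) c (of_int m * \<theta>)))\<^sup>2)"
      unfolding S_def W_def e_def x_def .
  qed
qed

section \<open>The discrete lower bound\<close>

lemma sum_eq_nn_integral_count_space:
  assumes "finite W" "\<And>m. e m \<ge> 0"
  shows "ennreal (\<Sum>m\<in>W. e m) = (\<integral>\<^sup>+m. ennreal (e m) * indicator W m \<partial>count_space UNIV)"
proof -
  have "(\<integral>\<^sup>+m. ennreal (e m) * indicator W m \<partial>count_space UNIV) = (\<Sum>m\<in>W. ennreal (e m) * indicator W m)"
    using assms(1) by (intro nn_integral_count_space') auto
  also have "\<dots> = (\<Sum>m\<in>W. ennreal (e m))" by (intro sum.cong) auto
  finally show ?thesis using assms by (simp add: sum_ennreal)
qed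

lemma int_window:
  fixes A R t :: real
  assumes A: "A > 0" and R: "R \<ge> 0"
  shows "finite {j::int. \<bar>t - of_int j * A\<bar> \<le> R}"
    and "real (card {j::int. \<bar>t - of_int j * A\<bar> \<le> R}) \<le> 2 * R / A + 1"
proof -
  let ?l = "\<lceil>(t - R) / A\<rceil>" and ?u = "\<lfloor>(t + R) / A\<rfloor>"
  have sub: "{j::int. \<bar>t - of_int j * A\<bar> \<le> R} \<subseteq> {?l..?u}"
    using A by (auto simp: ceiling_le_iff le_floor_iff field_simps abs_le_iff)
  then show "finite {j::int. \<bar>t - of_int j * A\<bar> \<le> R}" by (rule finite_subset) simp
  have "card {j::int. \<bar>t - of_int j * A\<bar> \<le> R} \<le> card {?l..?u}" by (intro card_mono sub) simp
  also have "\<dots> = nat (?u - ?l + 1)" by simp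
  finally have "real (card {j::int. \<bar>t - of_int j * A\<bar> \<le> R}) \<le> real (nat (?u - ?l + 1))" by simp
  also have "\<dots> \<le> 2 * R / A + 1"
  proof (cases "?u - ?l + 1 \<ge> 0")
    case True
    then have "real (nat (?u - ?l + 1)) = of_int ?u - of_int ?l + 1" by simp
    also have "\<dots> \<le> (t + R) / A - (t - R) / A + 1" by linarith
    also have "\<dots> = 2 * R / A + 1" using A by (simp add: field_simps)
    finally show ?thesis .
  next
    case False
    then show ?thesis using A R by simp
  qed
  finally show "real (card {j::int. \<bar>t - of_int j * A\<bar> \<le> R}) \<le> 2 * R / A + 1" .
qed

text \<open>Each lattice point lies in the window of a bounded number of nodes, so the local estimates can be
  summed.\<close>

lemma rowsum_lower:
  fixes \<theta> \<delta> :: real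
  assumes \<theta>: "\<theta> > 0" and \<delta>: "0 < \<delta>" "\<delta> \<le> \<theta>/2"
  defines "A \<equiv> 3 * \<theta> - \<delta>"
  obtains C where "C > 0"
    "\<And>x0 c. (\<integral>\<^sup>+j. ennreal ((cmod (c j))\<^sup>2) \<partial>count_space UNIV)
      \<le> ennreal C * (\<integral>\<^sup>+m. ennreal ((cmod (rowsum \<theta> (\<lambda>j. x0 + of_int j * A) c (of_int m * \<theta>)))\<^sup>2) \<partial>ints)"
proof -
  have A: "A > 0" using \<theta> \<delta> unfolding A_def by auto
  obtain C R where C: "C > 0" "R > 0" and loc:
    "\<And>x0 c j. (cmod (c j))\<^sup>2 \<le> C * (\<Sum>m\<in>{m::int. \<bar>of_int m * \<theta> - (x0 + of_int j * A)\<bar> \<le> R}.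
        (cmod (rowsum \<theta> (\<lambda>j. x0 + of_int j * A) c (of_int m * \<theta>)))\<^sup>2)"
    unfolding A_def by (rule rowsum_lower_local[OF \<theta> \<delta>], blast)
  define N where "N = 2 * R / A + 1"
  have N: "N > 0" unfolding N_def using C A by (simp add: add_pos_pos)
  show ?thesis
  proof (rule that[of "C * N"])
    show "C * N > 0" using C N by simp
    fix x0 :: real and c :: "int \<Rightarrow> complex"
    define e where "e = (\<lambda>m::int. (cmod (rowsum \<theta> (\<lambda>j. x0 + of_int j * A) c (of_int m * \<theta>)))\<^sup>2)"
    define W where "W = (\<lambda>j. {m::int. \<bar>of_int m * \<theta> - (x0 + of_int j * A)\<bar> \<le> R})"
    have finW: "finite (W j)" for j
    proof -
      have "W j = {m. \<bar>(x0 + of_int j * A) - of_int m * \<theta>\<bar> \<le> R}" unfolding W_def by (simp add: abs_minus_commute)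
      then show ?thesis using int_window(1)[OF \<theta>, of R] C by simp
    qed
    have "(\<integral>\<^sup>+j. ennreal ((cmod (c j))\<^sup>2) \<partial>count_space UNIV)
       \<le> (\<integral>\<^sup>+j. ennreal C * (\<integral>\<^sup>+m. ennreal (e m) * indicator (W j) m \<partial>count_space UNIV) \<partial>count_space UNIV)"
    proof (intro nn_integral_mono)
      fix j
      have "ennreal ((cmod (c j))\<^sup>2) \<le> ennreal (C * (\<Sum>m\<in>W j. e m))"
        using loc[of c j x0] unfolding W_def e_def by (rule ennreal_leI)
      also have "\<dots> = ennreal C * ennreal (\<Sum>m\<in>W j. e m)"
        using C by (intro ennreal_mult sum_nonneg) (auto simp: e_def)
      also have "ennreal (\<Sum>m\<in>W j. e m) = (\<integral>\<^sup>+m. ennreal (e m) * indicator (W j) m \<partial>count_space UNIV)"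
        by (rule sum_eq_nn_integral_count_space[OF finW]) (simp add: e_def)
      finally show "ennreal ((cmod (c j))\<^sup>2) \<le> ennreal C * (\<integral>\<^sup>+m. ennreal (e m) * indicator (W j) m \<partial>count_space UNIV)" .
    qed
    also have "\<dots> = ennreal C * (\<integral>\<^sup>+j. (\<integral>\<^sup>+m. ennreal (e m) * indicator (W j) m \<partial>count_space UNIV) \<partial>count_space UNIV)"
      by (rule nn_integral_cmult) simp
    also have "(\<integral>\<^sup>+j. (\<integral>\<^sup>+m. ennreal (e m) * indicator (W j) m \<partial>count_space UNIV) \<partial>count_space UNIV)
       = (\<integral>\<^sup>+m. (\<integral>\<^sup>+j. ennreal (e m) * indicator (W j) m \<partial>count_space UNIV) \<partial>count_space UNIV)"
      by (rule nn_integral_count_space_nn_integral) auto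
    also have "\<dots> \<le> (\<integral>\<^sup>+m. ennreal N * ennreal (e m) \<partial>count_space UNIV)"
    proof (intro nn_integral_mono)
      fix m :: int
      let ?V = "{j::int. \<bar>(of_int m * \<theta> - x0) - of_int j * A\<bar> \<le> R}"
      have "(\<integral>\<^sup>+j. ennreal (e m) * indicator (W j) m \<partial>count_space UNIV)
         = (\<integral>\<^sup>+j. ennreal (e m) * indicator ?V j \<partial>count_space UNIV)"
        by (intro nn_integral_cong) (auto simp: W_def indicator_def algebra_simps)
      also have "\<dots> = ennreal (e m) * emeasure (count_space UNIV) ?V"
        by (intro nn_integral_cmult_indicator) simp
      also have "emeasure (count_space UNIV) ?V = of_nat (card ?V)"
        using int_window(1)[OF A, of R "of_int m * \<theta> - x0"] C by (subst emeasure_count_space_finite) auto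
      also have "ennreal (e m) * of_nat (card ?V) \<le> ennreal (e m) * ennreal N"
        using int_window(2)[OF A, of R "of_int m * \<theta> - x0"] C unfolding N_def
        by (intro mult_left_mono) (auto simp: ennreal_of_nat_eq_real_of_nat ennreal_leI)
      finally show "(\<integral>\<^sup>+j. ennreal (e m) * indicator (W j) m \<partial>count_space UNIV) \<le> ennreal N * ennreal (e m)"
        by (simp add: mult.commute)
    qed
    also have "\<dots> = ennreal N * (\<integral>\<^sup>+m. ennreal (e m) \<partial>count_space UNIV)"
      by (rule nn_integral_cmult) simp
    also have "ennreal C * (ennreal N * (\<integral>\<^sup>+m. ennreal (e m) \<partial>count_space UNIV))
       = ennreal (C * N) * (\<integral>\<^sup>+m. ennreal (e m) \<partial>count_space UNIV)"
      using C N by (simp add: ennreal_mult mult.assoc)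
    finally show "(\<integral>\<^sup>+j. ennreal ((cmod (c j))\<^sup>2) \<partial>count_space UNIV)
      \<le> ennreal (C * N) * (\<integral>\<^sup>+m. ennreal ((cmod (rowsum \<theta> (\<lambda>j. x0 + of_int j * A) c (of_int m * \<theta>)))\<^sup>2) \<partial>ints)"
      unfolding e_def by (simp add: mult_left_mono)
  qed
qed

definition colsum :: "(int \<Rightarrow> real) \<Rightarrow> (int \<Rightarrow> complex) \<Rightarrow> real \<Rightarrow> complex" where
  "colsum x c y = (\<integral>j. c j * complex_of_real (profile (y - x j)) \<partial>count_space UNIV)"

lemma rowsum_eq_colsum:
  assumes "\<And>y. integrable (count_space UNIV) (\<lambda>j. c j * complex_of_real (profile (y - x j)))"
  shows "rowsum \<theta> x c y = - (\<Sum>i\<in>{-3..3}. complex_of_real (stencil \<theta> i) * colsum x c (y + of_int i * \<theta>)) / 2"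
proof -
  have "rowsum \<theta> x c y = (\<integral>j. - (\<Sum>i\<in>{-3..3}. complex_of_real (stencil \<theta> i) * (c j * complex_of_real (profile (y + of_int i * \<theta> - x j)))) / 2 \<partial>count_space UNIV)"
    unfolding rowsum_def bump_def
    by (intro Bochner_Integration.integral_cong) (auto simp: sum_distrib_left algebra_simps)
  also have "\<dots> = - (\<Sum>i\<in>{-3..3}. complex_of_real (stencil \<theta> i) * colsum x c (y + of_int i * \<theta>)) / 2"
    unfolding colsum_def using assms by (simp add: Bochner_Integration.integral_sum)
  finally show ?thesis .
qed

text \<open>A row sum of the bump is a fixed combination of seven translates by multiples of \<open>\<theta>\<close> of a row sum of
  the profile.  Such translates are again values on the same lattice.\<close>

lemma colsum_lower:
  fixes \<theta> \<delta> :: real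
  assumes \<theta>: "\<theta> > 0" and \<delta>: "0 < \<delta>" "\<delta> \<le> \<theta>/2"
  defines "A \<equiv> 3 * \<theta> - \<delta>"
  obtains C where "C > 0"
    "\<And>x0 c. (\<And>y. integrable (count_space UNIV) (\<lambda>j. c j * complex_of_real (profile (y - (x0 + of_int j * A))))) \<Longrightarrow>
      (\<integral>\<^sup>+j. ennreal ((cmod (c j))\<^sup>2) \<partial>count_space UNIV)
      \<le> ennreal C * (\<integral>\<^sup>+m. ennreal ((cmod (colsum (\<lambda>j. x0 + of_int j * A) c (of_int m * \<theta>)))\<^sup>2) \<partial>ints)"
proof -
  obtain C where C: "C > 0" and low:
    "\<And>x0 c. (\<integral>\<^sup>+j. ennreal ((cmod (c j))\<^sup>2) \<partial>count_space UNIV)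
      \<le> ennreal C * (\<integral>\<^sup>+m. ennreal ((cmod (rowsum \<theta> (\<lambda>j. x0 + of_int j * A) c (of_int m * \<theta>)))\<^sup>2) \<partial>ints)"
    unfolding A_def by (rule rowsum_lower[OF \<theta> \<delta>], blast)
  define L where "L = (\<Sum>i\<in>{-3..3::int}. (stencil \<theta> i)\<^sup>2)"
  have "stencil \<theta> 3 = 1" by (simp add: stencil_def)
  then have L: "L > 0" unfolding L_def by (intro sum_pos2[of _ 3]) auto
  show ?thesis
  proof (rule that[of "C * (7 * L)"])
    show "C * (7 * L) > 0" using C L by simp
    fix x0 :: real and c :: "int \<Rightarrow> complex"
    assume int: "\<And>y. integrable (count_space UNIV) (\<lambda>j. c j * complex_of_real (profile (y - (x0 + of_int j * A))))"
    define x where "x = (\<lambda>j. x0 + of_int j * A)"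
    define F where "F = (\<lambda>m::int. (cmod (colsum x c (of_int m * \<theta>)))\<^sup>2)"
    have "(cmod (rowsum \<theta> x c (of_int m * \<theta>)))\<^sup>2 \<le> L * (\<Sum>i\<in>{-3..3}. F (m + i))" for m :: int
    proof -
      let ?f = "\<lambda>i. cmod (colsum x c (of_int (m + i) * \<theta>))"
      have "cmod (rowsum \<theta> x c (of_int m * \<theta>)) = cmod (\<Sum>i\<in>{-3..3}. complex_of_real (stencil \<theta> i) * colsum x c (of_int (m + i) * \<theta>)) / 2"
        using rowsum_eq_colsum[of c x \<theta> "of_int m * \<theta>"] int unfolding x_def
        by (simp add: norm_divide algebra_simps)
      also have "\<dots> \<le> cmod (\<Sum>i\<in>{-3..3}. complex_of_real (stencil \<theta> i) * colsum x c (of_int (m + i) * \<theta>))" by simp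
      also have "\<dots> \<le> (\<Sum>i\<in>{-3..3}. \<bar>stencil \<theta> i\<bar> * ?f i)"
        by (rule order_trans[OF norm_sum]) (simp add: norm_mult)
      finally have "(cmod (rowsum \<theta> x c (of_int m * \<theta>)))\<^sup>2 \<le> (\<Sum>i\<in>{-3..3}. \<bar>stencil \<theta> i\<bar> * ?f i)\<^sup>2"
        by (intro power_mono) auto
      also have "\<dots> \<le> (\<Sum>i\<in>{-3..3}. \<bar>stencil \<theta> i\<bar>\<^sup>2) * (\<Sum>i\<in>{-3..3}. (?f i)\<^sup>2)"
        by (rule Cauchy_Schwarz_ineq_sum)
      finally show ?thesis unfolding L_def F_def by simp
    qed
    then have "(\<integral>\<^sup>+m. ennreal ((cmod (rowsum \<theta> x c (of_int m * \<theta>)))\<^sup>2) \<partial>count_space UNIV)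
       \<le> (\<integral>\<^sup>+m. ennreal (L * (\<Sum>i\<in>{-3..3}. F (m + i))) \<partial>ints)"
      by (intro nn_integral_mono ennreal_leI)
    also have "\<dots> = (\<integral>\<^sup>+m. ennreal L * (\<Sum>i\<in>{-3..3}. ennreal (F (m + i))) \<partial>ints)"
      using L by (intro nn_integral_cong) (simp add: ennreal_mult sum_nonneg F_def flip: sum_ennreal)
    also have "\<dots> = ennreal L * (\<Sum>i\<in>{-3..3}. (\<integral>\<^sup>+m. ennreal (F (m + i)) \<partial>ints))"
      by (simp add: nn_integral_cmult nn_integral_sum)
    also have "(\<Sum>i\<in>{-3..3}. (\<integral>\<^sup>+m. ennreal (F (m + i)) \<partial>ints))
       = (\<Sum>i\<in>{-3..3::int}. (\<integral>\<^sup>+m. ennreal (F m) \<partial>ints))"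
    proof (intro sum.cong refl)
      fix i :: int
      have "bij_betw (\<lambda>m::int. m + i) UNIV UNIV"
        by (intro bij_betwI[of _ _ _ "\<lambda>m. m - i"]) auto
      then show "(\<integral>\<^sup>+m. ennreal (F (m + i)) \<partial>ints) = (\<integral>\<^sup>+m. ennreal (F m) \<partial>count_space UNIV)"
        by (rule nn_integral_bij_count_space)
    qed
    also have "\<dots> = ennreal 7 * (\<integral>\<^sup>+m. ennreal (F m) \<partial>ints)" by simp
    finally have "(\<integral>\<^sup>+m. ennreal ((cmod (rowsum \<theta> x c (of_int m * \<theta>)))\<^sup>2) \<partial>count_space UNIV)
       \<le> ennreal L * (ennreal 7 * (\<integral>\<^sup>+m. ennreal (F m) \<partial>ints))" .
    then have "ennreal C * (\<integral>\<^sup>+m. ennreal ((cmod (rowsum \<theta> x c (of_int m * \<theta>)))\<^sup>2) \<partial>count_space UNIV)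
       \<le> ennreal C * (ennreal L * (ennreal 7 * (\<integral>\<^sup>+m. ennreal (F m) \<partial>ints)))"
      by (rule mult_left_mono) simp
    also have "\<dots> = ennreal (C * (7 * L)) * (\<integral>\<^sup>+m. ennreal (F m) \<partial>ints)"
      using C L by (simp add: ennreal_mult' mult_ac)
    finally show "(\<integral>\<^sup>+j. ennreal ((cmod (c j))\<^sup>2) \<partial>count_space UNIV)
      \<le> ennreal (C * (7 * L)) * (\<integral>\<^sup>+m. ennreal ((cmod (colsum (\<lambda>j. x0 + of_int j * A) c (of_int m * \<theta>)))\<^sup>2) \<partial>ints)"
      using low[of c x0] unfolding x_def F_def by (rule order_trans[rotated])
  qed
qed

section \<open>Parseval on an interval\<close>

text \<open>Trigonometric polynomials, in the form in which restrictions of polynomials to the circle are most easily recognised.\<close>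

inductive trigpoly :: "(real \<Rightarrow> complex) \<Rightarrow> bool" where
  monomial: "trigpoly (\<lambda>x. c * cis (of_int k * x))"
| add: "trigpoly f \<Longrightarrow> trigpoly g \<Longrightarrow> trigpoly (\<lambda>x. f x + g x)"

lemma trigpoly_const: "trigpoly (\<lambda>x. c)"
  using trigpoly.monomial[of c 0] by simp

lemma trigpoly_mult:
  assumes "trigpoly f" "trigpoly g"
  shows "trigpoly (\<lambda>x. f x * g x)"
  using assms
proof (induction rule: trigpoly.induct)
  case (monomial c k)
  then show ?case
  proof (induction rule: trigpoly.induct)
    case (monomial d l)
    have "(\<lambda>x. c * cis (of_int k * x) * (d * cis (of_int l * x))) = (\<lambda>x. (c * d) * cis (of_int (k + l) * x))"
      by (rule ext) (simp add: cis_mult[symmetric] algebra_simps)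
    then show ?case using trigpoly.monomial[of "c * d" "k + l"] by simp
  next
    case (add f g)
    then show ?case using trigpoly.add by (simp add: algebra_simps)
  qed
next
  case (add f f')
  then show ?case using trigpoly.add by (simp add: algebra_simps)
qed

lemma trigpoly_real_polynomial:
  assumes "real_polynomial_function p"
  shows "trigpoly (\<lambda>x. complex_of_real (p (cis x)))"
  using assms
proof (induction rule: real_polynomial_function.induct)
  case (linear f)
  have "complex_of_real (f (cis x)) = (complex_of_real (f 1) / 2 + complex_of_real (f \<i>) / (2 * \<i>)) * cis (of_int 1 * x)
     + (complex_of_real (f 1) / 2 - complex_of_real (f \<i>) / (2 * \<i>)) * cis (of_int (-1) * x)" for x
  proof -
    have "cis x = cos x *\<^sub>R 1 + sin x *\<^sub>R \<i>" by (simp add: complex_eq_iff)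
    then have "f (cis x) = cos x * f 1 + sin x * f \<i>"
      using linear by (simp add: bounded_linear.linear linear_add linear_scale)
    then show ?thesis by (simp add: complex_eq_iff field_simps)
  qed
  then show ?case by (simp only:) (intro trigpoly.intros)
next
  case (const c)
  then show ?case by (rule trigpoly_const)
next
  case (add f g)
  then show ?case using trigpoly.add by simp
next
  case (mult f g)
  then show ?case using trigpoly_mult by simp
qed

lemma trigpoly_polynomial:
  fixes p :: "complex \<Rightarrow> complex"
  assumes "polynomial_function p"
  shows "trigpoly (\<lambda>x. p (cis x))"
proof -
  have "real_polynomial_function (\<lambda>z. Re (p z))" "real_polynomial_function (\<lambda>z. Im (p z))"
    using assms bounded_linear_Re bounded_linear_Im unfolding polynomial_function_def o_def by blast+
  then have "trigpoly (\<lambda>x. complex_of_real (Re (p (cis x))) + \<i> * complex_of_real (Im (p (cis x))))"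
    by (intro trigpoly.add trigpoly_mult trigpoly_const trigpoly_real_polynomial)
  then show ?thesis by (simp add: complex_eq[symmetric])
qed

lemma trigpoly_sum:
  assumes "trigpoly f"
  shows "\<exists>K d. finite K \<and> (\<forall>x. f x = (\<Sum>k\<in>K. d k * cis (of_int k * x)))"
  using assms
proof (induction rule: trigpoly.induct)
  case (monomial c k)
  show ?case by (rule exI[of _ "{k}"], rule exI[of _ "\<lambda>_. c"]) simp
next
  case (add f g)
  then obtain K d K' d' where K: "finite K" "\<And>x. f x = (\<Sum>k\<in>K. d k * cis (of_int k * x))"
    and K': "finite K'" "\<And>x. g x = (\<Sum>k\<in>K'. d' k * cis (of_int k * x))" by blast
  have e1: "f x = (\<Sum>k\<in>K \<union> K'. (if k \<in> K then d k else 0) * cis (of_int k * x))" for x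
    unfolding K(2) using K(1) K'(1) by (intro sum.mono_neutral_cong_left) auto
  have e2: "g x = (\<Sum>k\<in>K \<union> K'. (if k \<in> K' then d' k else 0) * cis (of_int k * x))" for x
    unfolding K'(2) using K(1) K'(1) by (intro sum.mono_neutral_cong_left) auto
  show ?case
    by (rule exI[of _ "K \<union> K'"], rule exI[of _ "\<lambda>k. (if k \<in> K then d k else 0) + (if k \<in> K' then d' k else 0)"])
       (use K(1) K'(1) in \<open>simp only: e1 e2 sum.distrib distrib_right finite_UnI simp_thms\<close>)
qed

text \<open>Since \<open>f\<close> agrees at both ends, it is a function on the unit circle, continuous because \<open>cis\<close> maps
  closed subsets of the compact interval to closed sets.  The Weierstrass approximation theorem then applies.\<close>

lemma uniform_trigpoly_approximation:
  fixes f :: "real \<Rightarrow> complex"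
  assumes f: "continuous_on {0..2*pi} f" "f 0 = f (2*pi)" and e: "e > 0"
  shows "\<exists>p. trigpoly p \<and> (\<forall>x\<in>{0..2*pi}. cmod (f x - p x) < e)"
proof -
  define S where "S = sphere (0::complex) 1"
  define F where "F = (\<lambda>z. f (Arg2pi z))"
  have cis_S: "cis x \<in> S" for x unfolding S_def by simp
  have F_cis: "F (cis x) = f x" if "x \<in> {0..2*pi}" for x
  proof (cases "x = 2 * pi")
    case True
    moreover have "Arg2pi 1 = 0" by (rule Arg2pi_unique[of 1]) auto
    ultimately show ?thesis using f(2) unfolding F_def by simp
  next
    case False
    then have "Arg2pi (cis x) = x"
      using that by (intro Arg2pi_unique[of 1]) (auto simp: cis_conv_exp)
    then show ?thesis unfolding F_def by simp
  qed
  have surj: "\<exists>x\<in>{0..2*pi}. z = cis x" if "z \<in> S" for z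
  proof (rule bexI[of _ "Arg2pi z"])
    show "z = cis (Arg2pi z)" using that Arg2pi_eq[of z] unfolding S_def by (simp add: cis_conv_exp)
    show "Arg2pi z \<in> {0..2*pi}" using Arg2pi_ge_0[of z] Arg2pi_lt_2pi[of z] by simp
  qed
  have contF: "continuous_on S F"
  proof (subst continuous_on_closed_vimage)
    show "closed S" unfolding S_def by simp
    show "\<forall>B. closed B \<longrightarrow> closed (F -` B \<inter> S)"
    proof (intro allI impI)
      fix B :: "complex set" assume B: "closed B"
      have "closed (f -` B \<inter> {0..2*pi})"
        using f(1) B continuous_on_closed_vimage[of "{0..2*pi}" f] by simp
      from compact_Int_closed[OF compact_Icc this] have "compact ({0..2*pi} \<inter> (f -` B \<inter> {0..2*pi}))" .
      then have "compact (cis ` ({0..2*pi} \<inter> (f -` B \<inter> {0..2*pi})))"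
        by (intro compact_continuous_image continuous_intros)
      moreover have "F -` B \<inter> S = cis ` ({0..2*pi} \<inter> (f -` B \<inter> {0..2*pi}))"
      proof (intro equalityI subsetI)
        fix z assume z: "z \<in> F -` B \<inter> S"
        obtain x where x: "x \<in> {0..2*pi}" "z = cis x" using surj z by blast
        then have "f x \<in> B" using z F_cis[OF x(1)] by simp
        then show "z \<in> cis ` ({0..2*pi} \<inter> (f -` B \<inter> {0..2*pi}))" using x by blast
      next
        fix z assume "z \<in> cis ` ({0..2*pi} \<inter> (f -` B \<inter> {0..2*pi}))"
        then obtain x where x: "x \<in> {0..2*pi}" "f x \<in> B" "z = cis x" by blast
        then show "z \<in> F -` B \<inter> S" using F_cis[OF x(1)] cis_S by simp
      qed
      ultimately show "closed (F -` B \<inter> S)" by (simp add: compact_imp_closed)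
    qed
  qed
  have "compact S" unfolding S_def by simp
  from Stone_Weierstrass_polynomial_function[OF this contF e]
  obtain p where p: "polynomial_function p" "\<And>z. z \<in> S \<Longrightarrow> cmod (F z - p z) < e" by blast
  show ?thesis
  proof (intro exI[of _ "\<lambda>x. p (cis x)"] conjI ballI)
    show "trigpoly (\<lambda>x. p (cis x))" by (rule trigpoly_polynomial[OF p(1)])
    fix x assume "x \<in> {0..2*pi}"
    then show "cmod (f x - p (cis x)) < e" using p(2)[OF cis_S, of x] F_cis by simp
  qed
qed

lemma uniform_trig_approximation_interval:
  fixes f :: "real \<Rightarrow> complex"
  assumes L: "L > 0" and f: "continuous_on {u..u+L} f" "f u = f (u + L)" and e: "e > 0"
  shows "\<exists>(K::int set) d. finite K \<and>
    (\<forall>x\<in>{u..u+L}. cmod (f x - (\<Sum>k\<in>K. d k * cis (2 * pi * of_int k * x / L))) < e)"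
proof -
  define h where "h = (\<lambda>t. f (u + L * t / (2 * pi)))"
  have "continuous_on {0..2*pi} h" unfolding h_def
    by (intro continuous_on_compose2[OF f(1)] continuous_intros)
       (use L in \<open>auto simp: field_simps\<close>)
  moreover have "h 0 = h (2 * pi)" unfolding h_def using f(2) by simp
  ultimately obtain p where p: "trigpoly p" "\<And>t. t \<in> {0..2*pi} \<Longrightarrow> cmod (h t - p t) < e"
    using uniform_trigpoly_approximation e by blast
  obtain K d where K: "finite K" "\<And>t. p t = (\<Sum>k\<in>K. d k * cis (of_int k * t))"
    using trigpoly_sum[OF p(1)] by blast
  show ?thesis
  proof (rule exI[of _ K], rule exI[of _ "\<lambda>k. d k * cis (- (2 * pi * of_int k * u / L))"], intro conjI ballI K(1))
    fix x assume x: "x \<in> {u..u+L}"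
    define t where "t = 2 * pi * (x - u) / L"
    have "0 \<le> (x - u) / L" "(x - u) / L \<le> 1" using x L by (auto simp: field_simps)
    then have "2 * pi * ((x - u) / L) \<le> 2 * pi * 1" "0 \<le> 2 * pi * ((x - u) / L)"
      by (intro mult_left_mono mult_nonneg_nonneg; simp)+
    then have t: "t \<in> {0..2*pi}" unfolding t_def by simp
    have ht: "h t = f x" unfolding h_def t_def using L by simp
    have e: "d k * cis (- (2 * pi * of_int k * u / L)) * cis (2 * pi * of_int k * x / L) = d k * cis (of_int k * t)" for k
      unfolding mult.assoc cis_mult t_def using L by (simp add: field_simps)
    have "(\<Sum>k\<in>K. d k * cis (- (2 * pi * of_int k * u / L)) * cis (2 * pi * of_int k * x / L)) = p t"
      unfolding K(2) by (intro sum.cong refl e)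
    then show "cmod (f x - (\<Sum>k\<in>K. d k * cis (- (2 * pi * of_int k * u / L)) * cis (2 * pi * of_int k * x / L))) < e"
      using p(2)[OF t] ht by simp
  qed
qed

text \<open>Lebesgue measure on one period.  The half-open interval makes the translates by multiples of \<open>L\<close> a partition of
  the line.\<close>

definition seg :: "real \<Rightarrow> real \<Rightarrow> real measure" where
  "seg u L = restrict_space lborel {u..<u+L}"

lemma space_seg [simp]: "space (seg u L) = {u..<u+L}"
  by (simp add: seg_def space_restrict_space)

lemma finite_measure_seg: "finite_measure (seg u L)"
proof (rule finite_measureI)
  show "emeasure (seg u L) (space (seg u L)) \<noteq> \<infinity>"
    by (cases "L \<ge> 0") (simp_all add: seg_def space_restrict_space emeasure_restrict_space)
qed

lemma borel_measurable_seg: "f \<in> borel_measurable borel \<Longrightarrow> f \<in> borel_measurable (seg u L)"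
  unfolding seg_def by (rule measurable_restrict_space1) simp

lemma borel_measurable_seg_continuous:
  fixes f :: "real \<Rightarrow> 'a::topological_space"
  assumes "continuous_on {u..u+L} f"
  shows "f \<in> borel_measurable (seg u L)"
proof -
  have "f \<in> borel_measurable (restrict_space borel {u..<u+L})"
    by (rule borel_measurable_continuous_on_restrict) (rule continuous_on_subset[OF assms], auto)
  then show ?thesis
    by (simp add: seg_def measurable_cong_sets[OF sets_restrict_space_cong[OF sets_lborel] refl])
qed

lemma integrable_seg_bounded:
  fixes f :: "real \<Rightarrow> 'a::{banach, second_countable_topology}"
  assumes "f \<in> borel_measurable (seg u L)" "\<And>x. x \<in> {u..<u+L} \<Longrightarrow> norm (f x) \<le> B"
  shows "integrable (seg u L) f"
  by (rule finite_measure.integrable_const_bound[OF finite_measure_seg _ assms(1), of B])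
     (use assms(2) in \<open>auto intro!: AE_I2\<close>)

lemma integral_seg_Icc:
  fixes f :: "real \<Rightarrow> 'a::{banach, second_countable_topology}"
  assumes "continuous_on {u..u+L} f"
  shows "integral\<^sup>L (seg u L) f = integral\<^sup>L lborel (\<lambda>x. indicator {u..u+L} x *\<^sub>R f x)"
proof -
  define g where "g = (\<lambda>x. indicator {u..u+L} x *\<^sub>R f x)"
  have m [measurable]: "g \<in> borel_measurable borel"
    unfolding g_def by (rule borel_measurable_continuous_on_indicator) (use assms in auto)
  have "integral\<^sup>L (seg u L) f = integral\<^sup>L lborel (\<lambda>x. indicator {u..<u+L} x *\<^sub>R f x)"
    unfolding seg_def by (rule integral_restrict_space) simp
  also have "\<dots> = integral\<^sup>L lborel (\<lambda>x. indicator {u..<u+L} x *\<^sub>R g x)"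
    unfolding g_def by (rule Bochner_Integration.integral_cong) (auto simp: indicator_def)
  also have "\<dots> = integral\<^sup>L lborel g"
  proof (rule integral_cong_AE)
    show "AE x in lborel. indicator {u..<u+L} x *\<^sub>R g x = g x"
      using AE_lborel_singleton[of "u + L"] by eventually_elim (simp add: g_def indicator_def)
  qed simp_all
  finally show ?thesis unfolding g_def .
qed

lemma integral_cis_seg:
  assumes L: "L > 0"
  shows "(\<integral>x. cis (2 * pi * of_int k * x / L) \<partial>seg u L) = (if k = 0 then complex_of_real L else 0)"
proof (cases "k = 0")
  case True
  have "(\<integral>x. cis (2 * pi * of_int k * x / L) \<partial>seg u L) = integral\<^sup>L lborel (\<lambda>x. indicator {u..u+L} x *\<^sub>R (1::complex))"
    unfolding True by (subst integral_seg_Icc) (auto intro!: continuous_intros)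
  also have "\<dots> = complex_of_real L" using L by (simp add: scaleR_conv_of_real)
  finally show ?thesis using True by simp
next
  case False
  define w where "w = 2 * pi * of_int k / L"
  have w: "w \<noteq> 0" unfolding w_def using False L by simp
  have "(\<integral>x. cis (2 * pi * of_int k * x / L) \<partial>seg u L) = integral\<^sup>L lborel (\<lambda>x. indicator {u..u+L} x *\<^sub>R cis (w * x))"
    by (subst integral_seg_Icc) (use L in \<open>auto intro!: continuous_intros simp: w_def\<close>)
  also have "\<dots> = cis (w * (u + L)) / (\<i> * w) - cis (w * u) / (\<i> * w)"
  proof (rule integral_FTC_atLeastAtMost)
    show "continuous_on {u..u+L} (\<lambda>x. cis (w * x))" by (intro continuous_intros)
    fix x
    have "((\<lambda>z. exp (\<i> * w * z) / (\<i> * w)) has_field_derivative exp (\<i> * w * of_real x)) (at (of_real x))"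
      using w by (auto intro!: derivative_eq_intros)
    from has_vector_derivative_real_field[OF this]
    show "((\<lambda>x. cis (w * x) / (\<i> * w)) has_vector_derivative cis (w * x)) (at x within {u..u+L})"
      by (simp add: cis_conv_exp mult.assoc)
  qed (use L in simp)
  also have "cis (w * (u + L)) = cis (w * u)"
  proof -
    have "w * (u + L) = w * u + 2 * pi * of_int k" unfolding w_def using L by (simp add: field_simps)
    moreover have "cis (2 * pi * of_int k) = 1" by (rule cis_multiple_2pi) simp
    ultimately show ?thesis by (simp only: cis_mult[symmetric] mult_1_right)
  qed
  finally show ?thesis using False by simp
qed

text \<open>Expanding the square and using orthogonality of the exponentials; the Fourier coefficients are visibly the best
  choice of \<open>d\<close>.\<close>

lemma fourier_best_approximation:
  fixes f :: "real \<Rightarrow> complex"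
  assumes L: "L > 0" and f: "f \<in> borel_measurable (seg u L)" "\<And>x. x \<in> {u..<u+L} \<Longrightarrow> cmod (f x) \<le> B"
    and K: "finite K"
  defines "c \<equiv> \<lambda>k::int. (\<integral>x. f x * cis (- (2 * pi * of_int k * x / L)) \<partial>seg u L)"
  shows "(\<integral>x. (cmod (f x - (\<Sum>k\<in>K. d k * cis (2 * pi * of_int k * x / L))))\<^sup>2 \<partial>seg u L)
    = (\<integral>x. (cmod (f x))\<^sup>2 \<partial>seg u L) - (\<Sum>k\<in>K. (cmod (c k))\<^sup>2) / L + L * (\<Sum>k\<in>K. (cmod (d k - c k / L))\<^sup>2)"
proof -
  define e where "e = (\<lambda>(k::int) x. cis (2 * pi * of_int k * x / L))"
  have em [measurable]: "e k \<in> borel_measurable (seg u L)" for k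
    unfolding e_def by (intro borel_measurable_seg borel_measurable_continuous_onI continuous_intros) (use L in auto)
  note f(1) [measurable]
  have cnjm: "(\<lambda>z. cnj z) \<in> borel_measurable borel"
    by (intro borel_measurable_continuous_onI continuous_intros)
  have [measurable]: "(\<lambda>x. cnj (e k x)) \<in> borel_measurable (seg u L)" for k
    using measurable_compose[OF em cnjm] .
  have [measurable]: "(\<lambda>x. cnj (f x)) \<in> borel_measurable (seg u L)"
    using measurable_compose[OF f(1) cnjm] .
  have cnje: "cnj (e k x) = cis (- (2 * pi * of_int k * x / L))" for k x unfolding e_def by (simp add: cis_cnj)
  define b where "b = \<bar>B\<bar>"
  have b: "0 \<le> b" "\<And>x. x \<in> {u..<u+L} \<Longrightarrow> cmod (f x) \<le> b"
    unfolding b_def using order_trans[OF f(2) abs_ge_self] by simp_all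
  have ne: "cmod (e k x) = 1" for k x unfolding e_def by simp
  have i1: "integrable (seg u L) (\<lambda>x. f x * cnj (e k x))" for k
    by (rule integrable_seg_bounded[of _ _ _ b]) (use b in \<open>auto simp: norm_mult ne\<close>)
  have i2: "integrable (seg u L) (\<lambda>x. e k x * cnj (f x))" for k
    by (rule integrable_seg_bounded[of _ _ _ b]) (use b in \<open>auto simp: norm_mult ne\<close>)
  have i3: "integrable (seg u L) (\<lambda>x. f x * cnj (f x))"
    by (rule integrable_seg_bounded[of _ _ _ "b * b"]) (use b in \<open>auto simp: norm_mult intro!: mult_mono\<close>)
  have i4: "integrable (seg u L) (\<lambda>x. e k x * cnj (e l x))" for k l
    by (rule integrable_seg_bounded[of _ _ _ 1]) (auto simp: norm_mult ne)
  have c1: "(\<integral>x. f x * cnj (e k x) \<partial>seg u L) = c k" for k unfolding c_def cnje ..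
  have c2: "(\<integral>x. e k x * cnj (f x) \<partial>seg u L) = cnj (c k)" for k
    unfolding c1[symmetric] by (subst Bochner_Integration.integral_cnj[symmetric]) (simp add: mult.commute)
  have c4: "(\<integral>x. e k x * cnj (e l x) \<partial>seg u L) = (if k = l then complex_of_real L else 0)" for k l
  proof -
    have "e k x * cnj (e l x) = cis (2 * pi * of_int (k - l) * x / L)" for x
      unfolding cnje unfolding e_def cis_mult by (simp add: field_simps diff_divide_distrib)
    then show ?thesis using integral_cis_seg[OF L, where k = "k - l" and u = u] by simp
  qed
  define T where "T = (\<lambda>x. \<Sum>k\<in>K. d k * e k x)"
  have "complex_of_real (\<integral>x. (cmod (f x - T x))\<^sup>2 \<partial>seg u L) = (\<integral>x. (f x - T x) * cnj (f x - T x) \<partial>seg u L)"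
    unfolding complex_norm_square[symmetric] by (rule integral_complex_of_real[symmetric])
  also have "\<dots> = (\<integral>x. f x * cnj (f x) - (\<Sum>k\<in>K. d k * (e k x * cnj (f x))) - (\<Sum>k\<in>K. cnj (d k) * (f x * cnj (e k x)))
       + (\<Sum>l\<in>K. \<Sum>k\<in>K. d k * cnj (d l) * (e k x * cnj (e l x))) \<partial>seg u L)"
    unfolding T_def
    by (intro Bochner_Integration.integral_cong)
       (auto simp: algebra_simps sum_product sum_distrib_left sum_distrib_right)
  also have "\<dots> = (\<integral>x. f x * cnj (f x) \<partial>seg u L) - (\<Sum>k\<in>K. d k * cnj (c k)) - (\<Sum>k\<in>K. cnj (d k) * c k)
       + (\<Sum>l\<in>K. \<Sum>k\<in>K. d k * cnj (d l) * (if k = l then complex_of_real L else 0))"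
    by (simp add: i1 i2 i3 i4 c1 c2 c4 Bochner_Integration.integral_sum)
  also have "(\<integral>x. f x * cnj (f x) \<partial>seg u L) = complex_of_real (\<integral>x. (cmod (f x))\<^sup>2 \<partial>seg u L)"
    unfolding complex_norm_square[symmetric] by (rule integral_complex_of_real)
  also have "(\<Sum>l\<in>K. \<Sum>k\<in>K. d k * cnj (d l) * (if k = l then complex_of_real L else 0)) = (\<Sum>k\<in>K. d k * cnj (d k) * L)"
    using K by (intro sum.cong refl) (simp add: if_distrib[of "(*) _"] sum.delta cong: if_cong)
  also have "complex_of_real (\<integral>x. (cmod (f x))\<^sup>2 \<partial>seg u L) - (\<Sum>k\<in>K. d k * cnj (c k)) - (\<Sum>k\<in>K. cnj (d k) * c k) + (\<Sum>k\<in>K. d k * cnj (d k) * L)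
     = complex_of_real (\<integral>x. (cmod (f x))\<^sup>2 \<partial>seg u L) - (\<Sum>k\<in>K. c k * cnj (c k)) / L
       + L * (\<Sum>k\<in>K. (d k - c k / L) * cnj (d k - c k / L))"
  proof -
    have "d k * cnj (d k) * L - d k * cnj (c k) - cnj (d k) * c k
      = L * ((d k - c k / L) * cnj (d k - c k / L)) - c k * cnj (c k) / L" for k
      using L by (simp add: field_simps)
    then have "(\<Sum>k\<in>K. d k * cnj (d k) * L - d k * cnj (c k) - cnj (d k) * c k)
      = (\<Sum>k\<in>K. L * ((d k - c k / L) * cnj (d k - c k / L)) - c k * cnj (c k) / L)"
      by (intro sum.cong refl)
    then have eq: "(\<Sum>k\<in>K. d k * cnj (d k) * L) - (\<Sum>k\<in>K. d k * cnj (c k)) - (\<Sum>k\<in>K. cnj (d k) * c k)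
      = L * (\<Sum>k\<in>K. (d k - c k / L) * cnj (d k - c k / L)) - (\<Sum>k\<in>K. c k * cnj (c k)) / L"
      unfolding sum_subtractf sum_distrib_left[symmetric] sum_divide_distrib[symmetric] .
    have "A - B - C = D - E \<Longrightarrow> I - B - C + A = I - E + D" for I A B C D E :: complex
      by (simp add: algebra_simps)
    from this[OF eq] show ?thesis .
  qed
  also have "\<dots> = complex_of_real ((\<integral>x. (cmod (f x))\<^sup>2 \<partial>seg u L) - (\<Sum>k\<in>K. (cmod (c k))\<^sup>2) / L
       + L * (\<Sum>k\<in>K. (cmod (d k - c k / L))\<^sup>2))"
    by (simp add: complex_norm_square del: of_real_power)
  finally show ?thesis unfolding T_def e_def of_real_eq_iff .
qed

lemma nn_integral_count_space_eqI:
  fixes g :: "int \<Rightarrow> real"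
  assumes nn: "\<And>k. g k \<ge> 0" and up: "\<And>K. finite K \<Longrightarrow> (\<Sum>k\<in>K. g k) \<le> B"
    and low: "\<And>\<epsilon>. \<epsilon> > 0 \<Longrightarrow> \<exists>K. finite K \<and> B - \<epsilon> \<le> (\<Sum>k\<in>K. g k)"
  shows "(\<integral>\<^sup>+k. ennreal (g k) \<partial>count_space UNIV) = ennreal B"
proof -
  have B0: "B \<ge> 0" using up[of "{}"] by simp
  have fin: "ennreal (\<Sum>k\<in>K. g k) = (\<integral>\<^sup>+k. ennreal (g k) * indicator K k \<partial>count_space UNIV)" if "finite K" for K
  proof -
    have "(\<integral>\<^sup>+k. ennreal (g k) * indicator K k \<partial>count_space UNIV) = (\<Sum>k\<in>K. ennreal (g k) * indicator K k)"
      using that by (intro nn_integral_count_space') auto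
    also have "\<dots> = (\<Sum>k\<in>K. ennreal (g k))" by (intro sum.cong) auto
    finally show ?thesis using nn by (simp add: sum_ennreal)
  qed
  have "(\<integral>\<^sup>+k. ennreal (g k) \<partial>count_space UNIV) = (\<integral>\<^sup>+k. (SUP n. ennreal (g k) * indicator {- int n..int n} k) \<partial>count_space UNIV)"
  proof (intro nn_integral_cong antisym)
    fix k :: int
    have "k \<in> {- int (nat \<bar>k\<bar>)..int (nat \<bar>k\<bar>)}" by auto
    then have "ennreal (g k) = ennreal (g k) * indicator {- int (nat \<bar>k\<bar>)..int (nat \<bar>k\<bar>)} k" by simp
    then show "ennreal (g k) \<le> (SUP n. ennreal (g k) * indicator {- int n..int n} k)"
      by (metis (no_types, lifting) SUP_upper UNIV_I)
    show "(SUP n. ennreal (g k) * indicator {- int n..int n} k) \<le> ennreal (g k)"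
      by (intro SUP_least) (auto simp: indicator_def)
  qed
  also have "\<dots> = (SUP n. (\<integral>\<^sup>+k. ennreal (g k) * indicator {- int n..int n} k \<partial>count_space UNIV))"
    by (intro nn_integral_monotone_convergence_SUP) (auto simp: incseq_def le_fun_def indicator_def)
  also have "\<dots> \<le> ennreal B"
    using up by (intro SUP_least) (auto simp: fin[symmetric] intro!: ennreal_leI)
  finally have le: "(\<integral>\<^sup>+k. ennreal (g k) \<partial>count_space UNIV) \<le> ennreal B" .
  moreover have "ennreal B \<le> (\<integral>\<^sup>+k. ennreal (g k) \<partial>count_space UNIV)"
  proof (rule ennreal_le_epsilon)
    fix \<epsilon> :: real assume "\<epsilon> > 0"
    from low[OF this] obtain K where K: "finite K" "B - \<epsilon> \<le> (\<Sum>k\<in>K. g k)" by blast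
    have "ennreal B \<le> ennreal ((\<Sum>k\<in>K. g k) + \<epsilon>)" using K by (intro ennreal_leI) simp
    also have "\<dots> = ennreal (\<Sum>k\<in>K. g k) + ennreal \<epsilon>"
      using \<open>\<epsilon> > 0\<close> nn by (intro ennreal_plus sum_nonneg) auto
    also have "\<dots> \<le> (\<integral>\<^sup>+k. ennreal (g k) \<partial>count_space UNIV) + ennreal \<epsilon>"
      unfolding fin[OF K(1)] by (intro add_right_mono nn_integral_mono) (auto simp: indicator_def)
    finally show "ennreal B \<le> (\<integral>\<^sup>+k. ennreal (g k) \<partial>count_space UNIV) + ennreal \<epsilon>" .
  qed
  ultimately show ?thesis by (rule antisym)
qed

text \<open>Bessel's inequality bounds the sum from above, and uniform approximation by trigonometric polynomials shows
  that nothing is lost.\<close>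

lemma parseval_continuous:
  fixes f :: "real \<Rightarrow> complex"
  assumes L: "L > 0" and f: "continuous_on {u..u+L} f" "f u = f (u + L)"
  shows "(\<integral>\<^sup>+k. ennreal ((cmod (\<integral>x. f x * cis (- (2 * pi * of_int k * x / L)) \<partial>seg u L))\<^sup>2) \<partial>ints)
    = ennreal L * (\<integral>\<^sup>+x. ennreal ((cmod (f x))\<^sup>2) \<partial>seg u L)"
proof -
  have m: "f \<in> borel_measurable (seg u L)" by (rule borel_measurable_seg_continuous[OF f(1)])
  have "bounded (f ` {u..u+L})" by (intro compact_imp_bounded compact_continuous_image f) simp
  then obtain B where B: "\<forall>y\<in>f ` {u..u+L}. norm y \<le> B" unfolding bounded_iff by blast
  then have bd: "cmod (f x) \<le> B" if "x \<in> {u..<u+L}" for x using that by force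
  have B0: "B \<ge> 0" using order_trans[OF norm_ge_zero bd[of u]] L by simp
  have int2: "integrable (seg u L) (\<lambda>x. (cmod (f x))\<^sup>2)"
    using m by (intro integrable_seg_bounded[of _ _ _ "B\<^sup>2"]) (auto intro!: power_mono bd)
  define c where "c = (\<lambda>k::int. (\<integral>x. f x * cis (- (2 * pi * of_int k * x / L)) \<partial>seg u L))"
  define I where "I = (\<integral>x. (cmod (f x))\<^sup>2 \<partial>seg u L)"
  have best: "(\<integral>x. (cmod (f x - (\<Sum>k\<in>K. d k * cis (2 * pi * of_int k * x / L))))\<^sup>2 \<partial>seg u L)
    = I - (\<Sum>k\<in>K. (cmod (c k))\<^sup>2) / L + L * (\<Sum>k\<in>K. (cmod (d k - c k / L))\<^sup>2)" if "finite K" for K d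
    unfolding I_def c_def by (rule fourier_best_approximation[OF L m bd that])
  have "(\<integral>\<^sup>+k. ennreal ((cmod (c k))\<^sup>2) \<partial>count_space UNIV) = ennreal (L * I)"
  proof (rule nn_integral_count_space_eqI)
    fix K :: "int set" assume K: "finite K"
    have "0 \<le> (\<integral>x. (cmod (f x - (\<Sum>k\<in>K. c k / L * cis (2 * pi * of_int k * x / L))))\<^sup>2 \<partial>seg u L)"
      by (intro integral_nonneg_AE) simp
    also have "\<dots> = I - (\<Sum>k\<in>K. (cmod (c k))\<^sup>2) / L" unfolding best[OF K] by simp
    finally show "(\<Sum>k\<in>K. (cmod (c k))\<^sup>2) \<le> L * I" using L by (simp add: field_simps)
  next
    fix \<epsilon> :: real assume \<epsilon>: "\<epsilon> > 0"
    define \<eta> where "\<eta> = sqrt \<epsilon> / L"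
    have \<eta>: "\<eta> > 0" unfolding \<eta>_def using \<epsilon> L by simp
    from uniform_trig_approximation_interval[OF L f \<eta>] obtain K :: "int set" and d where K: "finite K"
      "\<forall>x\<in>{u..u+L}. cmod (f x - (\<Sum>k\<in>K. d k * cis (2 * pi * of_int k * x / L))) < \<eta>"
      by (elim exE conjE) (rule that)
    have "I - (\<Sum>k\<in>K. (cmod (c k))\<^sup>2) / L \<le> I - (\<Sum>k\<in>K. (cmod (c k))\<^sup>2) / L + L * (\<Sum>k\<in>K. (cmod (d k - c k / L))\<^sup>2)"
      using L by (simp add: sum_nonneg)
    also have "\<dots> = (\<integral>x. (cmod (f x - (\<Sum>k\<in>K. d k * cis (2 * pi * of_int k * x / L))))\<^sup>2 \<partial>seg u L)"
      unfolding best[OF K(1)] ..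
    also have "\<dots> \<le> (\<integral>x. \<eta>\<^sup>2 \<partial>seg u L)"
    proof (rule integral_mono_AE')
      show "integrable (seg u L) (\<lambda>x. \<eta>\<^sup>2)" by (rule integrable_seg_bounded[of _ _ _ "\<eta>\<^sup>2"]) auto
      show "AE x in seg u L. (cmod (f x - (\<Sum>k\<in>K. d k * cis (2 * pi * of_int k * x / L))))\<^sup>2 \<le> \<eta>\<^sup>2"
      proof (rule AE_I2)
        fix x assume "x \<in> space (seg u L)"
        then have "cmod (f x - (\<Sum>k\<in>K. d k * cis (2 * pi * of_int k * x / L))) \<le> \<eta>"
          using K(2) by (auto intro: less_imp_le)
        then show "(cmod (f x - (\<Sum>k\<in>K. d k * cis (2 * pi * of_int k * x / L))))\<^sup>2 \<le> \<eta>\<^sup>2"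
          by (rule power_mono) simp
      qed
    qed simp
    also have "\<dots> = L * \<eta>\<^sup>2"
      using L by (simp add: seg_def measure_restrict_space)
    also have "L * \<eta>\<^sup>2 = \<epsilon> / L"
      unfolding \<eta>_def using L \<epsilon> by (simp add: power_divide power2_eq_square)
    finally have "L * (I - (\<Sum>k\<in>K. (cmod (c k))\<^sup>2) / L) \<le> L * (\<epsilon> / L)"
      using L by (intro mult_left_mono) auto
    then have "L * I - \<epsilon> \<le> (\<Sum>k\<in>K. (cmod (c k))\<^sup>2)"
      using L by (simp add: right_diff_distrib)
    then show "\<exists>K. finite K \<and> L * I - \<epsilon> \<le> (\<Sum>k\<in>K. (cmod (c k))\<^sup>2)" using K(1) by blast
  qed simp
  also have "ennreal (L * I) = ennreal L * ennreal I"
    using L unfolding I_def by (intro ennreal_mult integral_nonneg_AE) auto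
  also have "ennreal I = (\<integral>\<^sup>+x. ennreal ((cmod (f x))\<^sup>2) \<partial>seg u L)"
    unfolding I_def using int2 by (intro nn_integral_eq_integral[symmetric]) auto
  finally show ?thesis unfolding c_def .
qed

section \<open>Periodization and the discrete upper bound\<close>

lemma int_cell_indicator:
  fixes a x :: real
  assumes a: "a > 0"
  shows "(\<integral>\<^sup>+j. indicator {of_int j * a..<of_int j * a + a} x \<partial>ints) = 1"
proof -
  have iff: "x \<in> {of_int j * a..<of_int j * a + a} \<longleftrightarrow> j = \<lfloor>x / a\<rfloor>" for j :: int
  proof -
    have "x \<in> {of_int j * a..<of_int j * a + a} \<longleftrightarrow> of_int j \<le> x / a \<and> x / a < of_int j + 1"
      using a by (auto simp: field_simps)
    also have "\<dots> \<longleftrightarrow> \<lfloor>x / a\<rfloor> = j" by (simp add: floor_eq_iff)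
    finally show ?thesis by auto
  qed
  have "(\<integral>\<^sup>+j. indicator {of_int j * a..<of_int j * a + a} x \<partial>ints)
      = (\<integral>\<^sup>+j. indicator {\<lfloor>x / a\<rfloor>} j \<partial>ints)"
    by (intro nn_integral_cong) (simp add: indicator_def iff del: atLeastLessThan_iff)
  also have "\<dots> = 1" by simp
  finally show ?thesis .
qed

lemma nn_integral_periodize:
  fixes \<phi> :: "real \<Rightarrow> ennreal"
  assumes a: "a > 0" and [measurable]: "\<phi> \<in> borel_measurable borel"
  shows "(\<integral>\<^sup>+x. \<phi> x \<partial>lborel) = (\<integral>\<^sup>+\<xi>. (\<integral>\<^sup>+j. \<phi> (\<xi> + of_int j * a) \<partial>ints) \<partial>seg 0 a)"
proof -
  have "(\<integral>\<^sup>+x. \<phi> x \<partial>lborel)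
      = (\<integral>\<^sup>+x. (\<integral>\<^sup>+j. \<phi> x * indicator {of_int j * a..<of_int j * a + a} x \<partial>ints) \<partial>lborel)"
    by (intro nn_integral_cong) (simp add: nn_integral_cmult int_cell_indicator[OF a])
  also have "\<dots> = (\<integral>\<^sup>+j. (\<integral>\<^sup>+x. \<phi> x * indicator {of_int j * a..<of_int j * a + a} x \<partial>lborel) \<partial>ints)"
    by (rule nn_integral_count_space_nn_integral) auto
  also have "\<dots> = (\<integral>\<^sup>+j. (\<integral>\<^sup>+\<xi>. \<phi> (\<xi> + of_int j * a) \<partial>seg 0 a) \<partial>ints)"
  proof (intro nn_integral_cong)
    fix j :: int
    have "(\<integral>\<^sup>+x. \<phi> x * indicator {of_int j * a..<of_int j * a + a} x \<partial>lborel)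
       = (\<integral>\<^sup>+x. \<phi> (of_int j * a + 1 * x) * indicator {of_int j * a..<of_int j * a + a} (of_int j * a + 1 * x) \<partial>lborel)"
      by (subst nn_integral_real_affine[where c = 1 and t = "of_int j * a"]) auto
    also have "\<dots> = (\<integral>\<^sup>+x. \<phi> (x + of_int j * a) * indicator {0..<0+a} x \<partial>lborel)"
      by (intro nn_integral_cong) (auto simp: indicator_def add.commute)
    also have "\<dots> = (\<integral>\<^sup>+\<xi>. \<phi> (\<xi> + of_int j * a) \<partial>seg 0 a)"
      unfolding seg_def by (rule nn_integral_restrict_space[symmetric]) simp
    finally show "(\<integral>\<^sup>+x. \<phi> x * indicator {of_int j * a..<of_int j * a + a} x \<partial>lborel) = (\<integral>\<^sup>+\<xi>. \<phi> (\<xi> + of_int j * a) \<partial>seg 0 a)" .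
  qed
  also have "\<dots> = (\<integral>\<^sup>+\<xi>. (\<integral>\<^sup>+j. \<phi> (\<xi> + of_int j * a) \<partial>ints) \<partial>seg 0 a)"
    by (rule nn_integral_count_space_nn_integral[symmetric]) (auto intro!: borel_measurable_seg)
  finally show ?thesis .
qed

lemma sigma_finite_seg: "sigma_finite_measure (seg u L)"
  using finite_measure_seg finite_measure.axioms(1) by blast

lemma pair_sigma_finite_seg: "pair_sigma_finite (ints) (seg u L)"
  by (intro pair_sigma_finite.intro sigma_finite_seg sigma_finite_measure_count_space)

lemma measurable_shift_pair [measurable]:
  "(\<lambda>z. snd z + of_int (fst z) * a) \<in> borel_measurable (ints \<Otimes>\<^sub>M seg u L)"
proof -
  have "(\<lambda>z. real_of_int (fst z)) \<in> borel_measurable (ints \<Otimes>\<^sub>M seg u L)"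
    by (rule measurable_compose[OF measurable_fst]) simp
  moreover have "(\<lambda>z. snd z) \<in> borel_measurable (ints \<Otimes>\<^sub>M seg u L)"
    by (rule measurable_compose[OF measurable_snd]) (rule borel_measurable_seg, simp)
  ultimately show ?thesis by simp
qed

lemma distr_periodize:
  assumes a: "a > 0"
  shows "distr (ints \<Otimes>\<^sub>M seg 0 a) lborel (\<lambda>z. snd z + of_int (fst z) * a) = lborel"
proof (rule measure_eqI)
  interpret pair_sigma_finite "ints" "seg 0 a" by (rule pair_sigma_finite_seg)
  fix A assume "A \<in> sets (distr (ints \<Otimes>\<^sub>M seg 0 a) lborel (\<lambda>z. snd z + of_int (fst z) * a))"
  then have A [measurable]: "A \<in> sets borel" by simp
  have T: "(\<lambda>z. snd z + of_int (fst z) * a) \<in> measurable (ints \<Otimes>\<^sub>M seg 0 a) lborel"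
    using measurable_shift_pair by simp
  have "emeasure (distr (ints \<Otimes>\<^sub>M seg 0 a) lborel (\<lambda>z. snd z + of_int (fst z) * a)) A
     = (\<integral>\<^sup>+x. indicator A x \<partial>distr (ints \<Otimes>\<^sub>M seg 0 a) lborel (\<lambda>z. snd z + of_int (fst z) * a))"
    using A by simp
  also have "\<dots> = (\<integral>\<^sup>+z. indicator A (snd z + of_int (fst z) * a) \<partial>(ints \<Otimes>\<^sub>M seg 0 a))"
    by (rule nn_integral_distr[OF T]) simp
  also have "\<dots> = (\<integral>\<^sup>+\<xi>. (\<integral>\<^sup>+j. indicator A (\<xi> + of_int j * a) \<partial>ints) \<partial>seg 0 a)"
    by (subst nn_integral_snd[symmetric]) simp_all
  also have "\<dots> = (\<integral>\<^sup>+x. indicator A x \<partial>lborel)"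
    by (rule nn_integral_periodize[OF a, symmetric]) simp
  also have "\<dots> = emeasure lborel A" by simp
  finally show "emeasure (distr (ints \<Otimes>\<^sub>M seg 0 a) lborel (\<lambda>z. snd z + of_int (fst z) * a)) A = emeasure lborel A" .
qed simp

lemma integral_periodize:
  fixes \<Psi> :: "real \<Rightarrow> complex"
  assumes a: "a > 0" and int: "integrable lborel \<Psi>"
  shows "(\<integral>x. \<Psi> x \<partial>lborel) = (\<integral>\<xi>. (\<integral>j. \<Psi> (\<xi> + of_int j * a) \<partial>ints) \<partial>seg 0 a)"
proof -
  interpret pair_sigma_finite "ints" "seg 0 a" by (rule pair_sigma_finite_seg)
  have T: "(\<lambda>z. snd z + of_int (fst z) * a) \<in> measurable (ints \<Otimes>\<^sub>M seg 0 a) lborel"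
    using measurable_shift_pair by simp
  have m: "\<Psi> \<in> borel_measurable lborel" using int by simp
  have "integrable (distr (ints \<Otimes>\<^sub>M seg 0 a) lborel (\<lambda>z. snd z + of_int (fst z) * a)) \<Psi>"
    using int by (simp add: distr_periodize[OF a])
  then have i2: "integrable (ints \<Otimes>\<^sub>M seg 0 a) (\<lambda>z. \<Psi> (snd z + of_int (fst z) * a))"
    by (rule integrable_distr[OF T])
  have "(\<integral>x. \<Psi> x \<partial>lborel) = (\<integral>x. \<Psi> x \<partial>distr (ints \<Otimes>\<^sub>M seg 0 a) lborel (\<lambda>z. snd z + of_int (fst z) * a))"
    by (simp add: distr_periodize[OF a])
  also have "\<dots> = (\<integral>z. \<Psi> (snd z + of_int (fst z) * a) \<partial>(ints \<Otimes>\<^sub>M seg 0 a))"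
    by (rule integral_distr[OF T m])
  also have "\<dots> = (\<integral>\<xi>. (\<integral>j. \<Psi> (\<xi> + of_int j * a) \<partial>ints) \<partial>seg 0 a)"
    using integral_snd[of "\<lambda>j \<xi>. \<Psi> (\<xi> + of_int j * a)"] i2 unfolding case_prod_beta' by (simp only:)
  finally show ?thesis .
qed

lemma nn_integral_exp_abs: "c > 0 \<Longrightarrow> (\<integral>\<^sup>+x. ennreal (exp (- (c * \<bar>x\<bar>))) \<partial>lborel) \<le> ennreal (2 / c)"
proof -
  assume c: "c > 0"
  have lim: "((\<lambda>x. - exp (- (c * x)) / c) \<longlongrightarrow> 0) at_top"
    using c by real_asymp
  have half: "(\<integral>\<^sup>+x. ennreal (exp (- (c * x))) * indicator {0..} x \<partial>lborel) = ennreal (0 - (- exp (- (c * 0)) / c))"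
    by (rule nn_integral_FTC_atLeast[OF _ _ _ lim]) (use c in \<open>auto intro!: derivative_eq_intros\<close>)
  have "(\<integral>\<^sup>+x. ennreal (exp (- (c * \<bar>x\<bar>))) \<partial>lborel)
      \<le> (\<integral>\<^sup>+x. ennreal (exp (- (c * x))) * indicator {0..} x + ennreal (exp (- (c * (- x)))) * indicator {0..} (- x) \<partial>lborel)"
    by (intro nn_integral_mono) (auto simp: indicator_def)
  also have "\<dots> = (\<integral>\<^sup>+x. ennreal (exp (- (c * x))) * indicator {0..} x \<partial>lborel)
      + (\<integral>\<^sup>+x. ennreal (exp (- (c * (- x)))) * indicator {0..} (- x) \<partial>lborel)"
    by (intro nn_integral_add) auto
  also have "(\<integral>\<^sup>+x. ennreal (exp (- (c * (- x)))) * indicator {0..} (- x) \<partial>lborel)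
      = (\<integral>\<^sup>+x. ennreal (exp (- (c * x))) * indicator {0..} x \<partial>lborel)"
    by (subst nn_integral_real_affine[where c = "-1" and t = 0]) auto
  finally show ?thesis unfolding half using c by (simp add: ennreal_plus[symmetric] del: ennreal_plus)
qed

text \<open>Moving a point within a cell of length \<open>a\<close> changes the summand by a factor of at most \<open>exp a\<close>, so the sum is
  comparable with the integral over the line.\<close>

lemma exp_sum_bound:
  assumes a: "a > 0"
  obtains H where "H > 0" "\<And>s. (\<integral>\<^sup>+j. ennreal (exp (- \<bar>s + of_int j * a\<bar>)) \<partial>ints) \<le> ennreal H"
proof (rule that[of "2 * exp a / a"])
  show "2 * exp a / a > 0" using a by simp
  fix s :: real
  let ?S = "\<integral>\<^sup>+j. ennreal (exp (- \<bar>s + of_int j * a\<bar>)) \<partial>ints"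
  have "ennreal a * ?S = (\<integral>\<^sup>+\<xi>. ?S \<partial>seg 0 a)"
    using a by (simp add: seg_def emeasure_restrict_space space_restrict_space mult.commute)
  also have "\<dots> \<le> (\<integral>\<^sup>+\<xi>. (\<integral>\<^sup>+j. ennreal (exp a) * ennreal (exp (- (1 * \<bar>s + (\<xi> + of_int j * a)\<bar>))) \<partial>ints) \<partial>seg 0 a)"
  proof (intro nn_integral_mono)
    fix \<xi> j assume "\<xi> \<in> space (seg 0 a)"
    then have "- \<bar>s + of_int j * a\<bar> \<le> a + - (1 * \<bar>s + (\<xi> + of_int j * a)\<bar>)" by auto
    then have "exp (- \<bar>s + of_int j * a\<bar>) \<le> exp a * exp (- (1 * \<bar>s + (\<xi> + of_int j * a)\<bar>))"
      unfolding exp_add[symmetric] by simp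
    then show "ennreal (exp (- \<bar>s + of_int j * a\<bar>)) \<le> ennreal (exp a) * ennreal (exp (- (1 * \<bar>s + (\<xi> + of_int j * a)\<bar>)))"
      by (simp add: ennreal_mult[symmetric] ennreal_leI)
  qed
  also have "\<dots> = (\<integral>\<^sup>+x. ennreal (exp a) * ennreal (exp (- (1 * \<bar>s + x\<bar>))) \<partial>lborel)"
    by (rule nn_integral_periodize[OF a, symmetric]) simp
  also have "\<dots> = ennreal (exp a) * (\<integral>\<^sup>+x. ennreal (exp (- (1 * \<bar>s + x\<bar>))) \<partial>lborel)"
    by (rule nn_integral_cmult) simp
  also have "(\<integral>\<^sup>+x. ennreal (exp (- (1 * \<bar>s + x\<bar>))) \<partial>lborel) = (\<integral>\<^sup>+x. ennreal (exp (- (1 * \<bar>x\<bar>))) \<partial>lborel)"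
    by (subst nn_integral_real_affine[where c = 1 and t = s, of "\<lambda>x. ennreal (exp (- (1 * \<bar>x\<bar>)))"]) auto
  also have "ennreal (exp a) * \<dots> \<le> ennreal (exp a) * ennreal (2 / 1)"
    by (intro mult_left_mono nn_integral_exp_abs) auto
  finally have "ennreal (1 / a) * (ennreal a * ?S) \<le> ennreal (1 / a) * (ennreal (exp a) * ennreal 2)"
    by (intro mult_left_mono) simp_all
  moreover have "ennreal (2 * exp a / a) = ennreal (1 / a) * (ennreal (exp a) * ennreal 2)"
    using a by (subst ennreal_mult'[symmetric], simp, subst ennreal_mult'[symmetric]) (simp_all add: field_simps)
  moreover have "ennreal (1 / a) * (ennreal a * ?S) = ?S"
    using a by (simp add: mult.assoc[symmetric] ennreal_mult[symmetric])
  ultimately show "?S \<le> ennreal (2 * exp a / a)" by (simp only:)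
qed

lemma profile_nonneg: "0 \<le> profile t" by (simp add: profile_def)

lemma profile_le_exp: "profile t \<le> exp (- \<bar>t\<bar>)"
proof -
  have "(1 - exp (- \<bar>t\<bar>))\<^sup>2 \<le> 1\<^sup>2" by (intro power_mono) auto
  then have "exp (- \<bar>t\<bar>) * (1 - exp (- \<bar>t\<bar>))\<^sup>2 \<le> exp (- \<bar>t\<bar>) * 1" by (intro mult_left_mono) auto
  then show ?thesis unfolding profile_def by simp
qed

lemma profile_sum_bound:
  assumes a: "a > 0"
  obtains H where "H > 0" "\<And>s. (\<integral>\<^sup>+j. ennreal (profile (s - of_int j * a)) \<partial>ints) \<le> ennreal H"
    "\<And>s. (\<integral>\<^sup>+j. ennreal (profile (of_int j * a - s)) \<partial>ints) \<le> ennreal H"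
proof -
  obtain H where H: "H > 0" "\<And>s. (\<integral>\<^sup>+j. ennreal (exp (- \<bar>s + of_int j * a\<bar>)) \<partial>ints) \<le> ennreal H"
    by (rule exp_sum_bound[OF a], blast)
  have 1: "(\<integral>\<^sup>+j. ennreal (profile (of_int j * a - s)) \<partial>ints) \<le> ennreal H" for s
    by (rule order_trans[OF nn_integral_mono H(2)[of "- s"]]) (auto intro!: ennreal_leI order_trans[OF profile_le_exp])
  have "profile (s - of_int j * a) = profile (of_int j * a - s)" for s j
    using profile_even[of "of_int j * a - s"] by simp
  then show ?thesis using that[OF H(1)] 1 by simp
qed

lemma integrable_profile_row:
  fixes c :: "int \<Rightarrow> complex"
  assumes a: "a > 0" and c: "\<And>j. cmod (c j) \<le> B"
  shows "integrable (count_space UNIV) (\<lambda>j. c j * complex_of_real (profile (y - (x0 + of_int j * a))))"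
proof -
  obtain H where H: "H > 0" "\<And>s. (\<integral>\<^sup>+j. ennreal (profile (s - of_int j * a)) \<partial>ints) \<le> ennreal H"
    by (rule profile_sum_bound[OF a], blast)
  have B: "0 \<le> B" using order_trans[OF norm_ge_zero c] .
  show ?thesis
  proof (rule integrableI_bounded)
    have "(\<integral>\<^sup>+j. ennreal (norm (c j * complex_of_real (profile (y - (x0 + of_int j * a))))) \<partial>count_space UNIV)
      \<le> (\<integral>\<^sup>+j. ennreal B * ennreal (profile ((y - x0) - of_int j * a)) \<partial>count_space UNIV)"
      using c B by (intro nn_integral_mono)
        (auto simp: norm_mult profile_nonneg ennreal_mult[symmetric] diff_diff_eq intro!: ennreal_leI mult_right_mono)
    also have "\<dots> = ennreal B * (\<integral>\<^sup>+j. ennreal (profile ((y - x0) - of_int j * a)) \<partial>count_space UNIV)"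
      by (rule nn_integral_cmult) simp
    also have "\<dots> \<le> ennreal B * ennreal H" by (intro mult_left_mono H) simp
    also have "\<dots> < \<infinity>" by (simp add: ennreal_mult_less_top)
    finally show "(\<integral>\<^sup>+j. ennreal (norm (c j * complex_of_real (profile (y - (x0 + of_int j * a))))) \<partial>count_space UNIV) < \<infinity>" .
  qed simp
qed

text \<open>Schur's test: the Cauchy--Schwarz inequality with respect to the weights \<open>profile\<close>, whose sums over rows and over
  columns are bounded.\<close>

lemma colsum_upper:
  fixes \<theta> a :: real
  assumes a: "a > 0" and \<theta>: "\<theta> > 0"
  obtains C where "C > 0" "\<And>x0 c B. (\<And>j. cmod (c j) \<le> B) \<Longrightarrow>
     (\<integral>\<^sup>+m. ennreal ((cmod (colsum (\<lambda>j. x0 + of_int j * a) c (of_int m * \<theta>)))\<^sup>2) \<partial>ints)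
      \<le> ennreal C * (\<integral>\<^sup>+j. ennreal ((cmod (c j))\<^sup>2) \<partial>count_space UNIV)"
proof -
  obtain H where H: "H > 0" "\<And>s. (\<integral>\<^sup>+j. ennreal (profile (s - of_int j * a)) \<partial>ints) \<le> ennreal H"
    by (rule profile_sum_bound[OF a], blast)
  obtain G where G: "G > 0" "\<And>s. (\<integral>\<^sup>+j. ennreal (profile (of_int j * \<theta> - s)) \<partial>ints) \<le> ennreal G"
    by (rule profile_sum_bound[OF \<theta>], blast)
  show ?thesis
  proof (rule that[of "H * G"])
    show "H * G > 0" using H G by simp
    fix x0 B :: real and c :: "int \<Rightarrow> complex" assume c: "\<And>j. cmod (c j) \<le> B"
    define x where "x = (\<lambda>j::int. x0 + of_int j * a)"
    have int: "integrable (count_space UNIV) (\<lambda>j. c j * complex_of_real (profile (y - x j)))" for y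
      unfolding x_def by (rule integrable_profile_row[OF a c])
    have pt: "ennreal ((cmod (colsum x c y))\<^sup>2)
       \<le> ennreal H * (\<integral>\<^sup>+j. ennreal ((cmod (c j))\<^sup>2) * ennreal (profile (y - x j)) \<partial>count_space UNIV)" for y
    proof -
      let ?f = "\<lambda>j. ennreal (sqrt (profile (y - x j)))"
      let ?g = "\<lambda>j. ennreal (cmod (c j) * sqrt (profile (y - x j)))"
      have "ennreal (cmod (colsum x c y)) \<le> (\<integral>\<^sup>+j. ennreal (norm (c j * complex_of_real (profile (y - x j)))) \<partial>count_space UNIV)"
        unfolding colsum_def by (rule integral_norm_bound_ennreal[OF int])
      also have "\<dots> = (\<integral>\<^sup>+j. ?f j * ?g j \<partial>count_space UNIV)"
      proof (intro nn_integral_cong)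
        fix j
        have "profile (y - x j) = sqrt (profile (y - x j)) * sqrt (profile (y - x j))" using profile_nonneg by simp
        then show "ennreal (norm (c j * complex_of_real (profile (y - x j)))) = ?f j * ?g j"
          using profile_nonneg by (simp add: norm_mult ennreal_mult[symmetric] mult_ac)
      qed
      finally have "(ennreal (cmod (colsum x c y)))\<^sup>2 \<le> (\<integral>\<^sup>+j. ?f j * ?g j \<partial>count_space UNIV)\<^sup>2"
        by (rule power_mono) simp
      also have "\<dots> \<le> (\<integral>\<^sup>+j. (?f j)\<^sup>2 \<partial>count_space UNIV) * (\<integral>\<^sup>+j. (?g j)\<^sup>2 \<partial>count_space UNIV)"
        by (rule Cauchy_Schwarz_nn_integral) simp_all
      also have "\<dots> = (\<integral>\<^sup>+j. ennreal (profile ((y - x0) - of_int j * a)) \<partial>count_space UNIV)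
          * (\<integral>\<^sup>+j. ennreal ((cmod (c j))\<^sup>2) * ennreal (profile (y - x j)) \<partial>count_space UNIV)"
        by (intro arg_cong2[of _ _ _ _ "(*)"] nn_integral_cong)
          (auto simp: ennreal_power profile_nonneg power_mult_distrib ennreal_mult[symmetric] x_def diff_diff_eq)
      also have "\<dots> \<le> ennreal H * (\<integral>\<^sup>+j. ennreal ((cmod (c j))\<^sup>2) * ennreal (profile (y - x j)) \<partial>count_space UNIV)"
        by (intro mult_right_mono H) simp
      finally show ?thesis by (simp add: ennreal_power)
    qed
    have "(\<integral>\<^sup>+m. ennreal ((cmod (colsum x c (of_int m * \<theta>)))\<^sup>2) \<partial>ints)
      \<le> (\<integral>\<^sup>+m. ennreal H * (\<integral>\<^sup>+j. ennreal ((cmod (c j))\<^sup>2) * ennreal (profile (of_int m * \<theta> - x j)) \<partial>count_space UNIV) \<partial>ints)"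
      by (intro nn_integral_mono pt)
    also have "\<dots> = ennreal H * (\<integral>\<^sup>+m. (\<integral>\<^sup>+j. ennreal ((cmod (c j))\<^sup>2) * ennreal (profile (of_int m * \<theta> - x j)) \<partial>count_space UNIV) \<partial>ints)"
      by (rule nn_integral_cmult) simp
    also have "(\<integral>\<^sup>+m. (\<integral>\<^sup>+j. ennreal ((cmod (c j))\<^sup>2) * ennreal (profile (of_int m * \<theta> - x j)) \<partial>count_space UNIV) \<partial>ints)
       = (\<integral>\<^sup>+j. (\<integral>\<^sup>+m. ennreal ((cmod (c j))\<^sup>2) * ennreal (profile (of_int m * \<theta> - x j)) \<partial>ints) \<partial>count_space UNIV)"
      by (rule nn_integral_count_space_nn_integral) auto
    also have "\<dots> \<le> (\<integral>\<^sup>+j. ennreal ((cmod (c j))\<^sup>2) * ennreal G \<partial>count_space UNIV)"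
      by (intro nn_integral_mono) (simp add: nn_integral_cmult mult_left_mono G)
    also have "\<dots> = ennreal G * (\<integral>\<^sup>+j. ennreal ((cmod (c j))\<^sup>2) \<partial>count_space UNIV)"
      by (subst nn_integral_multc) (simp_all add: mult.commute)
    also have "ennreal H * (ennreal G * (\<integral>\<^sup>+j. ennreal ((cmod (c j))\<^sup>2) \<partial>count_space UNIV))
       = ennreal (H * G) * (\<integral>\<^sup>+j. ennreal ((cmod (c j))\<^sup>2) \<partial>count_space UNIV)"
      using H G by (simp add: ennreal_mult mult.assoc)
    finally show "(\<integral>\<^sup>+m. ennreal ((cmod (colsum (\<lambda>j. x0 + of_int j * a) c (of_int m * \<theta>)))\<^sup>2) \<partial>ints)
      \<le> ennreal (H * G) * (\<integral>\<^sup>+j. ennreal ((cmod (c j))\<^sup>2) \<partial>count_space UNIV)"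
      unfolding x_def by (simp add: mult_left_mono)
  qed
qed

section \<open>Fourier transforms\<close>

lemma continuous_integral_dominated:
  fixes F :: "real \<Rightarrow> 'a \<Rightarrow> complex"
  assumes meas: "\<And>t. F t \<in> borel_measurable M"
    and cont: "\<And>x. x \<in> space M \<Longrightarrow> continuous_on S (\<lambda>t. F t x)"
    and bound: "\<And>t x. t \<in> S \<Longrightarrow> x \<in> space M \<Longrightarrow> norm (F t x) \<le> w x"
    and w: "integrable M w"
  shows "continuous_on S (\<lambda>t. \<integral>x. F t x \<partial>M)"
  unfolding continuous_on_sequentially o_def
proof (intro allI ballI impI)
  fix s :: "nat \<Rightarrow> real" and t assume t: "t \<in> S" and s: "(\<forall>n. s n \<in> S) \<and> s \<longlonglongrightarrow> t"
  show "(\<lambda>n. \<integral>x. F (s n) x \<partial>M) \<longlonglongrightarrow> (\<integral>x. F t x \<partial>M)"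
  proof (rule integral_dominated_convergence[OF meas meas w])
    show "AE x in M. (\<lambda>n. F (s n) x) \<longlonglongrightarrow> F t x"
    proof (rule AE_I2)
      fix x assume "x \<in> space M"
      from cont[OF this] show "(\<lambda>n. F (s n) x) \<longlonglongrightarrow> F t x"
        using s t unfolding continuous_on_sequentially o_def by blast
    qed
    show "AE x in M. norm (F (s n) x) \<le> w x" for n
      using bound s by (intro AE_I2) blast
  qed
qed

definition fourier :: "(real \<Rightarrow> complex) \<Rightarrow> real \<Rightarrow> complex" where
  "fourier f \<xi> = (\<integral>x. f x * cis (- (2 * pi * \<xi> * x)) \<partial>lborel)"

text \<open>Continuous functions that vanish outside the interval from \<open>- R\<close> to \<open>R\<close>.\<close>

definition cc :: "real \<Rightarrow> (real \<Rightarrow> complex) \<Rightarrow> bool" where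
  "cc R f \<longleftrightarrow> R > 0 \<and> continuous_on UNIV f \<and> (\<forall>x. \<bar>x\<bar> \<ge> R \<longrightarrow> f x = 0)"

lemma cis_measurable [measurable]: "(\<lambda>x. cis (c * x)) \<in> borel_measurable borel"
  by (intro borel_measurable_continuous_onI continuous_intros)

lemma cc_measurable: "cc R f \<Longrightarrow> f \<in> borel_measurable borel"
  unfolding cc_def by (auto intro: borel_measurable_continuous_onI)

lemma cc_integrable:
  assumes "cc R f" shows "integrable lborel f"
proof -
  have "integrable lborel (\<lambda>x. indicator {-R..R} x *\<^sub>R f x)"
    using assms unfolding cc_def by (intro borel_integrable_compact) (auto intro: continuous_on_subset)
  moreover have "(\<lambda>x. indicator {-R..R} x *\<^sub>R f x) = f"
    using assms unfolding cc_def by (intro ext) (auto simp: indicator_def abs_le_iff)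
  ultimately show ?thesis by simp
qed

lemma fourier_bound:
  assumes "cc R f" shows "cmod (fourier f \<xi>) \<le> (\<integral>x. cmod (f x) \<partial>lborel)"
proof -
  have "cmod (fourier f \<xi>) \<le> (\<integral>x. cmod (f x * cis (- (2 * pi * \<xi> * x))) \<partial>lborel)"
    unfolding fourier_def by (rule integral_norm_bound)
  then show ?thesis by (simp add: norm_mult)
qed

lemma fourier_continuous:
  assumes "cc R f" shows "continuous_on UNIV (fourier f)"
  unfolding fourier_def
proof (rule continuous_integral_dominated[where w = "\<lambda>x. cmod (f x)"])
  note cc_measurable[OF assms, measurable]
  show "(\<lambda>x. f x * cis (- (2 * pi * t * x))) \<in> borel_measurable lborel" for t
    using cis_measurable[of "- (2 * pi * t)"] by simp
  show "integrable lborel (\<lambda>x. cmod (f x))" using cc_integrable[OF assms] by simp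
qed (auto intro!: continuous_intros simp: norm_mult)

text \<open>The support of \<open>f\<close> fits into one interval of length \<open>L = 2 * R\<close>.  On it Parseval's identity for \<open>f\<close> times
  \<open>cis (- 2 * pi * \<tau> * x)\<close> expresses the norm of \<open>f\<close> by the values of its transform on \<open>\<tau> + \<int> / L\<close>; integration
  over \<open>\<tau>\<close> from \<open>0\<close> to \<open>1 / L\<close> covers all frequencies once.\<close>

lemma plancherel_cc:
  assumes f: "cc R f"
  shows "(\<integral>\<^sup>+\<xi>. ennreal ((cmod (fourier f \<xi>))\<^sup>2) \<partial>lborel) = (\<integral>\<^sup>+x. ennreal ((cmod (f x))\<^sup>2) \<partial>lborel)"
proof -
  define L where "L = 2 * R"
  have R: "R > 0" "L > 0" using f unfolding L_def cc_def by auto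
  have fc: "continuous_on S f" for S using f unfolding cc_def by (auto intro: continuous_on_subset)
  have f0: "f x = 0" if "R \<le> \<bar>x\<bar>" for x using f that unfolding cc_def by blast
  let ?I = "\<integral>\<^sup>+x. ennreal ((cmod (f x))\<^sup>2) \<partial>lborel"
  have seg: "- R + L = R" unfolding L_def by simp
  have inner: "(\<integral>\<^sup>+k. ennreal ((cmod (fourier f (\<tau> + of_int k * (1 / L))))\<^sup>2) \<partial>ints) = ennreal L * ?I" for \<tau>
  proof -
    define h where "h = (\<lambda>x. f x * cis (- (2 * pi * \<tau> * x)))"
    have "continuous_on {-R..-R+L} h" unfolding h_def by (intro continuous_intros fc)
    moreover have "h (-R) = h (-R + L)" unfolding seg h_def using f0[of R] f0[of "-R"] R by simp
    ultimately have P: "(\<integral>\<^sup>+k. ennreal ((cmod (\<integral>x. h x * cis (- (2 * pi * of_int k * x / L)) \<partial>seg (-R) L))\<^sup>2) \<partial>ints)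
       = ennreal L * (\<integral>\<^sup>+x. ennreal ((cmod (h x))\<^sup>2) \<partial>seg (-R) L)"
      by (rule parseval_continuous[OF R(2)])
    have "(\<integral>x. h x * cis (- (2 * pi * of_int k * x / L)) \<partial>seg (-R) L) = fourier f (\<tau> + of_int k * (1 / L))" for k :: int
    proof -
      have "(\<integral>x. h x * cis (- (2 * pi * of_int k * x / L)) \<partial>seg (-R) L)
          = (\<integral>x. indicator {-R..<-R+L} x *\<^sub>R (h x * cis (- (2 * pi * of_int k * x / L))) \<partial>lborel)"
        unfolding seg_def by (rule integral_restrict_space) simp
      also have "\<dots> = fourier f (\<tau> + of_int k * (1 / L))"
        unfolding fourier_def
      proof (rule Bochner_Integration.integral_cong[OF refl])
        fix x
        have "cis (- (2 * pi * \<tau> * x)) * cis (- (2 * pi * of_int k * x / L)) = cis (- (2 * pi * (\<tau> + of_int k * (1 / L)) * x))"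
          unfolding cis_mult by (simp add: algebra_simps)
        moreover have "f x = 0" if "x \<notin> {-R..<-R+L}" using that unfolding seg by (intro f0) auto
        ultimately show "indicator {-R..<-R+L} x *\<^sub>R (h x * cis (- (2 * pi * of_int k * x / L)))
            = f x * cis (- (2 * pi * (\<tau> + of_int k * (1 / L)) * x))"
          unfolding h_def by (cases "x \<in> {-R..<-R+L}") (auto simp: mult.assoc)
      qed
      finally show ?thesis .
    qed
    moreover have "(\<integral>\<^sup>+x. ennreal ((cmod (h x))\<^sup>2) \<partial>seg (-R) L) = ?I"
    proof -
      have "(\<integral>\<^sup>+x. ennreal ((cmod (h x))\<^sup>2) \<partial>seg (-R) L) = (\<integral>\<^sup>+x. ennreal ((cmod (h x))\<^sup>2) * indicator {-R..<-R+L} x \<partial>lborel)"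
        unfolding seg_def by (rule nn_integral_restrict_space) simp
      also have "\<dots> = ?I"
      proof (rule nn_integral_cong)
        fix x
        have "f x = 0" if "x \<notin> {-R..<-R+L}" using that unfolding seg by (intro f0) auto
        then show "ennreal ((cmod (h x))\<^sup>2) * indicator {-R..<-R+L} x = ennreal ((cmod (f x))\<^sup>2)"
          unfolding h_def by (cases "x \<in> {-R..<-R+L}") (auto simp: norm_mult)
      qed
      finally show ?thesis .
    qed
    ultimately show ?thesis using P by simp
  qed
  have m: "(\<lambda>\<xi>. ennreal ((cmod (fourier f \<xi>))\<^sup>2)) \<in> borel_measurable borel"
    using borel_measurable_continuous_onI[OF fourier_continuous[OF f]] by simp
  have "(\<integral>\<^sup>+\<xi>. ennreal ((cmod (fourier f \<xi>))\<^sup>2) \<partial>lborel) = (\<integral>\<^sup>+\<tau>. ennreal L * ?I \<partial>seg 0 (1 / L))"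
    by (subst nn_integral_periodize[OF _ m, of "1 / L"]) (use R in simp, simp only: inner)
  also have "\<dots> = ennreal L * ?I * ennreal (1 / L)"
    using R by (simp add: seg_def emeasure_restrict_space space_restrict_space)
  also have "\<dots> = (ennreal L * ennreal (1 / L)) * ?I" by (simp add: mult_ac)
  also have "ennreal L * ennreal (1 / L) = 1" using R by (simp add: ennreal_mult[symmetric])
  finally show ?thesis by simp
qed

lemma integrable_exp_abs:
  fixes c :: real
  assumes "c > 0" shows "integrable lborel (\<lambda>x. exp (- (c * \<bar>x\<bar>)))"
proof (rule integrableI_bounded)
  show "(\<integral>\<^sup>+x. ennreal (norm (exp (- (c * \<bar>x\<bar>)))) \<partial>lborel) < \<infinity>"
    using nn_integral_exp_abs[OF assms] by (simp add: order_le_less_trans)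
qed simp

lemma fourier_exp_half_line:
  assumes c: "c > 0"
  shows "(\<integral>x. indicator {0..} x *\<^sub>R (complex_of_real (exp (- (c * x))) * cis (b * x)) \<partial>lborel) = 1 / (c - \<i> * b)"
proof -
  define w where "w = complex_of_real (-c) + \<i> * b"
  have w: "w \<noteq> 0" "Re w = - c" using c unfolding w_def by (auto simp: complex_eq_iff)
  define E where "E = (\<lambda>x. complex_of_real (exp (- (c * x))) * cis (b * x))"
  have E: "E x = exp (w * of_real x)" for x
    unfolding E_def w_def cis_conv_exp exp_of_real[symmetric] exp_add[symmetric] by (simp add: algebra_simps)
  have mE [measurable]: "E \<in> borel_measurable borel"
    unfolding E_def by (intro borel_measurable_continuous_onI continuous_intros)
  have fin: "(\<integral>x. indicator {0..real n} x *\<^sub>R E x \<partial>lborel) = exp (w * real n) / w - 1 / w" for n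
  proof -
    have "(\<integral>x. indicator {0..real n} x *\<^sub>R E x \<partial>lborel) = exp (w * of_real (real n)) / w - exp (w * of_real 0) / w"
    proof (rule integral_FTC_atLeastAtMost)
      show "continuous_on {0..real n} E" unfolding E_def by (intro continuous_intros)
      fix x :: real
      have "((\<lambda>z. exp (w * z) / w) has_field_derivative exp (w * of_real x)) (at (of_real x))"
        using w by (auto intro!: derivative_eq_intros)
      from has_vector_derivative_real_field[OF this]
      show "((\<lambda>x. exp (w * of_real x) / w) has_vector_derivative E x) (at x within {0..real n})"
        unfolding E .
    qed simp
    then show ?thesis by simp
  qed
  have "(\<lambda>n. \<integral>x. indicator {0..real n} x *\<^sub>R E x \<partial>lborel) \<longlonglongrightarrow> (\<integral>x. indicator {0..} x *\<^sub>R E x \<partial>lborel)"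
  proof (rule integral_dominated_convergence[where w = "\<lambda>x. exp (- (c * \<bar>x\<bar>))"])
    show "integrable lborel (\<lambda>x. exp (- (c * \<bar>x\<bar>)))" by (rule integrable_exp_abs[OF c])
    show "AE x in lborel. (\<lambda>n. indicator {0..real n} x *\<^sub>R E x) \<longlonglongrightarrow> indicator {0..} x *\<^sub>R E x"
    proof (rule AE_I2)
      fix x :: real
      obtain N :: nat where N: "x \<le> real N" using real_arch_simple by blast
      have "eventually (\<lambda>n. indicator {0..real n} x *\<^sub>R E x = indicator {0..} x *\<^sub>R E x) sequentially"
        using eventually_ge_at_top[of N] by eventually_elim (use N in \<open>auto simp: indicator_def\<close>)
      then show "(\<lambda>n. indicator {0..real n} x *\<^sub>R E x) \<longlonglongrightarrow> indicator {0..} x *\<^sub>R E x"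
        by (rule tendsto_eventually)
    qed
    show "AE x in lborel. norm (indicator {0..real n} x *\<^sub>R E x) \<le> exp (- (c * \<bar>x\<bar>))" for n
      by (rule AE_I2) (auto simp: indicator_def E_def norm_mult)
  qed simp_all
  moreover have "(\<lambda>n. \<integral>x. indicator {0..real n} x *\<^sub>R E x \<partial>lborel) \<longlonglongrightarrow> 0 / w - 1 / w"
  proof -
    have "(\<lambda>n. exp (w * of_real (real n))) \<longlonglongrightarrow> 0"
    proof (rule tendsto_norm_zero_cancel)
      have "(\<lambda>n. exp (- (c * real n))) \<longlonglongrightarrow> 0" using c by real_asymp
      then show "(\<lambda>n. norm (exp (w * of_real (real n)))) \<longlonglongrightarrow> 0" using w(2) by simp
    qed
    then have "(\<lambda>n. exp (w * of_real (real n)) / w - 1 / w) \<longlonglongrightarrow> 0 / w - 1 / w"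
      by (intro tendsto_intros w(1))
    then show ?thesis unfolding fin by simp
  qed
  ultimately have "(\<integral>x. indicator {0..} x *\<^sub>R E x \<partial>lborel) = 0 / w - 1 / w" by (rule LIMSEQ_unique)
  also have "\<dots> = 1 / (c - \<i> * b)" using w(1) unfolding w_def by (simp add: field_simps)
  finally show ?thesis unfolding E_def .
qed

lemma fourier_exp_abs:
  assumes c: "c > 0"
  shows "(\<integral>x. complex_of_real (exp (- (c * \<bar>x\<bar>))) * cis (b * x) \<partial>lborel) = complex_of_real (2 * c / (c\<^sup>2 + b\<^sup>2))"
proof -
  define E where "E = (\<lambda>x b. complex_of_real (exp (- (c * x))) * cis (b * x))"
  have mE [measurable]: "(\<lambda>x. E x b) \<in> borel_measurable borel" for b
    unfolding E_def by (intro borel_measurable_continuous_onI continuous_intros)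
  have int: "integrable lborel (\<lambda>x. indicator {0..} x *\<^sub>R E x b)" for b
    by (rule Bochner_Integration.integrable_bound[OF integrable_exp_abs[OF c]])
       (auto simp: indicator_def E_def norm_mult intro!: AE_I2)
  have int': "integrable lborel (\<lambda>x. indicator {0..} (-x) *\<^sub>R E (-x) b)" for b
    using lborel_integrable_real_affine[OF int[of b], of "-1" 0] by simp
  have "(\<integral>x. complex_of_real (exp (- (c * \<bar>x\<bar>))) * cis (b * x) \<partial>lborel)
     = (\<integral>x. indicator {0..} x *\<^sub>R E x b + indicator {0..} (-x) *\<^sub>R E (-x) (-b) \<partial>lborel)"
  proof (rule integral_cong_AE)
    show "(\<lambda>x. complex_of_real (exp (- (c * \<bar>x\<bar>))) * cis (b * x)) \<in> borel_measurable lborel"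
      by simp
    show "(\<lambda>x. indicator {0..} x *\<^sub>R E x b + indicator {0..} (-x) *\<^sub>R E (-x) (-b)) \<in> borel_measurable lborel"
      using int int' by (intro borel_measurable_add borel_measurable_integrable) auto
    show "AE x in lborel. complex_of_real (exp (- (c * \<bar>x\<bar>))) * cis (b * x)
        = indicator {0..} x *\<^sub>R E x b + indicator {0..} (-x) *\<^sub>R E (-x) (-b)"
      using AE_lborel_singleton[of 0] by eventually_elim (auto simp: indicator_def E_def)
  qed
  also have "\<dots> = (\<integral>x. indicator {0..} x *\<^sub>R E x b \<partial>lborel) + (\<integral>x. indicator {0..} (-x) *\<^sub>R E (-x) (-b) \<partial>lborel)"
    by (rule Bochner_Integration.integral_add[OF int int'])
  also have "(\<integral>x. indicator {0..} (-x) *\<^sub>R E (-x) (-b) \<partial>lborel) = (\<integral>x. indicator {0..} x *\<^sub>R E x (-b) \<partial>lborel)"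
    by (subst lborel_integral_real_affine[where c = "-1" and t = 0]) simp_all
  also have "(\<integral>x. indicator {0..} x *\<^sub>R E x b \<partial>lborel) + (\<integral>x. indicator {0..} x *\<^sub>R E x (-b) \<partial>lborel)
     = 1 / (c - \<i> * b) + 1 / (c + \<i> * b)"
    unfolding E_def using fourier_exp_half_line[OF c, of b] fourier_exp_half_line[OF c, of "-b"] by simp
  also have "\<dots> = complex_of_real (2 * c / (c\<^sup>2 + b\<^sup>2))"
  proof -
    have nz: "c - \<i> * b \<noteq> 0" "c + \<i> * b \<noteq> 0" using c by (auto simp: complex_eq_iff)
    have p: "(c - \<i> * b) * (c + \<i> * b) = complex_of_real (c\<^sup>2 + b\<^sup>2)"
      by (simp add: complex_eq_iff algebra_simps power2_eq_square)
    have "1 / (c - \<i> * b) + 1 / (c + \<i> * b) = (2 * c) / ((c - \<i> * b) * (c + \<i> * b))"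
      using nz by (simp add: add_frac_eq)
    then show ?thesis unfolding p by simp
  qed
  finally show ?thesis .
qed

definition gwindow :: "real \<Rightarrow> real" where
  "gwindow x = (x\<^sup>2 - 1) / ((x\<^sup>2 + 1) * (x\<^sup>2 + 4) * (x\<^sup>2 + 9))"

lemma profile_expand: "profile t = exp (- \<bar>t\<bar>) - 2 * exp (- (2 * \<bar>t\<bar>)) + exp (- (3 * \<bar>t\<bar>))"
proof -
  have "exp (- (2 * \<bar>t\<bar>)) = exp (- \<bar>t\<bar>) ^ 2" "exp (- (3 * \<bar>t\<bar>)) = exp (- \<bar>t\<bar>) ^ 3"
    by (simp_all add: exp_of_nat_mult[symmetric])
  then show ?thesis unfolding profile_def by (simp add: algebra_simps power2_eq_square power3_eq_cube)
qed

text \<open>The partial fractions of the window belong to \<open>1 / (s\<^sup>2 + x\<^sup>2)\<close> for \<open>s = 1, 2, 3\<close>, and each of these is the transform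
  of a two-sided exponential.  Their coefficients are in proportion \<open>1 : -4 : 3\<close>, which makes the exponentials combine to
  \<open>exp (- t) - 2 * exp (- 2 * t) + exp (- 3 * t)\<close>.\<close>

lemma gwindow_inverse_fourier:
  "complex_of_real (gwindow x) = (\<integral>\<xi>. complex_of_real (- (pi / 12) * profile (2 * pi * \<xi>)) * cis (2 * pi * x * \<xi>) \<partial>lborel)"
proof -
  let ?e = "\<lambda>s \<xi>. complex_of_real (exp (- ((2 * pi * s) * \<bar>\<xi>\<bar>))) * cis ((2 * pi * x) * \<xi>)"
  have int: "integrable lborel (?e s)" if "s > 0" for s
    by (rule Bochner_Integration.integrable_bound[OF integrable_exp_abs[of "2 * pi * s"]])
       (use that in \<open>auto simp: norm_mult intro!: AE_I2\<close>)
  have val: "(\<integral>\<xi>. ?e s \<xi> \<partial>lborel) = complex_of_real (s / (pi * (s\<^sup>2 + x\<^sup>2)))" if "s > 0" for s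
  proof -
    have "2 * (2 * pi * s) / ((2 * pi * s)\<^sup>2 + (2 * pi * x)\<^sup>2) = s / (pi * (s\<^sup>2 + x\<^sup>2))"
    proof -
      have "(2 * pi * s)\<^sup>2 + (2 * pi * x)\<^sup>2 = (4 * pi) * (pi * (s\<^sup>2 + x\<^sup>2))"
        by (simp add: power2_eq_square algebra_simps)
      then show ?thesis by (simp add: mult.assoc[symmetric])
    qed
    then show ?thesis using fourier_exp_abs[of "2 * pi * s" "2 * pi * x"] that by simp
  qed
  have "(\<integral>\<xi>. complex_of_real (- (pi / 12) * profile (2 * pi * \<xi>)) * cis (2 * pi * x * \<xi>) \<partial>lborel)
     = (\<integral>\<xi>. complex_of_real (- (pi / 12)) * (?e 1 \<xi> - 2 * ?e 2 \<xi> + ?e 3 \<xi>) \<partial>lborel)"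
  proof (rule Bochner_Integration.integral_cong[OF refl])
    fix \<xi> :: real
    have "profile (2 * pi * \<xi>) = exp (- ((2 * pi * 1) * \<bar>\<xi>\<bar>)) - 2 * exp (- ((2 * pi * 2) * \<bar>\<xi>\<bar>)) + exp (- ((2 * pi * 3) * \<bar>\<xi>\<bar>))"
      unfolding profile_expand by (simp add: abs_mult mult_ac)
    then show "complex_of_real (- (pi / 12) * profile (2 * pi * \<xi>)) * cis (2 * pi * x * \<xi>)
       = complex_of_real (- (pi / 12)) * (?e 1 \<xi> - 2 * ?e 2 \<xi> + ?e 3 \<xi>)"
      by (simp only:) (simp add: algebra_simps)
  qed
  also have "\<dots> = complex_of_real (- (pi / 12)) * (complex_of_real (1 / (pi * (1\<^sup>2 + x\<^sup>2)))
      - 2 * complex_of_real (2 / (pi * (2\<^sup>2 + x\<^sup>2))) + complex_of_real (3 / (pi * (3\<^sup>2 + x\<^sup>2))))"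
    using int[of 1] int[of 2] int[of 3] val[of 1] val[of 2] val[of 3] by simp
  also have "\<dots> = complex_of_real (gwindow x)"
  proof -
    define p q r where "p = 1\<^sup>2 + x\<^sup>2" and "q = 2\<^sup>2 + x\<^sup>2" and "r = 3\<^sup>2 + x\<^sup>2"
    have nz: "p \<noteq> 0" "q \<noteq> 0" "r \<noteq> 0"
      unfolding p_def q_def r_def using add_pos_nonneg[OF _ zero_le_power2[of x]]
      by (metis less_irrefl zero_less_numeral zero_less_one zero_less_power)+
    have "- (pi / 12) * (1 / (pi * p) - 2 * (2 / (pi * q)) + 3 / (pi * r)) = - (1 / 12) * (1 / p - 4 / q + 3 / r)"
      by (simp add: field_simps)
    also have "1 / p - 4 / q + 3 / r = (q * r - 4 * p * r + 3 * p * q) / (p * q * r)"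
      using nz by (simp add: field_simps)
    also have "q * r - 4 * p * r + 3 * p * q = - 12 * (x\<^sup>2 - 1)"
      unfolding p_def q_def r_def by (simp add: algebra_simps)
    also have "- (1 / 12) * (- 12 * (x\<^sup>2 - 1) / (p * q * r)) = gwindow x"
    proof -
      have d: "(x\<^sup>2 + 1) * (x\<^sup>2 + 4) * (x\<^sup>2 + 9) = p * q * r"
        unfolding p_def q_def r_def by (simp add: add.commute)
      show ?thesis unfolding gwindow_def d using nz by (simp add: field_simps)
    qed
    finally have e: "- (pi / 12) * (1 / (pi * p) - 2 * (2 / (pi * q)) + 3 / (pi * r)) = gwindow x" .
    show ?thesis unfolding p_def[symmetric] q_def[symmetric] r_def[symmetric]
      by (simp only: e[symmetric] of_real_mult of_real_add of_real_diff of_real_numeral)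
  qed
  finally show ?thesis ..
qed

section \<open>Gabor coefficients on the Fourier side\<close>

lemma integrable_fourier_window:
  assumes f: "cc R f"
  shows "integrable lborel (\<lambda>\<xi>. complex_of_real (profile (2 * pi * (b - \<xi>))) * fourier f \<xi> * cis (r * \<xi>))"
proof -
  define B where "B = (\<integral>x. cmod (f x) \<partial>lborel)"
  have B: "cmod (fourier f \<xi>) \<le> B" for \<xi> unfolding B_def by (rule fourier_bound[OF f])
  then have B0: "0 \<le> B" using order_trans[OF norm_ge_zero] by blast
  have "integrable lborel (\<lambda>\<xi>. exp (- ((2 * pi) * \<bar>b + (-1) * \<xi>\<bar>)))"
    by (rule lborel_integrable_real_affine[OF integrable_exp_abs]) simp_all
  then have dom: "integrable lborel (\<lambda>\<xi>. B * exp (- ((2 * pi) * \<bar>b - \<xi>\<bar>)))" by simp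
  have pm: "continuous_on UNIV profile" unfolding profile_def by (intro continuous_intros)
  have "continuous_on UNIV (\<lambda>\<xi>. complex_of_real (profile (2 * pi * (b - \<xi>))) * fourier f \<xi> * cis (r * \<xi>))"
    by (intro continuous_intros fourier_continuous[OF f] continuous_on_compose2[OF pm]) auto
  then have m: "(\<lambda>\<xi>. complex_of_real (profile (2 * pi * (b - \<xi>))) * fourier f \<xi> * cis (r * \<xi>)) \<in> borel_measurable lborel"
    by (simp add: borel_measurable_continuous_onI)
  show ?thesis
  proof (rule Bochner_Integration.integrable_bound[OF dom m], rule AE_I2)
    fix \<xi> :: real
    have "profile (2 * pi * (b - \<xi>)) \<le> exp (- ((2 * pi) * \<bar>b - \<xi>\<bar>))"
      using profile_le_exp[of "2 * pi * (b - \<xi>)"] by (simp add: abs_mult)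
    then have "profile (2 * pi * (b - \<xi>)) * cmod (fourier f \<xi>) \<le> exp (- ((2 * pi) * \<bar>b - \<xi>\<bar>)) * B"
      using B profile_nonneg by (intro mult_mono) auto
    then show "norm (complex_of_real (profile (2 * pi * (b - \<xi>))) * fourier f \<xi> * cis (r * \<xi>)) \<le> norm (B * exp (- ((2 * pi) * \<bar>b - \<xi>\<bar>)))"
      using profile_nonneg B0 by (simp add: norm_mult mult.commute)
  qed
qed

text \<open>Insert the Fourier integral for the window and exchange the integrations; the transform of \<open>f\<close> appears.\<close>

lemma window_coefficient:
  assumes f: "cc R f"
  shows "(\<integral>x. f x * cnj (cis (2 * pi * b * x) * complex_of_real (gwindow (x - s))) \<partial>lborel)
    = - (pi / 12) * cis (- (2 * pi * s * b)) *
      (\<integral>\<xi>. complex_of_real (profile (2 * pi * (b - \<xi>))) * fourier f \<xi> * cis (2 * pi * s * \<xi>) \<partial>lborel)"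
proof -
  define \<Phi> where "\<Phi> = (\<lambda>x \<xi>. f x * complex_of_real (profile (2 * pi * (b - \<xi>))) * (cis (- (2 * pi * \<xi> * x)) * cis (2 * pi * s * \<xi>)))"
  have fc: "continuous_on S f" for S using f unfolding cc_def by (auto intro: continuous_on_subset)
  have pm: "continuous_on UNIV profile" unfolding profile_def by (intro continuous_intros)
  have g: "complex_of_real (gwindow (x - s)) =
     - (pi / 12) * (\<integral>\<xi>. complex_of_real (profile (2 * pi * (b - \<xi>))) * cis (2 * pi * (x - s) * (b - \<xi>)) \<partial>lborel)" for x
  proof -
    have "complex_of_real (gwindow (x - s)) = (\<integral>\<xi>. - (pi / 12) * (complex_of_real (profile (2 * pi * \<xi>)) * cis (2 * pi * (x - s) * \<xi>)) \<partial>lborel)"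
      unfolding gwindow_inverse_fourier by (simp add: mult.assoc)
    also have "\<dots> = - (pi / 12) * (\<integral>\<xi>. complex_of_real (profile (2 * pi * \<xi>)) * cis (2 * pi * (x - s) * \<xi>) \<partial>lborel)"
      by simp
    also have "(\<integral>\<xi>. complex_of_real (profile (2 * pi * \<xi>)) * cis (2 * pi * (x - s) * \<xi>) \<partial>lborel)
       = (\<integral>\<xi>. complex_of_real (profile (2 * pi * (b + (-1) * \<xi>))) * cis (2 * pi * (x - s) * (b + (-1) * \<xi>)) \<partial>lborel)"
      by (subst lborel_integral_real_affine[where c = "-1" and t = b]) simp_all
    finally show ?thesis by simp
  qed
  have "(\<integral>x. f x * cnj (cis (2 * pi * b * x) * complex_of_real (gwindow (x - s))) \<partial>lborel)
     = (\<integral>x. (- (pi / 12) * cis (- (2 * pi * s * b))) * (\<integral>\<xi>. \<Phi> x \<xi> \<partial>lborel) \<partial>lborel)"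
  proof (rule Bochner_Integration.integral_cong[OF refl])
    fix x
    have e: "\<Phi> x \<xi> = (f x * cis (- (2 * pi * b * x)) * cis (2 * pi * s * b)) *
        (complex_of_real (profile (2 * pi * (b - \<xi>))) * cis (2 * pi * (x - s) * (b - \<xi>)))" for \<xi>
    proof -
      have "cis (- (2 * pi * \<xi> * x)) * cis (2 * pi * s * \<xi>) = cis (- (2 * pi * b * x)) * cis (2 * pi * s * b) * cis (2 * pi * (x - s) * (b - \<xi>))"
        unfolding cis_mult by (simp add: algebra_simps)
      then show ?thesis unfolding \<Phi>_def by (simp add: mult_ac)
    qed
    define J where "J = (\<integral>\<xi>. complex_of_real (profile (2 * pi * (b - \<xi>))) * cis (2 * pi * (x - s) * (b - \<xi>)) \<partial>lborel)"
    have i: "(\<integral>\<xi>. \<Phi> x \<xi> \<partial>lborel) = (f x * cis (- (2 * pi * b * x)) * cis (2 * pi * s * b)) * J"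
      unfolding e J_def by simp
    have gJ: "complex_of_real (gwindow (x - s)) = - (pi / 12) * J" unfolding J_def by (rule g)
    have one: "cis (- (2 * pi * s * b)) * cis (2 * pi * s * b) = 1" unfolding cis_mult by simp
    have "f x * cnj (cis (2 * pi * b * x) * complex_of_real (gwindow (x - s)))
        = f x * cis (- (2 * pi * b * x)) * complex_of_real (gwindow (x - s))"
      by (simp add: cis_cnj mult_ac)
    also have "\<dots> = f x * cis (- (2 * pi * b * x)) * (- (pi / 12) * J)" by (simp only: gJ)
    also have "\<dots> = - (pi / 12) * (cis (- (2 * pi * s * b)) * cis (2 * pi * s * b)) * (f x * cis (- (2 * pi * b * x)) * J)"
    proof -
      have "F * C * (A * J) = A * 1 * (F * C * J)" for A F C :: complex by simp
      then show ?thesis unfolding one .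
    qed
    also have "\<dots> = (- (pi / 12) * cis (- (2 * pi * s * b))) * (\<integral>\<xi>. \<Phi> x \<xi> \<partial>lborel)"
    proof -
      have "A * (P * Q) * (F * C * J) = (A * P) * ((F * C * Q) * J)" for A P Q F C :: complex
        by (simp add: mult_ac)
      then show ?thesis unfolding i .
    qed
    finally show "f x * cnj (cis (2 * pi * b * x) * complex_of_real (gwindow (x - s)))
        = (- (pi / 12) * cis (- (2 * pi * s * b))) * (\<integral>\<xi>. \<Phi> x \<xi> \<partial>lborel)" .
  qed
  also have "\<dots> = - (pi / 12) * cis (- (2 * pi * s * b)) * (\<integral>x. (\<integral>\<xi>. \<Phi> x \<xi> \<partial>lborel) \<partial>lborel)"
    by simp
  also have "(\<integral>x. (\<integral>\<xi>. \<Phi> x \<xi> \<partial>lborel) \<partial>lborel) = (\<integral>\<xi>. (\<integral>x. \<Phi> x \<xi> \<partial>lborel) \<partial>lborel)"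
  proof (rule lborel_pair.Fubini_integral[symmetric])
    have "continuous_on UNIV (\<lambda>z::real \<times> real. \<Phi> (fst z) (snd z))"
      unfolding \<Phi>_def by (intro continuous_intros continuous_on_compose2[OF fc] continuous_on_compose2[OF pm]) auto
    then have "(\<lambda>z. \<Phi> (fst z) (snd z)) \<in> borel_measurable (lborel \<Otimes>\<^sub>M lborel)"
      unfolding lborel_prod by (simp add: borel_measurable_continuous_onI)
    then have m: "(\<lambda>(x, \<xi>). \<Phi> x \<xi>) \<in> borel_measurable (lborel \<Otimes>\<^sub>M lborel)" by (simp add: case_prod_beta')
    have "integrable lborel (\<lambda>\<xi>. exp (- ((2 * pi) * \<bar>b + (-1) * \<xi>\<bar>)))"
      by (rule lborel_integrable_real_affine[OF integrable_exp_abs]) simp_all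
    then have dom: "integrable lborel (\<lambda>\<xi>. exp (- ((2 * pi) * \<bar>b - \<xi>\<bar>)))" by simp
    have prof: "integrable lborel (\<lambda>\<xi>. profile (2 * pi * (b - \<xi>)))"
    proof (rule Bochner_Integration.integrable_bound[OF dom _ AE_I2])
      show "(\<lambda>\<xi>. profile (2 * pi * (b - \<xi>))) \<in> borel_measurable lborel"
        unfolding profile_def by simp
      fix \<xi> show "norm (profile (2 * pi * (b - \<xi>))) \<le> norm (exp (- ((2 * pi) * \<bar>b - \<xi>\<bar>)))"
        using profile_le_exp[of "2 * pi * (b - \<xi>)"] profile_nonneg by (simp add: abs_mult)
    qed
    have nrm: "norm (\<Phi> x \<xi>) = cmod (f x) * profile (2 * pi * (b - \<xi>))" for x \<xi>
      unfolding \<Phi>_def using profile_nonneg by (simp add: norm_mult)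
    show "integrable (lborel \<Otimes>\<^sub>M lborel) (\<lambda>(x, \<xi>). \<Phi> x \<xi>)"
    proof (rule lborel_pair.Fubini_integrable[OF m])
      show "integrable lborel (\<lambda>x. \<integral>\<xi>. norm ((\<lambda>(x, \<xi>). \<Phi> x \<xi>) (x, \<xi>)) \<partial>lborel)"
        using cc_integrable[OF f] by (simp add: nrm)
      show "AE x in lborel. integrable lborel (\<lambda>\<xi>. (\<lambda>(x, \<xi>). \<Phi> x \<xi>) (x, \<xi>))"
      proof (rule AE_I2)
        fix x
        have "(\<lambda>\<xi>. \<Phi> x \<xi>) \<in> borel_measurable lborel"
          using measurable_Pair2[OF m, of x] by simp
        moreover have "integrable lborel (\<lambda>\<xi>. norm (\<Phi> x \<xi>))" unfolding nrm using prof by simp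
        ultimately have "integrable lborel (\<lambda>\<xi>. \<Phi> x \<xi>)" using integrable_norm_cancel by blast
        then show "integrable lborel (\<lambda>\<xi>. (\<lambda>(x, \<xi>). \<Phi> x \<xi>) (x, \<xi>))" by simp
      qed
    qed
  qed
  also have "\<dots> = (\<integral>\<xi>. complex_of_real (profile (2 * pi * (b - \<xi>))) * fourier f \<xi> * cis (2 * pi * s * \<xi>) \<partial>lborel)"
  proof (rule Bochner_Integration.integral_cong[OF refl])
    fix \<xi>
    have e: "\<Phi> x \<xi> = (complex_of_real (profile (2 * pi * (b - \<xi>))) * cis (2 * pi * s * \<xi>)) * (f x * cis (- (2 * pi * \<xi> * x)))" for x
      unfolding \<Phi>_def by (simp add: mult_ac)
    show "(\<integral>x. \<Phi> x \<xi> \<partial>lborel) = complex_of_real (profile (2 * pi * (b - \<xi>))) * fourier f \<xi> * cis (2 * pi * s * \<xi>)"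
      unfolding fourier_def e integral_mult_right_zero by (simp only: mult_ac)
  qed
  finally show ?thesis .
qed

text \<open>The transform of \<open>f\<close> times the translated profile, summed over the translates of \<open>\<xi>\<close> by multiples of \<open>a\<close>.  Up to a constant, its
  Fourier coefficients on \<open>[0, a)\<close> are the Gabor coefficients of \<open>f\<close> with fixed modulation \<open>b\<close>; and for fixed \<open>\<xi>\<close> it
  is one of the sums that \<open>colsum_lower\<close> and \<open>colsum_upper\<close> control.\<close>

definition fibre :: "real \<Rightarrow> (real \<Rightarrow> complex) \<Rightarrow> real \<Rightarrow> real \<Rightarrow> complex" where
  "fibre a f b \<xi> = colsum (\<lambda>j. 2 * pi * \<xi> + of_int j * (2 * pi * a)) (\<lambda>j. fourier f (\<xi> + of_int j * a)) (2 * pi * b)"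

lemma fibre_eq:
  "fibre a f b \<xi> = (\<integral>j. complex_of_real (profile (2 * pi * (b - (\<xi> + of_int j * a)))) * fourier f (\<xi> + of_int j * a) \<partial>ints)"
proof -
  have "2 * pi * b - (2 * pi * \<xi> + of_int j * (2 * pi * a)) = 2 * pi * (b - (\<xi> + of_int j * a))" for j :: int
    by (simp add: algebra_simps)
  then show ?thesis unfolding fibre_def colsum_def by (simp add: mult.commute)
qed

lemma fibre_periodic: "fibre a f b (\<xi> + a) = fibre a f b \<xi>"
proof -
  have bij: "bij_betw (\<lambda>j::int. j + 1) UNIV UNIV"
    by (intro bij_betwI[of _ _ _ "\<lambda>m. m - 1"]) auto
  let ?h = "\<lambda>j. complex_of_real (profile (2 * pi * (b - (\<xi> + of_int j * a)))) * fourier f (\<xi> + of_int j * a)"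
  have "fibre a f b (\<xi> + a) = (\<integral>j. ?h (j + 1) \<partial>ints)"
    unfolding fibre_eq by (simp add: algebra_simps)
  also have "\<dots> = fibre a f b \<xi>" unfolding fibre_eq by (rule integral_bij_count_space[OF bij])
  finally show ?thesis .
qed

lemma fibre_continuous:
  assumes a: "a > 0" and f: "cc R f"
  shows "continuous_on {0..a} (fibre a f b)"
  unfolding fibre_eq[abs_def]
proof (rule continuous_integral_dominated)
  define B where "B = (\<integral>x. cmod (f x) \<partial>lborel)"
  have B: "cmod (fourier f \<xi>) \<le> B" for \<xi> unfolding B_def by (rule fourier_bound[OF f])
  then have B0: "0 \<le> B" using order_trans[OF norm_ge_zero] by blast
  define w where "w = (\<lambda>j::int. B * exp (2 * pi * a) * exp (- \<bar>- (2 * pi * b) + of_int j * (2 * pi * a)\<bar>))"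
  have pm: "continuous_on UNIV profile" unfolding profile_def by (intro continuous_intros)
  show "continuous_on {0..a} (\<lambda>\<xi>. complex_of_real (profile (2 * pi * (b - (\<xi> + of_int j * a)))) * fourier f (\<xi> + of_int j * a))" for j :: int
    by (intro continuous_intros continuous_on_compose2[OF pm] continuous_on_compose2[OF fourier_continuous[OF f]]) auto
  show "norm (complex_of_real (profile (2 * pi * (b - (\<xi> + of_int j * a)))) * fourier f (\<xi> + of_int j * a)) \<le> w j"
    if "\<xi> \<in> {0..a}" for \<xi> and j :: int
  proof -
    let ?t = "2 * pi * (b - (\<xi> + of_int j * a))"
    have "2 * pi * \<xi> \<le> 2 * pi * a" "0 \<le> 2 * pi * \<xi>" using that by (auto intro!: mult_left_mono)
    moreover have "?t = - (- (2 * pi * b) + of_int j * (2 * pi * a)) - 2 * pi * \<xi>" by (simp add: algebra_simps)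
    ultimately have "- \<bar>?t\<bar> \<le> 2 * pi * a + - \<bar>- (2 * pi * b) + of_int j * (2 * pi * a)\<bar>" by linarith
    then have "exp (- \<bar>?t\<bar>) \<le> exp (2 * pi * a) * exp (- \<bar>- (2 * pi * b) + of_int j * (2 * pi * a)\<bar>)"
      unfolding exp_add[symmetric] by simp
    then have "profile ?t \<le> exp (2 * pi * a) * exp (- \<bar>- (2 * pi * b) + of_int j * (2 * pi * a)\<bar>)"
      using profile_le_exp[of ?t] by linarith
    then have "profile ?t * cmod (fourier f (\<xi> + of_int j * a))
       \<le> (exp (2 * pi * a) * exp (- \<bar>- (2 * pi * b) + of_int j * (2 * pi * a)\<bar>)) * B"
      using B profile_nonneg by (intro mult_mono) auto
    then show ?thesis unfolding w_def using profile_nonneg by (simp add: norm_mult mult_ac)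
  qed
  show "integrable (ints) w"
  proof (rule integrableI_bounded)
    obtain H where H: "H > 0" "\<And>s. (\<integral>\<^sup>+j. ennreal (exp (- \<bar>s + of_int j * (2 * pi * a)\<bar>)) \<partial>ints) \<le> ennreal H"
      by (rule exp_sum_bound[of "2 * pi * a"], use a in simp, blast)
    have "(\<integral>\<^sup>+j. ennreal (norm (w j)) \<partial>count_space UNIV)
       = (\<integral>\<^sup>+j. ennreal (B * exp (2 * pi * a)) * ennreal (exp (- \<bar>- (2 * pi * b) + of_int j * (2 * pi * a)\<bar>)) \<partial>count_space UNIV)"
      unfolding w_def using B0 by (intro nn_integral_cong) (simp add: ennreal_mult[symmetric])
    also have "\<dots> = ennreal (B * exp (2 * pi * a)) * (\<integral>\<^sup>+j. ennreal (exp (- \<bar>- (2 * pi * b) + of_int j * (2 * pi * a)\<bar>)) \<partial>ints)"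
      by (rule nn_integral_cmult) simp
    also have "\<dots> \<le> ennreal (B * exp (2 * pi * a)) * ennreal H" by (intro mult_left_mono H) simp
    also have "\<dots> < \<infinity>" by (simp add: ennreal_mult_less_top)
    finally show "(\<integral>\<^sup>+j. ennreal (norm (w j)) \<partial>count_space UNIV) < \<infinity>" .
  qed simp
qed simp

lemma fibre_parseval:
  assumes \<alpha>: "\<alpha> > 0" and f: "cc R f"
  defines "a \<equiv> 1 / \<alpha>"
  shows "(\<integral>\<^sup>+k. ennreal ((cmod (\<integral>x. f x * cnj (cis (2 * pi * b * x) * complex_of_real (gwindow (x - \<alpha> * of_int k))) \<partial>lborel))\<^sup>2) \<partial>ints)
    = ennreal ((pi / 12)\<^sup>2 * a) * (\<integral>\<^sup>+\<xi>. ennreal ((cmod (fibre a f b \<xi>))\<^sup>2) \<partial>seg 0 a)"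
proof -
  have a: "a > 0" unfolding a_def using \<alpha> by simp
  let ?F = "\<lambda>k::int. (\<integral>\<xi>. fibre a f b \<xi> * cis (- (2 * pi * of_int k * \<xi> / a)) \<partial>seg 0 a)"
  have coef: "(\<integral>x. f x * cnj (cis (2 * pi * b * x) * complex_of_real (gwindow (x - \<alpha> * of_int k))) \<partial>lborel)
     = - (pi / 12) * cis (- (2 * pi * (\<alpha> * of_int k) * b)) * ?F (- k)" for k :: int
  proof -
    let ?\<Psi> = "\<lambda>\<xi>. complex_of_real (profile (2 * pi * (b - \<xi>))) * fourier f \<xi> * cis (2 * pi * (\<alpha> * of_int k) * \<xi>)"
    have "(\<integral>\<xi>. ?\<Psi> \<xi> \<partial>lborel) = (\<integral>\<xi>. (\<integral>j. ?\<Psi> (\<xi> + of_int j * a) \<partial>ints) \<partial>seg 0 a)"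
      by (rule integral_periodize[OF a integrable_fourier_window[OF f]])
    also have "\<dots> = ?F (- k)"
    proof (rule Bochner_Integration.integral_cong[OF refl])
      fix \<xi>
      have per: "cis (2 * pi * (\<alpha> * of_int k) * (\<xi> + of_int j * a)) = cis (- (2 * pi * of_int (- k) * \<xi> / a))" for j :: int
      proof -
        have "2 * pi * (\<alpha> * of_int k) * (\<xi> + of_int j * a) = - (2 * pi * of_int (- k) * \<xi> / a) + 2 * pi * of_int (k * j)"
          unfolding a_def using \<alpha> by (simp add: field_simps)
        moreover have "cis (2 * pi * of_int (k * j)) = 1" by (rule cis_multiple_2pi) simp
        ultimately show ?thesis by (simp only: cis_mult[symmetric] mult_1_right)
      qed
      show "(\<integral>j. ?\<Psi> (\<xi> + of_int j * a) \<partial>ints) = fibre a f b \<xi> * cis (- (2 * pi * of_int (- k) * \<xi> / a))"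
        unfolding per fibre_eq by simp
    qed
    finally show ?thesis unfolding window_coefficient[OF f] by simp
  qed
  have nrm: "ennreal ((cmod (\<integral>x. f x * cnj (cis (2 * pi * b * x) * complex_of_real (gwindow (x - \<alpha> * of_int k))) \<partial>lborel))\<^sup>2)
     = ennreal ((pi / 12)\<^sup>2) * ennreal ((cmod (?F (- k)))\<^sup>2)" for k :: int
  proof -
    have "cmod (- (pi / 12) * cis (- (2 * pi * (\<alpha> * of_int k) * b)) * ?F (- k)) = pi / 12 * cmod (?F (- k))"
      by (simp add: norm_mult norm_divide)
    then have "(cmod (- (pi / 12) * cis (- (2 * pi * (\<alpha> * of_int k) * b)) * ?F (- k)))\<^sup>2 = (pi / 12)\<^sup>2 * (cmod (?F (- k)))\<^sup>2"
      unfolding power_mult_distrib[symmetric] by (rule arg_cong)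
    then show ?thesis unfolding coef by (subst ennreal_mult[symmetric]) (simp_all only: zero_le_power2)
  qed
  have bij: "bij_betw (\<lambda>k::int. - k) UNIV UNIV" by (intro bij_betwI[of _ _ _ uminus]) auto
  have "(\<integral>\<^sup>+k. ennreal ((cmod (\<integral>x. f x * cnj (cis (2 * pi * b * x) * complex_of_real (gwindow (x - \<alpha> * of_int k))) \<partial>lborel))\<^sup>2) \<partial>ints)
     = ennreal ((pi / 12)\<^sup>2) * (\<integral>\<^sup>+k. ennreal ((cmod (?F (- k)))\<^sup>2) \<partial>ints)"
    unfolding nrm by (rule nn_integral_cmult) simp
  also have "(\<integral>\<^sup>+k. ennreal ((cmod (?F (- k)))\<^sup>2) \<partial>ints) = (\<integral>\<^sup>+k. ennreal ((cmod (?F k))\<^sup>2) \<partial>ints)"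
    by (rule nn_integral_bij_count_space[OF bij])
  also have "\<dots> = ennreal a * (\<integral>\<^sup>+\<xi>. ennreal ((cmod (fibre a f b \<xi>))\<^sup>2) \<partial>seg 0 a)"
    using fibre_continuous[OF a f, of b] fibre_periodic[of a f b 0] by (intro parseval_continuous[OF a]) simp_all
  finally show ?thesis using a by (simp add: ennreal_mult mult.assoc)
qed

section \<open>From a dense set to all square-integrable functions\<close>

lemma L2_norm_power2: "(L2_norm f)\<^sup>2 = (LINT x|lebesgue. (cmod (f x))\<^sup>2)"
  unfolding L2_norm_def by simp

lemma L2_product_integrable:
  assumes f: "f \<in> L2_space" and h: "h \<in> L2_space"
  shows "integrable lebesgue (\<lambda>x. f x * cnj (h x))"
proof (rule Bochner_Integration.integrable_bound)
  show "integrable lebesgue (\<lambda>x. (cmod (f x))\<^sup>2 + (cmod (h x))\<^sup>2)"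
    using f h unfolding L2_space_def by simp
  have [measurable]: "f \<in> borel_measurable lebesgue" "h \<in> borel_measurable lebesgue"
    using f h unfolding L2_space_def by auto
  have "continuous_on UNIV cnj" by (intro continuous_on_cnj continuous_on_id)
  then have [measurable]: "cnj \<in> borel_measurable borel" by (rule borel_measurable_continuous_onI)
  show "(\<lambda>x. f x * cnj (h x)) \<in> borel_measurable lebesgue" by measurable
  show "AE x in lebesgue. norm (f x * cnj (h x)) \<le> norm ((cmod (f x))\<^sup>2 + (cmod (h x))\<^sup>2)"
  proof (rule AE_I2)
    fix x
    have "2 * (cmod (f x) * cmod (h x)) \<le> (cmod (f x))\<^sup>2 + (cmod (h x))\<^sup>2"
      using sum_squares_bound[of "cmod (f x)" "cmod (h x)"] by simp
    moreover have "0 \<le> cmod (f x) * cmod (h x)" by simp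
    ultimately have "cmod (f x) * cmod (h x) \<le> (cmod (f x))\<^sup>2 + (cmod (h x))\<^sup>2" by linarith
    then show "norm (f x * cnj (h x)) \<le> norm ((cmod (f x))\<^sup>2 + (cmod (h x))\<^sup>2)"
      by (simp add: norm_mult)
  qed
qed

lemma cmod_power2_add_le: "(cmod (x + y))\<^sup>2 \<le> 2 * (cmod x)\<^sup>2 + 2 * (cmod y)\<^sup>2"
proof -
  have "(cmod (x + y))\<^sup>2 \<le> (cmod x + cmod y)\<^sup>2" by (rule power_mono[OF norm_triangle_ineq]) simp
  also have "\<dots> \<le> 2 * (cmod x)\<^sup>2 + 2 * (cmod y)\<^sup>2" by (rule power2_sum_le)
  finally show ?thesis .
qed

lemma L2_space_diff:
  assumes f: "f \<in> L2_space" and h: "h \<in> L2_space"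
  shows "(\<lambda>x. f x - h x) \<in> L2_space"
proof -
  have m[measurable]: "f \<in> borel_measurable lebesgue" "h \<in> borel_measurable lebesgue"
    using f h unfolding L2_space_def by auto
  have "integrable lebesgue (\<lambda>x. (cmod (f x - h x))\<^sup>2)"
  proof (rule Bochner_Integration.integrable_bound)
    show "integrable lebesgue (\<lambda>x. 2 * (cmod (f x))\<^sup>2 + 2 * (cmod (h x))\<^sup>2)"
      using f h unfolding L2_space_def by simp
    show "(\<lambda>x. (cmod (f x - h x))\<^sup>2) \<in> borel_measurable lebesgue" by measurable
    show "AE x in lebesgue. norm ((cmod (f x - h x))\<^sup>2) \<le> norm (2 * (cmod (f x))\<^sup>2 + 2 * (cmod (h x))\<^sup>2)"
      using cmod_power2_add_le[of "f _" "- h _"] by (intro AE_I2) simp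
  qed
  then show ?thesis unfolding L2_space_def by simp
qed

text \<open>The crude form of the triangle inequality is enough, since constants in frame bounds do not matter.\<close>

lemma L2_norm_add_le:
  assumes f: "f \<in> L2_space" and h: "h \<in> L2_space"
  shows "(L2_norm f)\<^sup>2 \<le> 2 * (L2_norm h)\<^sup>2 + 2 * (L2_norm (\<lambda>x. f x - h x))\<^sup>2"
proof -
  have d: "integrable lebesgue (\<lambda>x. (cmod (f x - h x))\<^sup>2)"
    using L2_space_diff[OF f h] unfolding L2_space_def by simp
  have fh: "integrable lebesgue (\<lambda>x. (cmod (f x))\<^sup>2)" "integrable lebesgue (\<lambda>x. (cmod (h x))\<^sup>2)"
    using f h unfolding L2_space_def by auto
  have "(LINT x|lebesgue. (cmod (f x))\<^sup>2) \<le> (LINT x|lebesgue. 2 * (cmod (h x))\<^sup>2 + 2 * (cmod (f x - h x))\<^sup>2)"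
  proof (rule integral_mono)
    show "(cmod (f x))\<^sup>2 \<le> 2 * (cmod (h x))\<^sup>2 + 2 * (cmod (f x - h x))\<^sup>2" for x
      using cmod_power2_add_le[of "h x" "f x - h x"] by simp
  qed (use d fh in simp_all)
  then show ?thesis unfolding L2_norm_power2 using d fh by simp
qed

lemma L2_inner_power2_le:
  assumes f: "f \<in> L2_space" and h: "h \<in> L2_space"
  shows "(cmod (L2_inner f h))\<^sup>2 \<le> (L2_norm f)\<^sup>2 * (L2_norm h)\<^sup>2"
proof -
  have m[measurable]: "f \<in> borel_measurable lebesgue" "h \<in> borel_measurable lebesgue"
    using f h unfolding L2_space_def by auto
  have n: "(\<integral>\<^sup>+x. (ennreal (cmod (f x)))^2 \<partial>lebesgue) = ennreal ((L2_norm f)\<^sup>2)" if "f \<in> L2_space" for f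
    unfolding L2_norm_power2 using that unfolding L2_space_def
    by (subst nn_integral_eq_integral[symmetric]) (auto simp: ennreal_power)
  have "ennreal (cmod (L2_inner f h)) \<le> (\<integral>\<^sup>+x. norm (f x * cnj (h x)) \<partial>lebesgue)"
    unfolding L2_inner_def by (rule integral_norm_bound_ennreal[OF L2_product_integrable[OF f h]])
  also have "\<dots> = (\<integral>\<^sup>+x. ennreal (cmod (f x)) * ennreal (cmod (h x)) \<partial>lebesgue)"
    by (intro nn_integral_cong) (simp add: norm_mult ennreal_mult)
  finally have "(ennreal (cmod (L2_inner f h)))^2 \<le> (\<integral>\<^sup>+x. ennreal (cmod (f x)) * ennreal (cmod (h x)) \<partial>lebesgue)^2"
    by (rule power_mono) simp
  also have "\<dots> \<le> (\<integral>\<^sup>+x. (ennreal (cmod (f x)))^2 \<partial>lebesgue) * (\<integral>\<^sup>+x. (ennreal (cmod (h x)))^2 \<partial>lebesgue)"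
    by (rule Cauchy_Schwarz_nn_integral) measurable
  also have "\<dots> = ennreal ((L2_norm f)\<^sup>2 * (L2_norm h)\<^sup>2)"
    unfolding n[OF f] n[OF h] by (rule ennreal_mult[symmetric]) simp_all
  finally have "ennreal ((cmod (L2_inner f h))\<^sup>2) \<le> ennreal ((L2_norm f)\<^sup>2 * (L2_norm h)\<^sup>2)"
    by (simp add: ennreal_power)
  then show ?thesis by simp
qed

lemma L2_inner_diff_left:
  assumes "f \<in> L2_space" "\<phi> \<in> L2_space" "h \<in> L2_space"
  shows "L2_inner (\<lambda>x. f x - \<phi> x) h = L2_inner f h - L2_inner \<phi> h"
  unfolding L2_inner_def left_diff_distrib
  by (rule Bochner_Integration.integral_diff) (intro L2_product_integrable assms)+

text \<open>It is enough to prove frame inequalities on a dense set.  For a fixed finite set of indices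
  the coefficients depend continuously on the function, so the upper bound passes to the closure;
  the upper bound, now known for differences as well, makes the whole coefficient
  sequence continuous, and then the lower bound passes to the closure too.\<close>

lemma L2_frame_dense:
  fixes e :: "'i \<Rightarrow> real \<Rightarrow> complex"
  assumes e: "\<And>i. e i \<in> L2_space" and D: "D \<subseteq> L2_space"
    and dense: "\<And>f \<epsilon>. f \<in> L2_space \<Longrightarrow> \<epsilon> > 0 \<Longrightarrow> \<exists>\<phi>\<in>D. (L2_norm (\<lambda>x. f x - \<phi> x))\<^sup>2 \<le> \<epsilon>"
    and A: "A > 0" and B: "B > 0"
    and summ: "\<And>\<phi>. \<phi> \<in> D \<Longrightarrow> (\<lambda>i. (cmod (L2_inner \<phi> (e i)))\<^sup>2) summable_on UNIV"
    and low: "\<And>\<phi>. \<phi> \<in> D \<Longrightarrow> (L2_norm \<phi>)\<^sup>2 \<le> A * (\<Sum>\<^sub>\<infinity>i. (cmod (L2_inner \<phi> (e i)))\<^sup>2)"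
    and up: "\<And>\<phi>. \<phi> \<in> D \<Longrightarrow> (\<Sum>\<^sub>\<infinity>i. (cmod (L2_inner \<phi> (e i)))\<^sup>2) \<le> B * (L2_norm \<phi>)\<^sup>2"
  shows "L2_frame e"
proof -
  define q where "q = (\<lambda>f i. (cmod (L2_inner f (e i)))\<^sup>2)"
  have q0: "q f i \<ge> 0" for f i unfolding q_def by simp
  have split: "q f i \<le> 2 * q \<phi> i + 2 * q (\<lambda>x. f x - \<phi> x) i" if "f \<in> L2_space" "\<phi> \<in> L2_space" for f \<phi> i
    using cmod_power2_add_le[of "L2_inner \<phi> (e i)" "L2_inner f (e i) - L2_inner \<phi> (e i)"]
    unfolding q_def L2_inner_diff_left[OF that e] by simp
  have fin: "sum (q f) I \<le> 4 * B * (L2_norm f)\<^sup>2" if f: "f \<in> L2_space" and I: "finite I" for f I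
  proof (rule field_le_epsilon)
    fix \<epsilon> :: real assume \<epsilon>: "\<epsilon> > 0"
    \<comment> \<open>The factor with which the approximation error enters the estimate below.\<close>
    define K where "K = 4 * B + 2 * (\<Sum>i\<in>I. (L2_norm (e i))\<^sup>2)"
    have K: "K > 0" unfolding K_def using B by (simp add: add_pos_nonneg sum_nonneg)
    obtain \<phi> where \<phi>: "\<phi> \<in> D" "(L2_norm (\<lambda>x. f x - \<phi> x))\<^sup>2 \<le> \<epsilon> / K"
      using dense[OF f, of "\<epsilon> / K"] \<epsilon> K by auto
    then have L: "\<phi> \<in> L2_space" using D by auto
    let ?d = "\<lambda>x. f x - \<phi> x"
    have swap: "(L2_norm (\<lambda>x. \<phi> x - f x))\<^sup>2 = (L2_norm ?d)\<^sup>2"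
      unfolding L2_norm_power2 by (simp add: norm_minus_commute)
    have s1: "sum (q \<phi>) I \<le> B * (L2_norm \<phi>)\<^sup>2"
    proof -
      have "sum (q \<phi>) I \<le> infsum (q \<phi>) UNIV"
        by (rule finite_sum_le_infsum) (use summ[OF \<phi>(1)] I q0 in \<open>auto simp: q_def\<close>)
      then show ?thesis using up[OF \<phi>(1)] unfolding q_def by linarith
    qed
    have s2: "sum (q ?d) I \<le> (L2_norm ?d)\<^sup>2 * (\<Sum>i\<in>I. (L2_norm (e i))\<^sup>2)"
      unfolding q_def sum_distrib_left by (intro sum_mono L2_inner_power2_le L2_space_diff f L e)
    have "sum (q f) I \<le> (\<Sum>i\<in>I. 2 * q \<phi> i + 2 * q ?d i)"
      by (intro sum_mono split f L)
    also have "\<dots> = 2 * sum (q \<phi>) I + 2 * sum (q ?d) I" by (simp add: sum.distrib sum_distrib_left)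
    also have "\<dots> \<le> 2 * (B * (2 * (L2_norm f)\<^sup>2 + 2 * (L2_norm ?d)\<^sup>2)) + 2 * ((L2_norm ?d)\<^sup>2 * (\<Sum>i\<in>I. (L2_norm (e i))\<^sup>2))"
    proof -
      have "B * (L2_norm \<phi>)\<^sup>2 \<le> B * (2 * (L2_norm f)\<^sup>2 + 2 * (L2_norm ?d)\<^sup>2)"
        using L2_norm_add_le[OF L f] B unfolding swap by (intro mult_left_mono) auto
      then show ?thesis using s1 s2 by linarith
    qed
    also have "\<dots> = 4 * B * (L2_norm f)\<^sup>2 + K * (L2_norm ?d)\<^sup>2" unfolding K_def by (simp add: algebra_simps)
    also have "K * (L2_norm ?d)\<^sup>2 \<le> K * (\<epsilon> / K)" using \<phi>(2) K by (intro mult_left_mono) auto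
    also have "K * (\<epsilon> / K) = \<epsilon>" using K by simp
    finally show "sum (q f) I \<le> 4 * B * (L2_norm f)\<^sup>2 + \<epsilon>" by simp
  qed
  have sm: "q f summable_on UNIV" if f: "f \<in> L2_space" for f
  proof (rule nonneg_bdd_above_summable_on)
    show "bdd_above (sum (q f) ` {F. F \<subseteq> UNIV \<and> finite F})"
      using fin[OF f] by (intro bdd_aboveI[of _ "4 * B * (L2_norm f)\<^sup>2"]) auto
  qed (rule q0)
  have upper: "infsum (q f) UNIV \<le> 4 * B * (L2_norm f)\<^sup>2" if f: "f \<in> L2_space" for f
    by (rule infsum_le_finite_sums[OF sm[OF f]]) (rule fin[OF f])
  have lower: "(L2_norm f)\<^sup>2 \<le> 4 * A * infsum (q f) UNIV" if f: "f \<in> L2_space" for f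
  proof (rule field_le_epsilon)
    fix \<epsilon> :: real assume \<epsilon>: "\<epsilon> > 0"
    define K where "K = 16 * A * B + 2"
    have K: "K > 0" unfolding K_def using A B by (simp add: add_pos_pos)
    obtain \<phi> where \<phi>: "\<phi> \<in> D" "(L2_norm (\<lambda>x. f x - \<phi> x))\<^sup>2 \<le> \<epsilon> / K"
      using dense[OF f, of "\<epsilon> / K"] \<epsilon> K by auto
    then have L: "\<phi> \<in> L2_space" using D by auto
    let ?d = "\<lambda>x. f x - \<phi> x" and ?d' = "\<lambda>x. \<phi> x - f x"
    have swap: "(L2_norm ?d')\<^sup>2 = (L2_norm ?d)\<^sup>2"
      unfolding L2_norm_power2 by (simp add: norm_minus_commute)
    have "infsum (q \<phi>) UNIV \<le> infsum (\<lambda>i. 2 * q f i + 2 * q ?d' i) UNIV"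
      by (intro infsum_mono summable_on_add summable_on_cmult_right sm L f L2_space_diff split)
    also have "\<dots> = 2 * infsum (q f) UNIV + 2 * infsum (q ?d') UNIV"
      by (subst infsum_add) (auto intro!: summable_on_cmult_right sm f L L2_space_diff simp: infsum_cmult_right sm f L L2_space_diff)
    also have "\<dots> \<le> 2 * infsum (q f) UNIV + 8 * B * (L2_norm ?d)\<^sup>2"
      using upper[OF L2_space_diff[OF L f]] unfolding swap by linarith
    finally have c: "A * infsum (q \<phi>) UNIV \<le> A * (2 * infsum (q f) UNIV + 8 * B * (L2_norm ?d)\<^sup>2)"
      using A by (intro mult_left_mono) auto
    have "(L2_norm f)\<^sup>2 \<le> 2 * (A * infsum (q \<phi>) UNIV) + 2 * (L2_norm ?d)\<^sup>2"
      using L2_norm_add_le[OF f L] low[OF \<phi>(1)] unfolding q_def by linarith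
    also have "\<dots> \<le> 2 * (A * (2 * infsum (q f) UNIV + 8 * B * (L2_norm ?d)\<^sup>2)) + 2 * (L2_norm ?d)\<^sup>2"
      using c by linarith
    also have "\<dots> = 4 * A * infsum (q f) UNIV + K * (L2_norm ?d)\<^sup>2" unfolding K_def by (simp add: algebra_simps)
    also have "K * (L2_norm ?d)\<^sup>2 \<le> K * (\<epsilon> / K)" using \<phi>(2) K by (intro mult_left_mono) auto
    also have "K * (\<epsilon> / K) = \<epsilon>" using K by simp
    finally show "(L2_norm f)\<^sup>2 \<le> 4 * A * infsum (q f) UNIV + \<epsilon>" by simp
  qed
  have "1 / (4 * A) > 0" "4 * B > 0" using A B by simp_all
  moreover have "1 / (4 * A) * (L2_norm f)\<^sup>2 \<le> infsum (q f) UNIV" if "f \<in> L2_space" for f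
    using lower[OF that] A by (simp add: field_simps)
  ultimately show ?thesis
    unfolding L2_frame_def using e sm upper unfolding q_def by blast
qed

lemma cc_L2: assumes f: "cc R f" shows "f \<in> L2_space"
proof -
  have m: "f \<in> borel_measurable borel" by (rule cc_measurable[OF f])
  have "cc R (\<lambda>x. f x * cnj (f x))" using f unfolding cc_def by (auto intro!: continuous_intros)
  then have "integrable lborel (\<lambda>x. norm (f x * cnj (f x)))" by (rule integrable_norm[OF cc_integrable])
  then have "integrable lborel (\<lambda>x. (cmod (f x))\<^sup>2)" by (simp add: norm_mult power2_eq_square)
  then have "integrable lebesgue (\<lambda>x. (cmod (f x))\<^sup>2)"
    using m by (subst integrable_completion) simp_all
  moreover have "f \<in> borel_measurable lebesgue" using m by (simp add: measurable_completion)
  ultimately show ?thesis unfolding L2_space_def by simp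
qed

text \<open>After truncating domain and values, the function is an almost everywhere limit of continuous functions.  These are
  forced back into a fixed disc and a fixed interval without changing the limit, so that dominated convergence
  applies.\<close>

lemma cc_dense:
  assumes f: "f \<in> L2_space" and \<epsilon>: "\<epsilon> > 0"
  shows "\<exists>\<phi>\<in>{\<phi>. \<exists>R. cc R \<phi>}. (L2_norm (\<lambda>x. f x - \<phi> x))\<^sup>2 \<le> \<epsilon>"
proof -
  have fm[measurable]: "f \<in> borel_measurable lebesgue" and fi: "integrable lebesgue (\<lambda>x. (cmod (f x))\<^sup>2)"
    using f unfolding L2_space_def by auto
  have sq: "(\<lambda>M. LINT x|lebesgue. (cmod (s M x))\<^sup>2) \<longlonglongrightarrow> 0"
    if s: "\<And>M::nat. s M \<in> borel_measurable lebesgue" and w: "integrable lebesgue w"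
      and lim: "AE x in lebesgue. (\<lambda>M. s M x) \<longlonglongrightarrow> (0::complex)"
      and bd: "\<And>M x. (cmod (s M x))\<^sup>2 \<le> w x" for s :: "nat \<Rightarrow> real \<Rightarrow> complex" and w :: "real \<Rightarrow> real"
  proof -
    have "(\<lambda>M. LINT x|lebesgue. (cmod (s M x))\<^sup>2) \<longlonglongrightarrow> (LINT x::real|lebesgue. (0::real))"
    proof (rule integral_dominated_convergence[where w = w])
      show "(\<lambda>x. (cmod (s M x))\<^sup>2) \<in> borel_measurable lebesgue" for M using s[of M] by measurable
      show "AE x in lebesgue. (\<lambda>M. (cmod (s M x))\<^sup>2) \<longlonglongrightarrow> 0"
        using lim
      proof eventually_elim
        case (elim x)
        show ?case using tendsto_power[OF tendsto_norm[OF elim], of 2] by simp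
      qed
    qed (use bd w in auto)
    then show ?thesis by simp
  qed
  define T where "T = (\<lambda>(M::nat) x. if \<bar>x\<bar> \<le> real M \<and> cmod (f x) \<le> real M then f x else 0)"
  have [measurable]: "(\<lambda>x::real. x) \<in> borel_measurable lebesgue" by (rule measurable_completion) simp
  have abs_m: "(\<lambda>x::real. \<bar>x\<bar>) \<in> borel_measurable lebesgue" by measurable
  have nf_m: "(\<lambda>x. cmod (f x)) \<in> borel_measurable lebesgue" by measurable
  have Tm[measurable]: "T M \<in> borel_measurable lebesgue" for M
    unfolding T_def
    by (intro measurable_If fm borel_measurable_const sets.sets_Collect_conj borel_measurable_le abs_m nf_m)
  have "(\<lambda>M. LINT x|lebesgue. (cmod (f x - T M x))\<^sup>2) \<longlonglongrightarrow> 0"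
  proof (rule sq[OF _ fi])
    show "AE x in lebesgue. (\<lambda>M. f x - T M x) \<longlonglongrightarrow> 0"
    proof (rule AE_I2)
      fix x
      obtain N :: nat where N: "max \<bar>x\<bar> (cmod (f x)) \<le> real N" using real_arch_simple by blast
      have "f x - T M x = 0" if "M \<ge> N" for M
        using N that unfolding T_def by auto
      then show "(\<lambda>M. f x - T M x) \<longlonglongrightarrow> 0"
        by (intro tendsto_eventually eventually_sequentiallyI[of N])
    qed
    show "(cmod (f x - T M x))\<^sup>2 \<le> (cmod (f x))\<^sup>2" for M x unfolding T_def by auto
  qed measurable
  then have "eventually (\<lambda>M. (LINT x|lebesgue. (cmod (f x - T M x))\<^sup>2) < \<epsilon> / 4) sequentially"
    by (rule order_tendstoD) (use \<epsilon> in simp)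
  then obtain M where M: "(LINT x|lebesgue. (cmod (f x - T M x))\<^sup>2) < \<epsilon> / 4"
    using eventually_happens'[OF sequentially_bot] by blast
  have "T M measurable_on UNIV" by (rule lebesgue_measurable_imp_measurable_on[OF Tm]) simp
  then obtain N G where N: "negligible N" and G: "\<And>n. continuous_on UNIV (G n)"
    and lim: "\<And>x. x \<notin> N \<Longrightarrow> (\<lambda>n. G n x) \<longlonglongrightarrow> T M x"
    unfolding measurable_on_def by auto
  define r where "r = real M + 1"
  have r: "r > 0" unfolding r_def by simp
  \<comment> \<open>The radial projection onto the disc of radius \<open>r\<close> and a tent cut-off both fix \<open>T M\<close>.\<close>
  define P where "P = (\<lambda>z::complex. z * of_real (r / max r (cmod z)))"
  define \<kappa> where "\<kappa> = (\<lambda>x::real. complex_of_real (max 0 (min 1 (r - \<bar>x\<bar>))))"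
  have Pc: "continuous_on UNIV P" unfolding P_def using r by (intro continuous_intros) (auto simp: max_def)
  have Pb: "cmod (P z) \<le> r" for z
  proof (cases "cmod z \<le> r")
    case True then show ?thesis unfolding P_def using r by (simp add: norm_mult max_def)
  next
    case False then show ?thesis unfolding P_def using r by (simp add: norm_mult norm_divide max_def)
  qed
  have Pid: "P z = z" if "cmod z \<le> r" for z using that r unfolding P_def by (simp add: max_def)
  have \<kappa>c: "continuous_on UNIV \<kappa>" unfolding \<kappa>_def by (intro continuous_intros)
  have \<kappa>b: "cmod (\<kappa> x) \<le> 1" for x unfolding \<kappa>_def by simp
  have \<kappa>0: "\<kappa> x = 0" if "\<bar>x\<bar> \<ge> r" for x using that unfolding \<kappa>_def by simp
  have TP: "\<kappa> x * P (T M x) = T M x" for x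
  proof (cases "T M x = 0")
    case False
    then have "\<bar>x\<bar> \<le> real M" "cmod (T M x) \<le> real M" unfolding T_def by (auto split: if_splits)
    then show ?thesis using Pid[of "T M x"] unfolding \<kappa>_def r_def by simp
  qed (simp add: P_def)
  define \<phi> where "\<phi> = (\<lambda>n x. \<kappa> x * P (G n x))"
  have cc: "cc r (\<phi> n)" for n
    unfolding cc_def \<phi>_def using r \<kappa>0
    by (auto intro!: continuous_intros continuous_on_compose2[OF Pc G] \<kappa>c)
  have \<phi>m[measurable]: "\<phi> n \<in> borel_measurable lebesgue" for n
    using cc_L2[OF cc[of n]] unfolding L2_space_def by simp
  have Tb: "cmod (T M x) \<le> r" for x unfolding T_def r_def by auto
  have T0: "T M x = 0" if "\<bar>x\<bar> \<ge> r" for x using that unfolding T_def r_def by auto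
  have "(\<lambda>n. LINT x|lebesgue. (cmod (T M x - \<phi> n x))\<^sup>2) \<longlonglongrightarrow> 0"
  proof (rule sq)
    show "(\<lambda>x. T M x - \<phi> n x) \<in> borel_measurable lebesgue" for n by measurable
    show "integrable lebesgue (\<lambda>x. (2 * r)\<^sup>2 * indicator {-r..r} x)"
      by (intro integrable_mult_right integrable_real_indicator) (auto simp: emeasure_lborel_Icc_eq)
    have "AE x in lebesgue. x \<notin> N"
      using N by (intro AE_not_in) (simp add: negligible_iff_null_sets)
    then show "AE x in lebesgue. (\<lambda>n. T M x - \<phi> n x) \<longlonglongrightarrow> 0"
    proof eventually_elim
      case (elim x)
      have "isCont P (T M x)" using Pc by (simp add: continuous_on_eq_continuous_at)
      then have "(\<lambda>n. P (G n x)) \<longlonglongrightarrow> P (T M x)" by (rule isCont_tendsto_compose[OF _ lim[OF elim]])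
      then have "(\<lambda>n. T M x - \<phi> n x) \<longlonglongrightarrow> T M x - \<kappa> x * P (T M x)"
        unfolding \<phi>_def by (intro tendsto_intros)
      then show ?case unfolding TP by simp
    qed
    show "(cmod (T M x - \<phi> n x))\<^sup>2 \<le> (2 * r)\<^sup>2 * indicator {-r..r} x" for n x
    proof (cases "\<bar>x\<bar> \<ge> r")
      case True then show ?thesis using T0 \<kappa>0 unfolding \<phi>_def by (simp add: indicator_def)
    next
      case False
      have "cmod (\<kappa> x) * cmod (P (G n x)) \<le> 1 * r" by (intro mult_mono \<kappa>b Pb) auto
      then have "cmod (T M x - \<phi> n x) \<le> 2 * r"
        using norm_triangle_ineq4[of "T M x" "\<phi> n x"] Tb[of x] unfolding \<phi>_def by (simp add: norm_mult)
      then have "(cmod (T M x - \<phi> n x))\<^sup>2 \<le> (2 * r)\<^sup>2" by (intro power_mono) auto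
      moreover have "x \<in> {-r..r}" using False by auto
      ultimately show ?thesis by simp
    qed
  qed
  then have "eventually (\<lambda>n. (LINT x|lebesgue. (cmod (T M x - \<phi> n x))\<^sup>2) < \<epsilon> / 4) sequentially"
    by (rule order_tendstoD) (use \<epsilon> in simp)
  then obtain n where n: "(LINT x|lebesgue. (cmod (T M x - \<phi> n x))\<^sup>2) < \<epsilon> / 4"
    using eventually_happens'[OF sequentially_bot] by blast
  have fTM: "(\<lambda>x. f x - T M x) \<in> L2_space"
  proof -
    have "integrable lebesgue (\<lambda>x. (cmod (f x - T M x))\<^sup>2)"
      by (rule Bochner_Integration.integrable_bound[OF fi]) (auto simp: T_def)
    then show ?thesis unfolding L2_space_def by simp
  qed
  have L: "(\<lambda>x. f x - \<phi> n x) \<in> L2_space" by (rule L2_space_diff[OF f cc_L2[OF cc]])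
  have "(L2_norm (\<lambda>x. f x - \<phi> n x))\<^sup>2 \<le> 2 * (L2_norm (\<lambda>x. f x - T M x))\<^sup>2 + 2 * (L2_norm (\<lambda>x. T M x - \<phi> n x))\<^sup>2"
    using L2_norm_add_le[OF L fTM] by simp
  also have "\<dots> \<le> \<epsilon>" using M n \<epsilon> unfolding L2_norm_power2 by simp
  finally show ?thesis using cc by blast
qed

section \<open>Frame bounds\<close>

lemma borel_measurable_nn_integral_int:
  fixes h :: "int \<Rightarrow> 'a \<Rightarrow> ennreal"
  assumes [measurable]: "\<And>i. h i \<in> borel_measurable M"
  shows "(\<lambda>x. \<integral>\<^sup>+i. h i x \<partial>count_space UNIV) \<in> borel_measurable M"
proof -
  have "(\<integral>\<^sup>+i. h i x \<partial>count_space UNIV) = (\<Sum>n. h (int_decode n) x)" for x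
    by (simp add: nn_integral_bij_count_space[OF bij_int_decode, symmetric] nn_integral_count_space_nat)
  then show ?thesis by simp
qed

text \<open>The sum of the squared Gabor coefficients, with the modulations outside and the translations inside: the
  order in which \<open>fibre_parseval\<close> evaluates it.\<close>

definition gabor_energy :: "real \<Rightarrow> real \<Rightarrow> (real \<Rightarrow> complex) \<Rightarrow> ennreal" where
  "gabor_energy \<alpha> \<beta> f = (\<integral>\<^sup>+m. (\<integral>\<^sup>+k. ennreal ((cmod (\<integral>x. f x *
      cnj (cis (2 * pi * (\<beta> * of_int m) * x) * complex_of_real (gwindow (x - \<alpha> * of_int k))) \<partial>lborel))\<^sup>2)
      \<partial>ints) \<partial>ints)"

text \<open>By \<open>fibre_parseval\<close> the energy is the integral over \<open>\<xi>\<close> of the squared fibres, summed over the modulations; by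
  Plancherel and periodization the norm is the integral of the squared values of the transform on \<open>\<xi> + a * \<int>\<close>.  For
  each \<open>\<xi>\<close> the discrete bounds compare the two integrands, with constants that do not depend on \<open>\<xi>\<close>.\<close>

lemma cc_frame_bounds:
  assumes \<alpha>: "\<alpha> > 0" and \<beta>: "\<beta> > 0" and \<delta>: "0 < \<delta>" "\<delta> \<le> 2 * pi * \<beta> / 2"
    and dens: "2 * pi / \<alpha> = 3 * (2 * pi * \<beta>) - \<delta>"
  obtains A B :: real where "A > 0" "B > 0"
    "\<And>R f. cc R f \<Longrightarrow> (\<integral>\<^sup>+x. ennreal ((cmod (f x))\<^sup>2) \<partial>lborel) \<le> ennreal A * gabor_energy \<alpha> \<beta> f"
    "\<And>R f. cc R f \<Longrightarrow> gabor_energy \<alpha> \<beta> f \<le> ennreal B * (\<integral>\<^sup>+x. ennreal ((cmod (f x))\<^sup>2) \<partial>lborel)"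
proof -
  define a where "a = 1 / \<alpha>"
  have a: "a > 0" unfolding a_def using \<alpha> by simp
  define \<theta> where "\<theta> = 2 * pi * \<beta>"
  have \<theta>: "\<theta> > 0" unfolding \<theta>_def using \<beta> by simp
  have step: "3 * \<theta> - \<delta> = 2 * pi * a" using dens unfolding a_def \<theta>_def by simp
  have \<delta>': "\<delta> \<le> \<theta> / 2" using \<delta> unfolding \<theta>_def by simp
  have a2: "2 * pi * a > 0" using a by simp
  obtain C where C: "C > 0" "\<And>x0 c. (\<And>y. integrable (count_space UNIV) (\<lambda>j. c j * complex_of_real (profile (y - (x0 + of_int j * (3 * \<theta> - \<delta>)))))) \<Longrightarrow>
      (\<integral>\<^sup>+j. ennreal ((cmod (c j))\<^sup>2) \<partial>count_space UNIV)
      \<le> ennreal C * (\<integral>\<^sup>+m. ennreal ((cmod (colsum (\<lambda>j. x0 + of_int j * (3 * \<theta> - \<delta>)) c (of_int m * \<theta>)))\<^sup>2) \<partial>ints)"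
    by (rule colsum_lower[OF \<theta> \<delta>(1) \<delta>'], blast)
  obtain D where D: "D > 0" "\<And>x0 c B. (\<And>j. cmod (c j) \<le> B) \<Longrightarrow>
     (\<integral>\<^sup>+m. ennreal ((cmod (colsum (\<lambda>j. x0 + of_int j * (2 * pi * a)) c (of_int m * \<theta>)))\<^sup>2) \<partial>ints)
      \<le> ennreal D * (\<integral>\<^sup>+j. ennreal ((cmod (c j))\<^sup>2) \<partial>count_space UNIV)"
    by (rule colsum_upper[OF a2 \<theta>], blast)
  define K where "K = (pi / 12)\<^sup>2 * a"
  have K: "K > 0" unfolding K_def using a by simp
  define rows where "rows = (\<lambda>f \<xi>. \<integral>\<^sup>+m. ennreal ((cmod (fibre a f (\<beta> * of_int m) \<xi>))\<^sup>2) \<partial>ints)"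
  define cols where "cols = (\<lambda>f \<xi>. \<integral>\<^sup>+j. ennreal ((cmod (fourier f (\<xi> + of_int j * a)))\<^sup>2) \<partial>ints)"
  have fib_m: "(\<lambda>\<xi>. ennreal ((cmod (fibre a f b \<xi>))\<^sup>2)) \<in> borel_measurable (seg 0 a)" if f: "cc R f" for R f b
  proof -
    have "fibre a f b \<in> borel_measurable (seg 0 a)"
      by (rule borel_measurable_seg_continuous) (use fibre_continuous[OF a f] in simp)
    then show ?thesis by measurable
  qed
  have four_m: "fourier f \<in> borel_measurable borel" if f: "cc R f" for R f
    by (rule borel_measurable_continuous_onI[OF fourier_continuous[OF f]])
  have rows_m: "rows f \<in> borel_measurable (seg 0 a)" if f: "cc R f" for R f
    unfolding rows_def by (rule borel_measurable_nn_integral_int[OF fib_m[OF f]])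
  have cols_m: "cols f \<in> borel_measurable (seg 0 a)" if f: "cc R f" for R f
  proof -
    note four_m[OF f, measurable]
    have "(\<lambda>\<xi>. ennreal ((cmod (fourier f (\<xi> + of_int j * a)))\<^sup>2)) \<in> borel_measurable borel" for j :: int
      by measurable
    then show ?thesis unfolding cols_def by (intro borel_measurable_nn_integral_int borel_measurable_seg)
  qed
  have energy: "gabor_energy \<alpha> \<beta> f = ennreal K * (\<integral>\<^sup>+\<xi>. rows f \<xi> \<partial>seg 0 a)" if f: "cc R f" for R f
  proof -
    have "gabor_energy \<alpha> \<beta> f = (\<integral>\<^sup>+m. ennreal K * (\<integral>\<^sup>+\<xi>. ennreal ((cmod (fibre a f (\<beta> * of_int m) \<xi>))\<^sup>2) \<partial>seg 0 a) \<partial>ints)"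
      unfolding gabor_energy_def fibre_parseval[OF \<alpha> f] K_def a_def ..
    also have "\<dots> = ennreal K * (\<integral>\<^sup>+m. (\<integral>\<^sup>+\<xi>. ennreal ((cmod (fibre a f (\<beta> * of_int m) \<xi>))\<^sup>2) \<partial>seg 0 a) \<partial>ints)"
      by (rule nn_integral_cmult) simp
    also have "(\<integral>\<^sup>+m. (\<integral>\<^sup>+\<xi>. ennreal ((cmod (fibre a f (\<beta> * of_int m) \<xi>))\<^sup>2) \<partial>seg 0 a) \<partial>ints) = (\<integral>\<^sup>+\<xi>. rows f \<xi> \<partial>seg 0 a)"
      unfolding rows_def by (rule nn_integral_count_space_nn_integral[symmetric]) (use fib_m[OF f] in auto)
    finally show ?thesis .
  qed
  have norm: "(\<integral>\<^sup>+x. ennreal ((cmod (f x))\<^sup>2) \<partial>lborel) = (\<integral>\<^sup>+\<xi>. cols f \<xi> \<partial>seg 0 a)" if f: "cc R f" for R f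
  proof -
    note four_m[OF f, measurable]
    show ?thesis
      unfolding plancherel_cc[OF f, symmetric] cols_def by (rule nn_integral_periodize[OF a]) measurable
  qed
  have fib: "fibre a f (\<beta> * of_int m) \<xi> = colsum (\<lambda>j. 2 * pi * \<xi> + of_int j * (2 * pi * a)) (\<lambda>j. fourier f (\<xi> + of_int j * a)) (of_int m * \<theta>)"
    for f \<xi> and m :: int
    unfolding fibre_def \<theta>_def by (simp add: mult_ac)
  have low: "cols f \<xi> \<le> ennreal C * rows f \<xi>" if f: "cc R f" for R f \<xi>
    unfolding cols_def rows_def fib
    by (rule C(2)[unfolded step], rule integrable_profile_row[OF a2], rule fourier_bound[OF f])
  have up: "rows f \<xi> \<le> ennreal D * cols f \<xi>" if f: "cc R f" for R f \<xi>
    unfolding cols_def rows_def fib by (rule D(2), rule fourier_bound[OF f])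
  show ?thesis
  proof
    show "C / K > 0" "K * D > 0" using C(1) D(1) K by simp_all
    show "(\<integral>\<^sup>+x. ennreal ((cmod (f x))\<^sup>2) \<partial>lborel) \<le> ennreal (C / K) * gabor_energy \<alpha> \<beta> f" if f: "cc R f" for R f
    proof -
      have "(\<integral>\<^sup>+\<xi>. cols f \<xi> \<partial>seg 0 a) \<le> (\<integral>\<^sup>+\<xi>. ennreal C * rows f \<xi> \<partial>seg 0 a)"
        by (intro nn_integral_mono low[OF f])
      also have "\<dots> = ennreal C * (\<integral>\<^sup>+\<xi>. rows f \<xi> \<partial>seg 0 a)" by (rule nn_integral_cmult[OF rows_m[OF f]])
      also have "ennreal C = ennreal (C / K) * ennreal K" using C(1) K by (simp add: ennreal_mult[symmetric])
      finally show ?thesis unfolding norm[OF f] energy[OF f] by (simp add: mult.assoc)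
    qed
    show "gabor_energy \<alpha> \<beta> f \<le> ennreal (K * D) * (\<integral>\<^sup>+x. ennreal ((cmod (f x))\<^sup>2) \<partial>lborel)" if f: "cc R f" for R f
    proof -
      have "(\<integral>\<^sup>+\<xi>. rows f \<xi> \<partial>seg 0 a) \<le> (\<integral>\<^sup>+\<xi>. ennreal D * cols f \<xi> \<partial>seg 0 a)"
        by (intro nn_integral_mono up[OF f])
      also have "\<dots> = ennreal D * (\<integral>\<^sup>+\<xi>. cols f \<xi> \<partial>seg 0 a)" by (rule nn_integral_cmult[OF cols_m[OF f]])
      finally have "ennreal K * (\<integral>\<^sup>+\<xi>. rows f \<xi> \<partial>seg 0 a) \<le> ennreal K * (ennreal D * (\<integral>\<^sup>+\<xi>. cols f \<xi> \<partial>seg 0 a))"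
        by (intro mult_left_mono) auto
      then show ?thesis unfolding norm[OF f] energy[OF f] using K D(1) by (simp add: ennreal_mult mult.assoc)
    qed
  qed
qed

lemma nn_integral_count_space_infsum:
  fixes q :: "'i \<Rightarrow> real"
  assumes q: "\<And>i. q i \<ge> 0" and fin: "(\<integral>\<^sup>+i. ennreal (q i) \<partial>count_space UNIV) < \<infinity>"
  shows "q summable_on UNIV" "(\<integral>\<^sup>+i. ennreal (q i) \<partial>count_space UNIV) = ennreal (infsum q UNIV)"
proof -
  have "integrable (count_space UNIV) q"
    by (rule integrableI_bounded) (use q fin in simp_all)
  then have a: "Infinite_Set_Sum.abs_summable_on q UNIV"
    unfolding Infinite_Set_Sum.abs_summable_on_def .
  then show "q summable_on UNIV"
    unfolding abs_summable_equivalent[symmetric] by (rule abs_summable_summable)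
  show "(\<integral>\<^sup>+i. ennreal (q i) \<partial>count_space UNIV) = ennreal (infsum q UNIV)"
    unfolding infsetsum_infsum[OF a, symmetric] by (rule nn_integral_conv_infsetsum[OF a]) (rule q)
qed

lemma integrable_inverse_one_plus_square: "integrable lborel (\<lambda>x::real. inverse (1 + x\<^sup>2))"
proof (rule integrableI_bounded)
  let ?h = "\<lambda>x::real. ennreal (inverse (1 + x\<^sup>2))"
  have half: "(\<integral>\<^sup>+x. ?h x * indicator {0..} x \<partial>lborel) = ennreal (pi / 2 - arctan 0)"
  proof (rule nn_integral_FTC_atLeast)
    show "(arctan \<longlongrightarrow> pi / 2) at_top" by (rule tendsto_arctan_at_top)
  qed (auto intro: DERIV_arctan)
  have other: "(\<integral>\<^sup>+x. ?h x * indicator {..0} x \<partial>lborel) = (\<integral>\<^sup>+x. ?h x * indicator {0..} x \<partial>lborel)"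
    by (subst nn_integral_real_affine[where c = "-1" and t = 0]) (auto intro!: nn_integral_cong simp: indicator_def)
  have "(\<integral>\<^sup>+x. ennreal (norm (inverse (1 + (x::real)\<^sup>2))) \<partial>lborel) \<le> (\<integral>\<^sup>+x. ?h x * indicator {0..} x + ?h x * indicator {..0} x \<partial>lborel)"
    by (intro nn_integral_mono) (auto simp: indicator_def)
  also have "\<dots> = (\<integral>\<^sup>+x. ?h x * indicator {0..} x \<partial>lborel) + (\<integral>\<^sup>+x. ?h x * indicator {..0} x \<partial>lborel)"
    by (rule nn_integral_add) simp_all
  also have "\<dots> < \<infinity>" unfolding other half by simp
  finally show "(\<integral>\<^sup>+x. ennreal (norm (inverse (1 + (x::real)\<^sup>2))) \<partial>lborel) < \<infinity>" .
qed simp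

lemma gwindow_measurable [measurable]: "gwindow \<in> borel_measurable borel"
  unfolding gwindow_def by measurable

lemma gwindow_power2_le: "(gwindow x)\<^sup>2 \<le> inverse (1 + x\<^sup>2)"
proof -
  have p: "0 < 1 + x\<^sup>2" "1 \<le> 1 + x\<^sup>2" by (simp_all add: add_pos_nonneg)
  have nz: "x\<^sup>2 + 1 \<noteq> 0" using p by linarith
  have P: "1 + x\<^sup>2 \<le> (x\<^sup>2 + 4) * (x\<^sup>2 + 9)" by (simp add: algebra_simps)
  have "\<bar>x\<^sup>2 - 1\<bar> \<le> x\<^sup>2 + 1" by (simp add: abs_le_iff)
  then have "\<bar>gwindow x\<bar> \<le> (x\<^sup>2 + 1) / ((x\<^sup>2 + 1) * (x\<^sup>2 + 4) * (x\<^sup>2 + 9))"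
    unfolding gwindow_def abs_divide using p by (intro frac_le) (auto simp: add_pos_nonneg abs_mult)
  also have "\<dots> = inverse ((x\<^sup>2 + 4) * (x\<^sup>2 + 9))" using nz by (simp add: divide_simps)
  also have "\<dots> \<le> inverse (1 + x\<^sup>2)" using P p(1) by (rule le_imp_inverse_le)
  finally have g: "\<bar>gwindow x\<bar> \<le> inverse (1 + x\<^sup>2)" .
  have "inverse (1 + x\<^sup>2) \<le> 1" using p by (simp add: inverse_le_1_iff)
  then have "\<bar>gwindow x\<bar> * \<bar>gwindow x\<bar> \<le> inverse (1 + x\<^sup>2) * 1" using g p by (intro mult_mono) auto
  then show ?thesis by (simp add: power2_eq_square)
qed

lemma gabor_system_gwindow:
  "gabor_system (\<lambda>x. complex_of_real (gwindow x)) \<alpha> \<beta> (k, m) =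
     (\<lambda>x. cis (2 * pi * (\<beta> * of_int m) * x) * complex_of_real (gwindow (x - \<alpha> * of_int k)))"
  unfolding gabor_system_def by (simp add: cis_conv_exp mult_ac)

lemma gabor_system_L2:
  "gabor_system (\<lambda>x. complex_of_real (gwindow x)) \<alpha> \<beta> i \<in> L2_space"
proof -
  obtain k m where i: "i = (k, m)" by (cases i)
  let ?e = "\<lambda>x. cis (2 * pi * (\<beta> * of_int m) * x) * complex_of_real (gwindow (x - \<alpha> * of_int k))"
  have [measurable]: "(\<lambda>x. cis (2 * pi * (\<beta> * of_int m) * x)) \<in> borel_measurable borel" by (rule cis_measurable)
  have m: "?e \<in> borel_measurable borel" by measurable
  have "integrable lborel (\<lambda>x. (gwindow x)\<^sup>2)"
    by (rule Bochner_Integration.integrable_bound[OF integrable_inverse_one_plus_square])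
      (use gwindow_power2_le in \<open>auto simp: add_nonneg_nonneg\<close>)
  then have "integrable lborel (\<lambda>x. (gwindow (- (\<alpha> * of_int k) + 1 * x))\<^sup>2)"
    by (rule lborel_integrable_real_affine) simp
  then have "integrable lborel (\<lambda>x. (cmod (?e x))\<^sup>2)" by (simp add: norm_mult)
  then have "integrable lebesgue (\<lambda>x. (cmod (?e x))\<^sup>2)"
    using m by (subst integrable_completion) simp_all
  then show ?thesis unfolding i gabor_system_gwindow L2_space_def using m by (simp add: measurable_completion)
qed

lemma gabor_energy_eq:
  assumes f: "cc R f"
  shows "(\<integral>\<^sup>+i. ennreal ((cmod (L2_inner f (gabor_system (\<lambda>x. complex_of_real (gwindow x)) \<alpha> \<beta> i)))\<^sup>2) \<partial>count_space UNIV)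
    = gabor_energy \<alpha> \<beta> f"
proof -
  have "L2_inner f (gabor_system (\<lambda>x. complex_of_real (gwindow x)) \<alpha> \<beta> (k, m))
     = (\<integral>x. f x * cnj (cis (2 * pi * (\<beta> * of_int m) * x) * complex_of_real (gwindow (x - \<alpha> * of_int k))) \<partial>lborel)" for k m
  proof -
    have [measurable]: "f \<in> borel_measurable borel" by (rule cc_measurable[OF f])
    have [measurable]: "(\<lambda>x. cis (- (2 * pi * (\<beta> * of_int m)) * x)) \<in> borel_measurable borel" by (rule cis_measurable)
    have "(\<lambda>x. f x * (cis (- (2 * pi * (\<beta> * of_int m)) * x) * complex_of_real (gwindow (x - \<alpha> * of_int k)))) \<in> borel_measurable borel"
      by measurable
    then have "(\<lambda>x. f x * cnj (cis (2 * pi * (\<beta> * of_int m) * x) * complex_of_real (gwindow (x - \<alpha> * of_int k)))) \<in> borel_measurable lborel"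
      by (simp add: cis_cnj)
    then show ?thesis unfolding L2_inner_def gabor_system_gwindow by (rule integral_completion)
  qed
  then show ?thesis
    unfolding gabor_energy_def by (simp add: nn_integral_snd_count_space[symmetric])
qed

theorem theorem1p3:
  fixes g :: "real \<Rightarrow> complex" and p :: int and \<alpha> \<beta> :: real
  assumes g: "\<And>x. g x = complex_of_real ((x\<^sup>2 - 1) / ((x\<^sup>2 + 1) * (x\<^sup>2 + 4) * (x\<^sup>2 + 9)))"
    and p: "p \<ge> 2"
    and \<alpha>: "\<alpha> > 0"
    and \<beta>: "\<beta> > 0"
    and density: "\<alpha> * \<beta> = of_int p / (3 * of_int p - 1)"
  shows "L2_frame (gabor_system g \<alpha> \<beta>)"
proof -
  have gw: "g = (\<lambda>x. complex_of_real (gwindow x))" unfolding gwindow_def using g by (intro ext)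
  define P where "P = real_of_int p"
  have P: "P \<ge> 2" using p unfolding P_def by simp
  define \<delta> where "\<delta> = 2 * pi * \<beta> / P"
  have "2 * (pi * \<beta>) \<le> P * (pi * \<beta>)" using P \<beta> by (intro mult_right_mono) auto
  then have \<delta>: "0 < \<delta>" "\<delta> \<le> 2 * pi * \<beta> / 2"
    unfolding \<delta>_def using P \<beta> by (auto simp: divide_le_eq mult_ac)
  have "\<alpha> * \<beta> * (3 * P - 1) = P" using density P unfolding P_def by (simp add: field_simps)
  then have "2 * pi * P = 2 * pi * (\<alpha> * \<beta> * (3 * P - 1))" by simp
  then have dens: "2 * pi / \<alpha> = 3 * (2 * pi * \<beta>) - \<delta>"
    unfolding \<delta>_def using \<alpha> P by (simp add: field_simps)
  obtain A B :: real where A: "A > 0" and B: "B > 0"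
    and low: "\<And>R f. cc R f \<Longrightarrow> (\<integral>\<^sup>+x. ennreal ((cmod (f x))\<^sup>2) \<partial>lborel) \<le> ennreal A * gabor_energy \<alpha> \<beta> f"
    and up: "\<And>R f. cc R f \<Longrightarrow> gabor_energy \<alpha> \<beta> f \<le> ennreal B * (\<integral>\<^sup>+x. ennreal ((cmod (f x))\<^sup>2) \<partial>lborel)"
    by (rule cc_frame_bounds[OF \<alpha> \<beta> \<delta> dens], blast)
  let ?e = "gabor_system g \<alpha> \<beta>"
  define q where "q = (\<lambda>f i. (cmod (L2_inner f (?e i)))\<^sup>2)"
  have nrm: "(\<integral>\<^sup>+x. ennreal ((cmod (f x))\<^sup>2) \<partial>lborel) = ennreal ((L2_norm f)\<^sup>2)" if f: "cc R f" for R f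
  proof -
    have "integrable lebesgue (\<lambda>x. (cmod (f x))\<^sup>2)" using cc_L2[OF f] unfolding L2_space_def by simp
    then have "(\<integral>\<^sup>+x. ennreal ((cmod (f x))\<^sup>2) \<partial>lebesgue) = ennreal ((L2_norm f)\<^sup>2)"
      unfolding L2_norm_power2 by (rule nn_integral_eq_integral) simp
    then show ?thesis unfolding nn_integral_completion .
  qed
  have q0: "q f i \<ge> 0" for f i unfolding q_def by simp
  have en: "(\<integral>\<^sup>+i. ennreal (q f i) \<partial>count_space UNIV) = gabor_energy \<alpha> \<beta> f" if f: "cc R f" for R f
    unfolding q_def gw by (rule gabor_energy_eq[OF f])
  have fin: "(\<integral>\<^sup>+i. ennreal (q f i) \<partial>count_space UNIV) < \<infinity>" if f: "cc R f" for R f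
    unfolding en[OF f] using up[OF f] unfolding nrm[OF f]
    by (rule le_less_trans) (simp add: ennreal_mult_less_top)
  note sums = nn_integral_count_space_infsum[OF q0 fin]
  have i0: "0 \<le> infsum (q f) UNIV" for f by (rule infsum_nonneg) (rule q0)
  show ?thesis
  proof (rule L2_frame_dense[of ?e "{f. \<exists>R. cc R f}" A B])
    show "?e i \<in> L2_space" for i unfolding gw by (rule gabor_system_L2)
    show "{f. \<exists>R. cc R f} \<subseteq> L2_space" using cc_L2 by blast
    show "\<exists>\<phi>\<in>{f. \<exists>R. cc R f}. (L2_norm (\<lambda>x. f x - \<phi> x))\<^sup>2 \<le> \<epsilon>" if "f \<in> L2_space" "\<epsilon> > 0" for f \<epsilon>
      by (rule cc_dense[OF that])
    show "(\<lambda>i. (cmod (L2_inner f (?e i)))\<^sup>2) summable_on UNIV" if "f \<in> {f. \<exists>R. cc R f}" for f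
      using that sums(1) unfolding q_def by blast
    show "(L2_norm f)\<^sup>2 \<le> A * (\<Sum>\<^sub>\<infinity>i. (cmod (L2_inner f (?e i)))\<^sup>2)" if D: "f \<in> {f. \<exists>R. cc R f}" for f
    proof -
      obtain R where f: "cc R f" using D by blast
      have "ennreal ((L2_norm f)\<^sup>2) \<le> ennreal (A * infsum (q f) UNIV)"
        using low[OF f] A i0 unfolding nrm[OF f] en[OF f, symmetric] sums(2)[OF f]
        by (simp add: ennreal_mult)
      then have "(L2_norm f)\<^sup>2 \<le> A * infsum (q f) UNIV" using A i0 by (simp add: ennreal_le_iff)
      then show ?thesis unfolding q_def .
    qed
    show "(\<Sum>\<^sub>\<infinity>i. (cmod (L2_inner f (?e i)))\<^sup>2) \<le> B * (L2_norm f)\<^sup>2" if D: "f \<in> {f. \<exists>R. cc R f}" for f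
    proof -
      obtain R where f: "cc R f" using D by blast
      have "ennreal (infsum (q f) UNIV) \<le> ennreal (B * (L2_norm f)\<^sup>2)"
        using up[OF f] B unfolding nrm[OF f] en[OF f, symmetric] sums(2)[OF f]
        by (simp add: ennreal_mult)
      then have "infsum (q f) UNIV \<le> B * (L2_norm f)\<^sup>2" using B by (simp add: ennreal_le_iff)
      then show ?thesis unfolding q_def .
    qed
  qed (use A B in auto)
qed

end
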